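(* Let $K$ be a field, $S=K[x_1,\ldots,x_n]$ the standard graded polynomial ring, $J\subset I\subset S$ graded ideals, $M$ a finitely generated graded $S$-module and $N\subset M$ a graded submodule. Let $d$ be the limit dimension of the family $(I^kM/J^kN)_{k\ge 0}$. Then the limit $$\lim_{k\to\infty}\frac{e_0(I^kM/J^kN)}{k^{n-d}}$$ exists and is a rational number.
   Context: For a finitely generated graded $S$-module $N$ of dimension $d$, put $H(N,i)=\sum_{j\le i}\dim_K N_j$; for $i\gg 0$ this agrees with a polynomial of degree $d$, written $P_N(x)=\sum_{i=0}^{d}(-1)^i e_i(N)\binom{x+d-i}{d-i}$, and $e_0(N)$ is the multiplicity of $N$ (with $e_0(0)=0$). A family $(M_k)_{k\ge 0}$ of finitely generated $S$-modules has limit dimension $d$ if there is $k_0$ such that $\dim M_k=d$ for all $k\ge k_0$; the family $(I^kM/J^kN)_{k\ge 0}$ is known to have a limit dimension. *)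

theory Defs
  imports
    "Jordan_Normal_Form.VS_Connect"
    "HOL-Library.Poly_Mapping"
    "HOL-Library.Cardinality"
    "HOL-Algebra.Ideal_Product"
begin

text \<open>
  The polynomial ring $K[x_1,\ldots,x_n]$ is the monoid algebra of the exponent vectors
  \<open>'n \<Rightarrow>\<^sub>0 nat\<close>, where \<open>'n\<close> is a finite type with \<open>n = CARD('n)\<close> elements.
\<close>

type_synonym ('n, 'k) mpoly = "('n \<Rightarrow>\<^sub>0 nat) \<Rightarrow>\<^sub>0 'k"

abbreviation mpoly_ring :: "('n::finite, 'k::field) mpoly ring"  (\<open>\<S>\<close>)
  where "mpoly_ring \<equiv> class_ring"

definition mono_deg :: "('n::finite \<Rightarrow>\<^sub>0 nat) \<Rightarrow> nat"
  where "mono_deg m = (\<Sum>x\<in>UNIV. Poly_Mapping.lookup m x)"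

definition mpoly_hom_component :: "nat \<Rightarrow> ('n::finite, 'k::field) mpoly set"
  where "mpoly_hom_component i = {f. \<forall>m\<in>Poly_Mapping.keys f. mono_deg m = i}"

definition mpoly_hom_part :: "nat \<Rightarrow> ('n::finite, 'k::field) mpoly \<Rightarrow> ('n, 'k) mpoly"
  where "mpoly_hom_part i f =
    (\<Sum>m\<in>{m \<in> Poly_Mapping.keys f. mono_deg m = i}. Poly_Mapping.single m (Poly_Mapping.lookup f m))"

definition mpoly_const :: "'k::field \<Rightarrow> ('n::finite, 'k) mpoly"
  where "mpoly_const c = Poly_Mapping.single 0 c"

definition graded_ideal :: "('n::finite, 'k::field) mpoly set \<Rightarrow> bool"
  where "graded_ideal I \<longleftrightarrow> ideal I \<S> \<and> (\<forall>f\<in>I. \<forall>i. mpoly_hom_part i f \<in> I)"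


text \<open>Graded modules are \<open>\<int>\<close>-graded; the record carries the homogeneous components.\<close>

record ('a, 'b) graded_module = "('a, 'b) module" +
  component :: "int \<Rightarrow> 'b set"

definition hom_decomposition ::
    "('a, 'b, 'c) graded_module_scheme \<Rightarrow> 'b \<Rightarrow> (int \<Rightarrow> 'b) \<Rightarrow> bool"
  where "hom_decomposition M x c \<longleftrightarrow>
    (\<forall>j. c j \<in> component M j) \<and> finite {j. c j \<noteq> \<zero>\<^bsub>M\<^esub>} \<and>
    x = (\<Oplus>\<^bsub>M\<^esub> j\<in>{j. c j \<noteq> \<zero>\<^bsub>M\<^esub>}. c j)"

locale graded_module =
  Module.module "\<S> :: ('n::finite, 'k::field) mpoly ring" M
  for M :: "(('n::finite, 'k::field) mpoly, 'm) graded_module" (structure) +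
  assumes component_subgroup: "additive_subgroup (component M j) M"
    and decomposition: "x \<in> carrier M \<Longrightarrow> \<exists>!c. hom_decomposition M x c"
    and smult_component:
      "f \<in> mpoly_hom_component i \<Longrightarrow> x \<in> component M j \<Longrightarrow> f \<odot> x \<in> component M (int i + j)"

definition fin_gen_module :: "(('n::finite, 'k::field) mpoly, 'm) graded_module \<Rightarrow> bool"
  where "fin_gen_module M \<longleftrightarrow>
    (\<exists>X. finite X \<and> X \<subseteq> carrier M \<and> LinearCombinations.module.span \<S> M X = carrier M)"

definition graded_submodule ::
    "'m set \<Rightarrow> (('n::finite, 'k::field) mpoly, 'm) graded_module \<Rightarrow> bool"
  where "graded_submodule N M \<longleftrightarrow> LinearCombinations.submodule \<S> N M \<and>
    (\<forall>x\<in>N. \<forall>c. hom_decomposition M x c \<longrightarrow> (\<forall>j. c j \<in> N))"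

definition restrict_graded :: "('a, 'b) graded_module \<Rightarrow> 'b set \<Rightarrow> ('a, 'b) graded_module"
  where "restrict_graded M N = M\<lparr>carrier := N, component := (\<lambda>j. component M j \<inter> N)\<rparr>"

text \<open>
  The fields \<open>mult\<close> and \<open>one\<close>, which a module record inherits from rings, play no role.
\<close>

definition quotient_graded :: "('a, 'b) graded_module \<Rightarrow> 'b set \<Rightarrow> ('a, 'b set) graded_module"
  where "quotient_graded M N =
    \<lparr>carrier = a_rcosets\<^bsub>M\<^esub> N, mult = (\<lambda>_ _. N), one = N,
     zero = N, add = set_add M,
     smult = (\<lambda>a X. \<Union>x\<in>X. N +>\<^bsub>M\<^esub> (a \<odot>\<^bsub>M\<^esub> x)),
     component = (\<lambda>j. (\<lambda>x. N +>\<^bsub>M\<^esub> x) ` component M j)\<rparr>"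

definition ideal_smult ::
    "('n::finite, 'k::field) mpoly set \<Rightarrow> (('n, 'k) mpoly, 'm) graded_module \<Rightarrow> 'm set \<Rightarrow> 'm set"
  where "ideal_smult I M N = LinearCombinations.module.span \<S> M {f \<odot>\<^bsub>M\<^esub> x | f x. f \<in> I \<and> x \<in> N}"

definition power_quotient ::
    "('n::finite, 'k::field) mpoly set \<Rightarrow> ('n, 'k) mpoly set \<Rightarrow>
     (('n, 'k) mpoly, 'm) graded_module \<Rightarrow> 'm set \<Rightarrow> nat \<Rightarrow>
     (('n, 'k) mpoly, 'm set) graded_module"
  where "power_quotient I J M N k =
    quotient_graded
      (restrict_graded M (ideal_smult (I [^]\<^bsub>ideals_set \<S>\<^esub> k) M (carrier M)))
      (ideal_smult (J [^]\<^bsub>ideals_set \<S>\<^esub> k) M N)"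


definition annihilator :: "('a, 'c) ring_scheme \<Rightarrow> ('a, 'b, 'd) module_scheme \<Rightarrow> 'a set"
  where "annihilator R M = {a \<in> carrier R. \<forall>x\<in>carrier M. a \<odot>\<^bsub>M\<^esub> x = \<zero>\<^bsub>M\<^esub>}"

text \<open>
  Krull dimension of \<open>R / Ann M\<close>: the chain $P_0 \subset \cdots \subset P_l$ has \<open>l + 1\<close>
  members. The empty chain is admitted, so the zero module has dimension \<open>-1\<close>.
  The supremum on \<^typ>\<open>nat\<close> is meaningful when \<open>R / Ann M\<close> has finite Krull dimension,
  as is the case over \<open>\<S>\<close>.
\<close>

definition module_dim :: "('a, 'c) ring_scheme \<Rightarrow> ('a, 'b, 'd) module_scheme \<Rightarrow> int"
  where "module_dim R M =
    int (Sup {card C | C. finite C \<and>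
      subset.chain {P. primeideal P R \<and> annihilator R M \<subseteq> P} C}) - 1"

definition has_limit_dimension ::
    "(nat \<Rightarrow> (('n::finite, 'k::field) mpoly, 'm) graded_module) \<Rightarrow> int \<Rightarrow> bool"
  where "has_limit_dimension Ms d \<longleftrightarrow> (\<exists>k0. \<forall>k\<ge>k0. module_dim \<S> (Ms k) = d)"


definition component_space ::
    "(('n::finite, 'k::field) mpoly, 'm) graded_module \<Rightarrow> int \<Rightarrow> ('k, 'm) module"
  where "component_space M j =
    \<lparr>carrier = component M j, mult = mult M, one = one M, zero = zero M, add = add M,
     smult = (\<lambda>c x. mpoly_const c \<odot>\<^bsub>M\<^esub> x)\<rparr>"

definition component_dim ::
    "(('n::finite, 'k::field) mpoly, 'm) graded_module \<Rightarrow> int \<Rightarrow> nat"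
  where "component_dim M j = vectorspace.dim class_ring (component_space M j)"

text \<open>
  For finitely generated \<open>M\<close>, only finitely many \<open>j \<le> i\<close> have a nonzero component.
\<close>

definition hilbert_sum ::
    "(('n::finite, 'k::field) mpoly, 'm) graded_module \<Rightarrow> int \<Rightarrow> nat"
  where "hilbert_sum M i = (\<Sum>j\<in>{j. j \<le> i \<and> component_dim M j \<noteq> 0}. component_dim M j)"

text \<open>
  With \<open>d = module_dim \<S> M\<close> the index set \<open>{..<nat (d + 1)}\<close> is \<open>{0..d}\<close>,
  which is empty for the zero module.
\<close>

definition is_hilbert_coeffs ::
    "(('n::finite, 'k::field) mpoly, 'm) graded_module \<Rightarrow> (nat \<Rightarrow> real) \<Rightarrow> bool"
  where "is_hilbert_coeffs M e \<longleftrightarrow>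
    (let d = module_dim \<S> M in
      (\<forall>i. int i > d \<longrightarrow> e i = 0) \<and>
      (\<forall>\<^sub>F x in at_top. real (hilbert_sum M x) =
        (\<Sum>i<nat (d + 1). (-1) ^ i * e i *
           ((of_int x + of_int d - of_nat i) gchoose nat (d - int i)))))"

definition hilbert_coeff ::
    "(('n::finite, 'k::field) mpoly, 'm) graded_module \<Rightarrow> nat \<Rightarrow> real"
  where "hilbert_coeff M = (THE e. is_hilbert_coeffs M e)"

definition multiplicity_module ::
    "(('n::finite, 'k::field) mpoly, 'm) graded_module \<Rightarrow> real"
  where "multiplicity_module M = hilbert_coeff M 0"

end

theory Submission
  imports Defs
begin

text \<open>
  Write the components of \<open>I\<^sup>k M\<close> as spans of the elements \<open>x\<^sup>a f\<^sup>b g\<^sub>l\<close> with \<open>|b| = k\<close>, where \<open>f\<close> are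
  homogeneous generators of \<open>I\<close> and \<open>g\<^sub>l\<close> those of \<open>M\<close>. Call such an element standard if it is not a linear
  combination of lexicographically smaller ones of the same bidegree. The standard elements form
  bases, and their exponents are closed under taking divisors. By Dickson's lemma, counting the exponents
  \<open>(a, b)\<close> in a downward closed set with \<open>|b| = k\<close> and \<open>x\<^sup>a f\<^sup>b\<close> of degree at most \<open>i\<close> gives a rational
  polynomial in \<open>(i, k)\<close> on a region \<open>k \<ge> k\<^sub>0\<close>, \<open>i \<ge> W k + c\<close>. Hence so does the Hilbert sum of
  \<open>I\<^sup>k M / J\<^sup>k N\<close>. As this sum is \<open>O(i\<^sup>n)\<close> uniformly in \<open>k\<close>, the polynomial has total degree at most \<open>n\<close>. For fixed
  \<open>k\<close> its degree in \<open>i\<close> is at most the Krull dimension \<open>d\<close>, so \<open>e\<^sub>0\<close> is \<open>d!\<close> times the coefficient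
  of \<open>i\<^sup>d\<close>, which is a rational polynomial in \<open>k\<close> of degree at most \<open>n - d\<close>.

  The bound by the Krull dimension is proved by noetherian induction on a graded ideal \<open>A\<close>: if \<open>A\<close> is not
  prime there are homogeneous \<open>f, g \<notin> A\<close> with \<open>f g \<in> A\<close>, and one passes to \<open>A + (f)\<close> and \<open>A + (g)\<close>; if \<open>A\<close> is
  prime and omits a variable \<open>x\<close>, then chains of primes above \<open>A + (x)\<close> are shorter. Prime chains
  have at most \<open>n + 1\<close> members, since picking an element in each step of the chain produces
  algebraically independent polynomials.
\<close>


text \<open>All powers \<open>k\<close> are treated at once because a Hilbert polynomial for each
  single \<open>k\<close> says nothing about how it varies with \<open>k\<close>. Multiplication by
  monomials respects the order and adds bidegrees, so one downward closed set of exponents per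
  generator of \<open>M\<close> records every \<open>I^k M\<close>. Comparisons take place only
  inside one bidegree, which has finitely many exponents.

  The region \<open>i >= W k + c\<close> comes from the generators of \<open>I\<close>: one of
  degree \<open>e\<close> shifts the bidegree by \<open>(e, 1)\<close>, so the count may change its
  shape along a line of slope \<open>e\<close>, and \<open>W\<close> bounds all these slopes. The
  bound \<open>O(i^n)\<close> is uniform because \<open>I^k M / J^k N\<close> is in each degree no
  larger than \<open>M\<close>.

  The Krull dimension enters only as an upper bound for the degree in \<open>i\<close>. A polynomial
  of degree at most \<open>d\<close> has a unique expansion in the binomial basis even if its top
  coefficient is zero, so \<open>e_0\<close> can be read off without deciding whether degree and
  dimension agree. For \<open>0 <= d <= n\<close> the limit is \<open>d!\<close> times the
  coefficient of \<open>i^d k^(n-d)\<close>.\<close>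

abbreviation lookup :: "('a \<Rightarrow>\<^sub>0 'b::zero) \<Rightarrow> 'a \<Rightarrow> 'b" where "lookup \<equiv> Poly_Mapping.lookup"
abbreviation keys :: "('a \<Rightarrow>\<^sub>0 'b::zero) \<Rightarrow> 'a set" where "keys \<equiv> Poly_Mapping.keys"
abbreviation single :: "'a \<Rightarrow> 'b \<Rightarrow> ('a \<Rightarrow>\<^sub>0 'b::zero)" where "single \<equiv> Poly_Mapping.single"

section \<open>Counting exponents in downward closed sets\<close>

text \<open>A non-increasing subsequence of naturals is constant from where it attains its minimum,
  so either kind of monotone subsequence yields a non-decreasing one.\<close>

lemma nat_seq_mono_subseq:
  fixes f :: "nat \<Rightarrow> nat"
  shows "\<exists>r::nat \<Rightarrow> nat. strict_mono r \<and> (\<forall>i j. i \<le> j \<longrightarrow> f (r i) \<le> f (r j))"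
proof -
  obtain r where r: "strict_mono r" "monoseq (\<lambda>n. f (r n))"
    using seq_monosub[of f] by auto
  show ?thesis
  proof (cases "\<forall>m. \<forall>n\<ge>m. f (r m) \<le> f (r n)")
    case True
    then show ?thesis using r(1) by auto
  next
    case False
    then have dec: "\<forall>m. \<forall>n\<ge>m. f (r n) \<le> f (r m)" using r(2) by (auto simp: monoseq_def)
    obtain N where N: "\<And>n. f (r N) \<le> f (r n)"
      using ex_has_least_nat[of "\<lambda>_. True" 0 "\<lambda>n. f (r n)"] by auto
    have "strict_mono (\<lambda>i. r (N + i))" using r(1) by (auto simp: strict_mono_def)
    moreover have "f (r (N + i)) \<le> f (r (N + j))" for i j
      using dec N by (meson le_add1 order_trans)
    ultimately show ?thesis by (intro exI[of _ "\<lambda>i. r (N + i)"]) auto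
  qed
qed

lemma coordinatewise_mono_subseq:
  fixes g :: "nat \<Rightarrow> 'a \<Rightarrow> nat"
  assumes "finite V"
  shows "\<exists>r::nat \<Rightarrow> nat. strict_mono r \<and> (\<forall>s\<in>V. \<forall>i j. i \<le> j \<longrightarrow> g (r i) s \<le> g (r j) s)"
  using assms
proof (induction V)
  case empty
  then show ?case by (intro exI[of _ id]) (auto simp: strict_mono_def)
next
  case (insert a V)
  then obtain r :: "nat \<Rightarrow> nat" where r: "strict_mono r" "\<forall>s\<in>V. \<forall>i j. i \<le> j \<longrightarrow> g (r i) s \<le> g (r j) s" by auto
  obtain q :: "nat \<Rightarrow> nat" where q: "strict_mono q" "\<forall>i j. i \<le> j \<longrightarrow> g (r (q i)) a \<le> g (r (q j)) a"
    using nat_seq_mono_subseq[of "\<lambda>i. g (r i) a"] by auto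
  have "q i \<le> q j" if "i \<le> j" for i j using q(1) that by (simp add: strict_mono_less_eq)
  then have "\<forall>s\<in>insert a V. \<forall>i j. i \<le> j \<longrightarrow> g ((r \<circ> q) i) s \<le> g ((r \<circ> q) j) s"
    using r(2) q(2) unfolding comp_def by blast
  then show ?case using strict_mono_o[OF r(1) q(1)] by blast
qed

text \<open>Dickson's lemma in the form that every sequence contains an earlier member dividing a
  later one. It is the source of three finiteness facts: stabilising slices, well-foundedness of the
  monomial order and the Hilbert basis theorem.\<close>

lemma dickson:
  fixes g :: "nat \<Rightarrow> ('a \<Rightarrow>\<^sub>0 nat)"
  assumes "finite V" and "\<And>i. keys (g i) \<subseteq> V"
  shows "\<exists>i j. i < j \<and> (\<forall>s. lookup (g i) s \<le> lookup (g j) s)"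
proof -
  obtain r :: "nat \<Rightarrow> nat" where r: "strict_mono r"
    "\<forall>s\<in>V. \<forall>i j. i \<le> j \<longrightarrow> lookup (g (r i)) s \<le> lookup (g (r j)) s"
    using coordinatewise_mono_subseq[OF assms(1), of "\<lambda>i. lookup (g i)"] by auto
  have "lookup (g (r 0)) s \<le> lookup (g (r 1)) s" for s
  proof (cases "s \<in> V")
    case False
    then have "lookup (g (r 0)) s = 0" using assms(2) by (meson in_keys_iff subsetD)
    then show ?thesis by simp
  qed (use r in auto)
  moreover have "r 0 < r 1" using r(1) by (simp add: strict_mono_def)
  ultimately show ?thesis by blast
qed

section \<open>Descending chains of downward closed sets of exponents\<close>

definition downclosed :: "('a \<Rightarrow>\<^sub>0 nat) set \<Rightarrow> bool"
  where "downclosed D \<longleftrightarrow> (\<forall>v\<in>D. \<forall>u. (\<forall>s. lookup u s \<le> lookup v s) \<longrightarrow> u \<in> D)"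

lemma downclosedD: "downclosed D \<Longrightarrow> v \<in> D \<Longrightarrow> (\<And>s. lookup u s \<le> lookup v s) \<Longrightarrow> u \<in> D"
  by (auto simp: downclosed_def)

text \<open>Choose an element lost at each strict drop. By Dickson an earlier choice divides a later
  one, and the later one still lies in the set that the earlier one has left, against downward
  closure.\<close>

lemma downclosed_chain_stabilises:
  fixes D :: "nat \<Rightarrow> ('a \<Rightarrow>\<^sub>0 nat) set"
  assumes "finite V" and supp: "\<And>t v. v \<in> D t \<Longrightarrow> keys v \<subseteq> V"
    and down: "\<And>t. downclosed (D t)" and dec: "\<And>t. D (Suc t) \<subseteq> D t"
  shows "\<exists>t0. \<forall>t\<ge>t0. D t = D t0"
proof (rule ccontr)
  assume "\<not> ?thesis"
  then have "\<forall>t0. \<exists>t. t \<ge> t0 \<and> D t \<noteq> D t0" by auto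
  then obtain nx where nx: "\<And>t0. nx t0 \<ge> t0 \<and> D (nx t0) \<noteq> D t0" by metis
  have sub: "D t \<subseteq> D s" if "s \<le> t" for s t using lift_Suc_antimono_le[of D] dec that by blast
  have "\<exists>u. u \<in> D t \<and> u \<notin> D (nx t)" for t using nx[of t] sub[of t "nx t"] by blast
  then obtain u where u: "\<And>t. u t \<in> D t \<and> u t \<notin> D (nx t)" by metis
  define \<tau> where "\<tau> i = (nx ^^ i) 0" for i
  have \<tau>S: "\<tau> (Suc i) = nx (\<tau> i)" for i by (simp add: \<tau>_def)
  have mono: "\<tau> i \<le> \<tau> j" if "i \<le> j" for i j
    using lift_Suc_mono_le[of \<tau>] nx \<tau>S that by auto
  obtain i j where ij: "i < j" "\<forall>s. lookup (u (\<tau> i)) s \<le> lookup (u (\<tau> j)) s"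
    using dickson[OF assms(1), of "\<lambda>i. u (\<tau> i)"] supp u by blast
  have "u (\<tau> j) \<in> D (nx (\<tau> i))"
    using u[of "\<tau> j"] sub[of "\<tau> (Suc i)" "\<tau> j"] mono[of "Suc i" j] ij(1) \<tau>S by auto
  then have "u (\<tau> i) \<in> D (nx (\<tau> i))" using downclosedD[OF down] ij(2) by blast
  then show False using u by blast
qed

text \<open>Rational polynomials in two variables are kept as functions, so that sums, products,
  substitutions and partial sums become closure rules. Coefficients are recovered once, in
  \<open>bipoly_normal_form\<close>.\<close>

inductive bipoly :: "(real \<Rightarrow> real \<Rightarrow> real) \<Rightarrow> bool" where
  bipoly_monom: "c \<in> \<rat> \<Longrightarrow> bipoly (\<lambda>x y. c * x ^ a * y ^ b)"
| bipoly_add: "bipoly f \<Longrightarrow> bipoly g \<Longrightarrow> bipoly (\<lambda>x y. f x y + g x y)"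

lemma bipoly_const: "c \<in> \<rat> \<Longrightarrow> bipoly (\<lambda>x y. c)"
  using bipoly_monom[of c 0 0] by simp

lemma bipoly_fst: "bipoly (\<lambda>x y. x)" using bipoly_monom[of 1 1 0] by simp

lemma bipoly_snd: "bipoly (\<lambda>x y. y)" using bipoly_monom[of 1 0 1] by simp

lemma bipoly_mult_monom: "bipoly f \<Longrightarrow> c \<in> \<rat> \<Longrightarrow> bipoly (\<lambda>x y. f x y * (c * x ^ a * y ^ b))"
proof (induction rule: bipoly.induct)
  case (bipoly_monom d a' b')
  have "(\<lambda>x y. d * x ^ a' * y ^ b' * (c * x ^ a * y ^ b)) =
      (\<lambda>x y. (d * c) * x ^ (a' + a) * y ^ (b' + b))" by (auto simp: power_add algebra_simps)
  then show ?case using bipoly.bipoly_monom[of "d * c"] bipoly_monom by simp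
next
  case (bipoly_add f g)
  then show ?case using bipoly.bipoly_add by (simp add: distrib_right)
qed

lemma bipoly_mult: "bipoly g \<Longrightarrow> bipoly f \<Longrightarrow> bipoly (\<lambda>x y. f x y * g x y)"
proof (induction rule: bipoly.induct)
  case (bipoly_monom d a' b')
  then show ?case using bipoly_mult_monom by blast
next
  case (bipoly_add f g)
  then show ?case using bipoly.bipoly_add by (simp add: distrib_left)
qed

lemma bipoly_power: "bipoly f \<Longrightarrow> bipoly (\<lambda>x y. f x y ^ n)"
  by (induction n) (auto intro: bipoly_const bipoly_mult)

lemma bipoly_scale: "c \<in> \<rat> \<Longrightarrow> bipoly f \<Longrightarrow> bipoly (\<lambda>x y. c * f x y)"
  using bipoly_mult[of f "\<lambda>x y. c"] bipoly_const by simp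

lemma bipoly_diff: "bipoly f \<Longrightarrow> bipoly g \<Longrightarrow> bipoly (\<lambda>x y. f x y - g x y)"
  using bipoly_add[of f "\<lambda>x y. (-1) * g x y"] bipoly_scale[of "-1" g] by simp

lemma bipoly_sum: "(\<And>t. t \<in> A \<Longrightarrow> bipoly (f t)) \<Longrightarrow> bipoly (\<lambda>x y. \<Sum>t\<in>A. f t x y)"
  by (induction A rule: infinite_finite_induct) (auto intro: bipoly_const bipoly_add)

lemma bipoly_subst:
  "bipoly f \<Longrightarrow> bipoly g \<Longrightarrow> bipoly h \<Longrightarrow> bipoly (\<lambda>x y. f (g x y) (h x y))"
proof (induction rule: bipoly.induct)
  case (bipoly_monom c a b)
  then show ?case by (intro bipoly_mult bipoly_power bipoly_const) auto
next
  case (bipoly_add f g)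
  then show ?case using bipoly.bipoly_add by auto
qed

text \<open>Telescoping \<open>(t + 1)^(b + 1) - t^(b + 1)\<close> expresses the \<open>b\<close>-th
  power sum by the lower ones; the only division is by \<open>b + 1\<close>, so the coefficients
  stay rational.\<close>

lemma power_sum_bipoly:
  "\<exists>p. bipoly (\<lambda>x y. p y) \<and> (\<forall>k::nat. (\<Sum>t<k. real t ^ b) = p (real k))"
proof (induction b rule: less_induct)
  case (less b)
  then obtain p where p: "\<And>j. j < b \<Longrightarrow> bipoly (\<lambda>x y. p j y)"
    "\<And>j k. j < b \<Longrightarrow> (\<Sum>t<k. real t ^ j) = p j (real k)" by metis
  define q where "q y = (1 / (real b + 1)) * (y ^ (b + 1) - (\<Sum>j<b. real (Suc b choose j) * p j y))" for y
  have "bipoly (\<lambda>x y. q y)" unfolding q_def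
    by (intro bipoly_scale bipoly_diff bipoly_power bipoly_snd bipoly_sum p(1)) auto
  moreover have "(\<Sum>t<k. real t ^ b) = q (real k)" for k
  proof -
    have step: "(real t + 1) ^ Suc b - real t ^ Suc b
        = (\<Sum>j<b. real (Suc b choose j) * real t ^ j) + real (Suc b) * real t ^ b" for t
    proof -
      have "(real t + 1) ^ Suc b = (\<Sum>j\<le>Suc b. real (Suc b choose j) * real t ^ j)"
        using binomial_ring[of "real t" 1 "Suc b"] by simp
      also have "\<dots> = (\<Sum>j<b. real (Suc b choose j) * real t ^ j)
          + real (Suc b choose b) * real t ^ b + real t ^ Suc b"
        by (simp only: atMost_Suc lessThan_Suc_atMost[symmetric] lessThan_Suc) simp
      finally show ?thesis by (simp add: binomial_Suc_n)
    qed
    have "real k ^ Suc b = (\<Sum>t<k. (real t + 1) ^ Suc b - real t ^ Suc b)"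
      using sum_lessThan_telescope[of "\<lambda>t. real t ^ Suc b" k] by (simp add: add.commute)
    also have "\<dots> = (\<Sum>t<k. \<Sum>j<b. real (Suc b choose j) * real t ^ j) + real (Suc b) * (\<Sum>t<k. real t ^ b)"
      unfolding step by (simp add: sum.distrib sum_distrib_left)
    also have "(\<Sum>t<k. \<Sum>j<b. real (Suc b choose j) * real t ^ j) = (\<Sum>j<b. real (Suc b choose j) * p j (real k))"
      by (subst sum.swap) (simp add: p(2) sum_distrib_left[symmetric])
    finally show ?thesis by (simp add: q_def field_simps)
  qed
  ultimately show ?case by blast
qed

lemma bipoly_partial_sum:
  "bipoly f \<Longrightarrow> \<exists>g. bipoly g \<and> (\<forall>x. \<forall>k::nat. (\<Sum>t<k. f x (real t)) = g x (real k))"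
proof (induction rule: bipoly.induct)
  case (bipoly_monom c a b)
  obtain p where p: "bipoly (\<lambda>x y. p y)" "\<And>k::nat. (\<Sum>t<k. real t ^ b) = p (real k)"
    using power_sum_bipoly by blast
  have "bipoly (\<lambda>x y. c * x ^ a * p y)"
    by (intro bipoly_mult bipoly_scale bipoly_power bipoly_fst bipoly_monom p(1) bipoly_const)
  moreover have "(\<Sum>t<k. c * x ^ a * real t ^ b) = c * x ^ a * p (real k)" for x and k :: nat
    by (simp add: p(2)[symmetric] sum_distrib_left)
  ultimately show ?case by blast
next
  case (bipoly_add f g)
  then obtain f' g' where "bipoly f'" "bipoly g'"
    "\<forall>x. \<forall>k::nat. (\<Sum>t<k. f x (real t)) = f' x (real k)"
    "\<forall>x. \<forall>k::nat. (\<Sum>t<k. g x (real t)) = g' x (real k)" by blast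
  then show ?case
    by (intro exI[of _ "\<lambda>x y. f' x y + g' x y"]) (auto intro: bipoly.bipoly_add simp: sum.distrib)
qed

lemma sum_lessThan_add:
  fixes f :: "nat \<Rightarrow> 'a::comm_monoid_add"
  shows "(\<Sum>t<a + b. f t) = (\<Sum>t<a. f t) + (\<Sum>t<b. f (a + t))"
  by (induction b) (auto simp: add.assoc)

text \<open>A polynomial in one variable is written as a \<open>bipoly\<close> that ignores its
  second argument, so that one set of closure rules serves both cases.\<close>

definition eventually_poly :: "(int \<Rightarrow> nat) \<Rightarrow> bool" where
  "eventually_poly f \<longleftrightarrow>
    (\<exists>p c. bipoly (\<lambda>x y. p x) \<and> (\<forall>i\<ge>c. real (f i) = p (real_of_int i)))"

lemma eventually_polyI:
  "bipoly (\<lambda>x y. p x) \<Longrightarrow> (\<And>i. i \<ge> c \<Longrightarrow> real (f i) = p (real_of_int i)) \<Longrightarrow> eventually_poly f"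
  unfolding eventually_poly_def by blast

lemma eventually_poly_add:
  assumes "eventually_poly f" "eventually_poly g"
  shows "eventually_poly (\<lambda>i. f i + g i)"
proof -
  obtain p c q d where "bipoly (\<lambda>x y. p x)" "\<forall>i\<ge>c. real (f i) = p (real_of_int i)"
    "bipoly (\<lambda>x y. q x)" "\<forall>i\<ge>d. real (g i) = q (real_of_int i)"
    using assms unfolding eventually_poly_def by blast
  then show ?thesis
    by (intro eventually_polyI[of "\<lambda>x. p x + q x" "max c d"] bipoly_add) auto
qed

lemma eventually_poly_eq_const:
  assumes "\<And>i. i \<ge> c \<Longrightarrow> f i = m"
  shows "eventually_poly f"
  by (rule eventually_polyI[of "\<lambda>x. real m" c]) (auto intro: bipoly_const simp: assms)

lemma eventually_poly_sum:
  "(\<And>t. t \<in> A \<Longrightarrow> eventually_poly (f t)) \<Longrightarrow> eventually_poly (\<lambda>i. \<Sum>t\<in>A. f t i)"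
  by (induction A rule: infinite_finite_induct)
     (auto intro: eventually_poly_add eventually_poly_eq_const[of 0 _ 0])

lemma eventually_poly_shift:
  assumes "eventually_poly f"
  shows "eventually_poly (\<lambda>i. f (i - s))"
proof -
  obtain p c where p: "bipoly (\<lambda>x y. p x)" "\<forall>i\<ge>c. real (f i) = p (real_of_int i)"
    using assms unfolding eventually_poly_def by blast
  have "bipoly (\<lambda>x y. p (x - real_of_int s))"
    by (rule bipoly_subst[OF p(1), of "\<lambda>x y. x - real_of_int s" "\<lambda>x y. y"])
      (auto intro!: bipoly_diff bipoly_fst bipoly_const bipoly_snd)
  then show ?thesis using p(2) by (intro eventually_polyI[of _ "c + s"]) auto
qed

lemma eventually_poly_partial_sum:
  assumes "eventually_poly f"
  shows "eventually_poly (\<lambda>i. \<Sum>t<nat (i + 1). f (i - int t))"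
proof -
  obtain p c0 where p: "bipoly (\<lambda>x y. p x)" "\<forall>i\<ge>c0. real (f i) = p (real_of_int i)"
    using assms unfolding eventually_poly_def by blast
  define c where "c = nat c0"
  have pc: "real (f (int j)) = p (real j)" if "j \<ge> c" for j using p(2) that by (auto simp: c_def)
  have bp: "bipoly (\<lambda>x y. p (real c + y))"
    by (rule bipoly_subst[OF p(1), of "\<lambda>x y. real c + y" "\<lambda>x y. y"])
      (auto intro!: bipoly_add bipoly_snd bipoly_const)
  obtain g where g: "bipoly g" "\<And>x. \<And>k::nat. (\<Sum>t<k. p (real c + real t)) = g x (real k)"
    using bipoly_partial_sum[OF bp] by blast
  \<comment> \<open>The sum always reaches down to the arguments below \<open>c\<close>, where
    \<open>f\<close> need not agree with \<open>p\<close>. They contribute the constant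
    \<open>A\<close>, a sum of naturals and hence rational.\<close>
  define A where "A = (\<Sum>j<c. real (f (int j)))"
  have "A \<in> \<rat>" unfolding A_def by (intro Rats_sum) auto
  define q where "q x = A + g 0 (x + 1 - real c)" for x
  have "bipoly (\<lambda>x y. q x)" unfolding q_def
    using \<open>A \<in> \<rat>\<close>
    by (intro bipoly_add[OF bipoly_const bipoly_subst[OF g(1), of "\<lambda>x y. 0" "\<lambda>x y. x + 1 - real c"]])
      (auto intro!: bipoly_diff bipoly_add bipoly_fst bipoly_const)
  moreover have "real (\<Sum>t<nat (i + 1). f (i - int t)) = q (real_of_int i)" if "i \<ge> int c" for i
  proof -
    define m where "m = nat (i - int c)"
    have m: "i = int (c + m)" using that by (simp add: m_def)
    have "(\<Sum>t<nat (i + 1). f (i - int t)) = (\<Sum>j<Suc (c + m). f (int j))"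
      by (rule sum.reindex_bij_witness[of _ "\<lambda>j. c + m - j" "\<lambda>t. c + m - t"])
         (auto simp: m of_nat_diff)
    also have "{..<Suc (c + m)} = {..<c + Suc m}" by auto
    also have "(\<Sum>j\<in>{..<c + Suc m}. f (int j)) = (\<Sum>j<c. f (int j)) + (\<Sum>t<Suc m. f (int (c + t)))"
      by (rule sum_lessThan_add)
    also have "real \<dots> = A + (\<Sum>t<Suc m. p (real c + real t))"
    proof -
      have "real (f (int (c + t))) = p (real c + real t)" for t using pc[of "c + t"] by simp
      then show ?thesis unfolding A_def of_nat_add of_nat_sum by presburger
    qed
    also have "\<dots> = A + g 0 (real (Suc m))" by (simp only: g(2)[where x = 0])
    also have "real (Suc m) = real_of_int i + 1 - real c" using m by simp
    finally show ?thesis by (simp add: q_def)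
  qed
  ultimately show ?thesis by (rule eventually_polyI)
qed

text \<open>Joint polynomiality says nothing about small \<open>k\<close>, yet diagonal sums range
  over all of them; eventual polynomiality in \<open>i\<close> for every single \<open>k\<close>
  covers those.\<close>

definition asymp_bipoly :: "int \<Rightarrow> (int \<Rightarrow> int \<Rightarrow> nat) \<Rightarrow> bool" where
  "asymp_bipoly D f \<longleftrightarrow> (\<forall>k. eventually_poly (\<lambda>i. f i k)) \<and>
    (\<exists>k0 c P. bipoly P \<and> (\<forall>k\<ge>k0. \<forall>i\<ge>D * k + c. real (f i k) = P (real_of_int i) (real_of_int k)))"

lemma asymp_bipolyI:
  "(\<And>k. eventually_poly (\<lambda>i. f i k)) \<Longrightarrow> bipoly P \<Longrightarrow>
   (\<And>k i. k \<ge> K \<Longrightarrow> i \<ge> D * k + c \<Longrightarrow> real (f i k) = P (real_of_int i) (real_of_int k)) \<Longrightarrow>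
   asymp_bipoly D f"
  unfolding asymp_bipoly_def by blast

lemma asymp_bipoly_add:
  assumes "asymp_bipoly D f" "asymp_bipoly D g"
  shows "asymp_bipoly D (\<lambda>i k. f i k + g i k)"
proof -
  obtain k0 c P k1 d Q where h: "bipoly P" "bipoly Q"
    "\<forall>k\<ge>k0. \<forall>i\<ge>D * k + c. real (f i k) = P (real_of_int i) (real_of_int k)"
    "\<forall>k\<ge>k1. \<forall>i\<ge>D * k + d. real (g i k) = Q (real_of_int i) (real_of_int k)"
    using assms unfolding asymp_bipoly_def by metis
  show ?thesis
  proof (rule asymp_bipolyI[where K = "max k0 k1" and c = "max c d"])
    show "eventually_poly (\<lambda>i. f i k + g i k)" for k
      using assms by (auto simp: asymp_bipoly_def intro: eventually_poly_add)
    show "bipoly (\<lambda>x y. P x y + Q x y)" using h by (intro bipoly_add)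
    show "real (f i k + g i k) = P (real_of_int i) (real_of_int k) + Q (real_of_int i) (real_of_int k)"
      if "max k0 k1 \<le> k" "D * k + max c d \<le> i" for k i using h that by auto
  qed
qed

lemma asymp_bipoly_zero: "asymp_bipoly D (\<lambda>i k. 0)"
  by (rule asymp_bipolyI[where P = "\<lambda>x y. 0"])
     (auto intro: eventually_poly_eq_const[of 0 _ 0] bipoly_const)

lemma asymp_bipoly_sum:
  "(\<And>t. t \<in> A \<Longrightarrow> asymp_bipoly D (f t)) \<Longrightarrow> asymp_bipoly D (\<lambda>i k. \<Sum>t\<in>A. f t i k)"
  by (induction A rule: infinite_finite_induct) (auto intro: asymp_bipoly_add asymp_bipoly_zero)

lemma asymp_bipoly_shift:
  assumes "asymp_bipoly D f" "D \<ge> 0" "t \<ge> 0"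
  shows "asymp_bipoly D (\<lambda>i k. f (i - s) (k - t))"
proof -
  obtain k0 c P where h: "bipoly P"
    "\<And>k i. k \<ge> k0 \<Longrightarrow> i \<ge> D * k + c \<Longrightarrow> real (f i k) = P (real_of_int i) (real_of_int k)"
    using assms unfolding asymp_bipoly_def by metis
  show ?thesis
  proof (rule asymp_bipolyI[where K = "k0 + t" and c = "c + s"])
    show "eventually_poly (\<lambda>i. f (i - s) (k - t))" for k
      using assms by (auto simp: asymp_bipoly_def intro: eventually_poly_shift[where f = "\<lambda>i. f i (k - t)"])
    show "bipoly (\<lambda>x y. P (x - real_of_int s) (y - real_of_int t))"
      by (rule bipoly_subst[OF h(1)]) (auto intro!: bipoly_diff bipoly_fst bipoly_snd bipoly_const)
    show "real (f (i - s) (k - t)) = P (real_of_int i - real_of_int s) (real_of_int k - real_of_int t)"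
      if "k0 + t \<le> k" "D * k + (c + s) \<le> i" for k i
    proof -
      have "D * (k - t) \<le> D * k" using assms by (simp add: mult_left_mono)
      then show ?thesis using h(2)[of "k - t" "i - s"] that by simp
    qed
  qed
qed

text \<open>Adding a generator of bidegree \<open>(d, 1)\<close> sums along this diagonal. With
  \<open>\<tau> = k - t\<close> the summand is \<open>f (i - d k + d \<tau>) \<tau>\<close>. For the
  finitely many \<open>\<tau>\<close> below the threshold its eventual polynomial in the first
  argument applies; for the others the joint polynomial does, since \<open>d \<le> D\<close> keeps
  the point inside the region of slope \<open>D\<close>.\<close>

lemma asymp_bipoly_diagonal_sum:
  assumes "asymp_bipoly D f" "0 \<le> d" "d \<le> D"
  shows "asymp_bipoly D (\<lambda>i k. \<Sum>t<nat (k + 1). f (i - d * int t) (k - int t))"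
proof -
  have slices: "eventually_poly (\<lambda>i. f i k)" for k using assms(1) by (simp add: asymp_bipoly_def)
  obtain k0 c P where P: "bipoly P"
    "\<And>k i. k \<ge> k0 \<Longrightarrow> i \<ge> D * k + c \<Longrightarrow> real (f i k) = P (real_of_int i) (real_of_int k)"
    using assms unfolding asymp_bipoly_def by metis
  obtain p e where p: "\<And>k. bipoly (\<lambda>x y. p k x)"
    "\<And>k i. i \<ge> e k \<Longrightarrow> real (f i k) = p k (real_of_int i)"
    using slices unfolding eventually_poly_def by metis
  define K where "K = nat k0"
  \<comment> \<open>\<open>C\<close> dominates the offset \<open>c\<close> of the joint region and
    also the thresholds of the finitely many slices \<open>\<tau> < K\<close>.\<close>
  define C where "C = Max (insert (max c 0) ((\<lambda>\<tau>. e (int \<tau>)) ` {..<K}))"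
  have C: "c \<le> C" "0 \<le> C" "\<And>\<tau>. \<tau> < K \<Longrightarrow> e (int \<tau>) \<le> C"
    unfolding C_def by (auto intro!: Max.coboundedI[OF _ imageI] simp: Max_ge_iff)
  define h where "h x y = P (x + real_of_int d * (real K + y)) (real K + y)" for x y
  have "bipoly h" unfolding h_def
    by (rule bipoly_subst[OF P(1)])
       (auto intro!: bipoly_add bipoly_mult bipoly_fst bipoly_snd bipoly_const)
  then obtain g where g: "bipoly g" "\<And>x. \<And>k::nat. (\<Sum>t<k. h x (real t)) = g x (real k)"
    using bipoly_partial_sum by blast
  define Q where "Q x y = (\<Sum>\<tau><K. p (int \<tau>) (x - real_of_int d * y + real_of_int d * real \<tau>))
      + g (x - real_of_int d * y) (y + 1 - real K)" for x y
  show ?thesis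
  proof (rule asymp_bipolyI[where K = "int K" and c = C])
    show "eventually_poly (\<lambda>i. \<Sum>t<nat (k + 1). f (i - d * int t) (k - int t))" for k
      by (intro eventually_poly_sum eventually_poly_shift[where f = "\<lambda>i. f i (k - int _)"] slices)
    have "bipoly (\<lambda>x y. p (int \<tau>) (x - real_of_int d * y + real_of_int d * real \<tau>))" for \<tau>
      by (rule bipoly_subst[OF p(1), of _ "\<lambda>x y. y"])
         (auto intro!: bipoly_add bipoly_diff bipoly_mult bipoly_fst bipoly_snd bipoly_const)
    moreover have "bipoly (\<lambda>x y. g (x - real_of_int d * y) (y + 1 - real K))"
      by (rule bipoly_subst[OF g(1)])
         (auto intro!: bipoly_add bipoly_diff bipoly_mult bipoly_fst bipoly_snd bipoly_const)
    ultimately show "bipoly Q" unfolding Q_def by (intro bipoly_add bipoly_sum)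
    fix k i assume k: "int K \<le> k" and i: "D * k + C \<le> i"
    define m where "m = nat (k + 1) - K"
    have m: "nat (k + 1) = K + m" "k = int K + int m - 1" "m \<ge> 1" using k by (auto simp: m_def)
    have "(\<Sum>t<nat (k + 1). f (i - d * int t) (k - int t)) = (\<Sum>\<tau><nat (k + 1). f (i - d * k + d * int \<tau>) (int \<tau>))"
      using k by (intro sum.reindex_bij_witness[of _ "\<lambda>j. nat k - j" "\<lambda>t. nat k - t"])
         (auto simp: of_nat_diff algebra_simps)
    also have "\<dots> = (\<Sum>\<tau><K. f (i - d * k + d * int \<tau>) (int \<tau>))
        + (\<Sum>t<m. f (i - d * k + d * int (K + t)) (int (K + t)))"
      unfolding m(1) by (rule sum_lessThan_add)
    also have "real \<dots> = Q (real_of_int i) (real_of_int k)"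
    proof -
      have dk: "d * k \<le> D * k" using assms k by (simp add: mult_right_mono)
      have "real (f (i - d * k + d * int \<tau>) (int \<tau>)) =
          p (int \<tau>) (real_of_int i - real_of_int d * real_of_int k + real_of_int d * real \<tau>)"
        if "\<tau> < K" for \<tau>
      proof -
        have "0 \<le> d * int \<tau>" using assms by simp
        then have "i - d * k + d * int \<tau> \<ge> e (int \<tau>)" using C(3)[OF that] dk i by linarith
        then show ?thesis using p(2) by simp
      qed
      moreover have "real (f (i - d * k + d * int (K + t)) (int (K + t))) =
          h (real_of_int i - real_of_int d * real_of_int k) (real t)" if "t < m" for t
      proof -
        have "(D - d) * int (K + t) \<le> (D - d) * k"
          using that m assms(3) by (intro mult_left_mono) auto
        then have "i - d * k + d * int (K + t) \<ge> D * int (K + t) + c"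
          using i C(1) by (simp add: algebra_simps)
        then show ?thesis using P(2)[of "int (K + t)"] by (simp add: K_def h_def)
      qed
      ultimately show ?thesis
        unfolding Q_def of_nat_add of_nat_sum using m(2) by (simp add: g(2))
    qed
    finally show "real (\<Sum>t<nat (k + 1). f (i - d * int t) (k - int t)) = Q (real_of_int i) (real_of_int k)" .
  qed
qed

section \<open>Exponent vectors of given bidegree\<close>

lemma finite_bounded_exponents:
  assumes "finite V"
  shows "finite {v :: 'a \<Rightarrow>\<^sub>0 nat. keys v \<subseteq> V \<and> (\<forall>s. lookup v s \<le> B)}" (is "finite ?A")
proof (rule finite_imageD)
  show "inj_on lookup ?A" by (simp add: inj_on_def lookup_inject)
  have "lookup ` ?A \<subseteq> {f. \<forall>x. (x \<in> V \<longrightarrow> f x \<in> {..B}) \<and> (x \<notin> V \<longrightarrow> f x = 0)}"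
    by (auto simp: in_keys_iff)
  then show "finite (lookup ` ?A)"
    using finite_set_of_finite_funs[OF assms, of "{..B}" 0] finite_subset by blast
qed

definition wt :: "(nat \<Rightarrow> nat) \<Rightarrow> nat \<Rightarrow> (nat \<Rightarrow>\<^sub>0 nat) \<Rightarrow> nat"
  where "wt w N v = (\<Sum>s<N. w s * lookup v s)"

text \<open>Exact in the second weight and cumulative in the first, because the count is to match
  the Hilbert sum for one fixed power \<open>k\<close>.\<close>

definition bidegree_set ::
    "(nat \<Rightarrow> nat) \<Rightarrow> (nat \<Rightarrow> nat) \<Rightarrow> nat \<Rightarrow> (nat \<Rightarrow>\<^sub>0 nat) set \<Rightarrow> int \<Rightarrow> int \<Rightarrow> (nat \<Rightarrow>\<^sub>0 nat) set"
  where "bidegree_set w \<kappa> N D i k =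
    {v \<in> D. keys v \<subseteq> {..<N} \<and> int (wt \<kappa> N v) = k \<and> int (wt w N v) \<le> i}"

text \<open>The fibre of \<open>D\<close> over the exponent \<open>t\<close> of the last variable.
  For downward closed \<open>D\<close> the fibres shrink as \<open>t\<close> grows and so are
  eventually constant, which drives the induction on the number of variables.\<close>

definition slice :: "nat \<Rightarrow> (nat \<Rightarrow>\<^sub>0 nat) set \<Rightarrow> nat \<Rightarrow> (nat \<Rightarrow>\<^sub>0 nat) set"
  where "slice N D t = {u. keys u \<subseteq> {..<N} \<and> u + single N t \<in> D}"

lemma wt_add: "wt w N (u + v) = wt w N u + wt w N v"
  by (simp add: wt_def lookup_add algebra_simps sum.distrib)

lemma wt_le: "s < N \<Longrightarrow> w s * lookup v s \<le> wt w N v"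
  unfolding wt_def by (rule member_le_sum) auto

lemma wt_Suc_single: "keys u \<subseteq> {..<N} \<Longrightarrow> wt w (Suc N) (u + single N t) = wt w N u + w N * t"
proof -
  assume u: "keys u \<subseteq> {..<N}"
  then have "lookup u N = 0" by (meson in_keys_iff lessThan_iff less_irrefl subsetD)
  then show ?thesis by (simp add: wt_def lookup_add lookup_single when_def)
qed

lemma finite_bidegree_set:
  assumes "\<And>s. s < N \<Longrightarrow> w s + \<kappa> s \<ge> 1"
  shows "finite (bidegree_set w \<kappa> N D i k)"
proof (rule finite_subset)
  show "bidegree_set w \<kappa> N D i k \<subseteq> {v. keys v \<subseteq> {..<N} \<and> (\<forall>s. lookup v s \<le> nat i + nat k)}"
  proof
    fix v assume v: "v \<in> bidegree_set w \<kappa> N D i k"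
    have "lookup v s \<le> nat i + nat k" for s
    proof (cases "s < N")
      case True
      have "lookup v s \<le> (w s + \<kappa> s) * lookup v s" using assms[OF True] by simp
      also have "\<dots> \<le> wt w N v + wt \<kappa> N v" using wt_le[OF True] by (simp add: distrib_right add_mono)
      finally show ?thesis using v by (auto simp: bidegree_set_def)
    next
      case False
      then have "s \<notin> keys v" using v unfolding bidegree_set_def by blast
      then have "lookup v s = 0" by (simp add: in_keys_iff)
      then show ?thesis by simp
    qed
    then show "v \<in> {v. keys v \<subseteq> {..<N} \<and> (\<forall>s. lookup v s \<le> nat i + nat k)}"
      using v by (auto simp: bidegree_set_def)
  qed
qed (rule finite_bounded_exponents, simp)

lemma keys_subset_lessThan_SucE:
  assumes "keys v \<subseteq> {..<Suc N}"
  obtains u t where "keys u \<subseteq> {..<N}" "v = u + single N (t::nat)"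
proof
  let ?u = "v - single N (lookup v N)"
  show "v = ?u + single N (lookup v N)"
    by (rule poly_mapping_eqI) (auto simp: lookup_add lookup_minus lookup_single when_def)
  show "keys ?u \<subseteq> {..<N}"
  proof
    fix s assume "s \<in> keys ?u"
    then have "s \<noteq> N" "s \<in> keys v" by (auto simp: in_keys_iff lookup_minus lookup_single when_def split: if_splits)
    then show "s \<in> {..<N}" using assms by force
  qed
qed

text \<open>\<open>B\<close> may be any bound past which the last exponent exceeds one of the
  degrees. This freedom allows taking \<open>t0\<close> plus the number of remaining terms and
  splitting the sum where the slices become constant.\<close>

lemma card_bidegree_set_Suc:
  assumes pos: "\<And>s. s \<le> N \<Longrightarrow> w s + \<kappa> s \<ge> 1"
    and B: "\<And>t. t \<ge> B \<Longrightarrow> int (w N * t) > i \<or> int (\<kappa> N * t) > k"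
  shows "card (bidegree_set w \<kappa> (Suc N) D i k) =
    (\<Sum>t<B. card (bidegree_set w \<kappa> N (slice N D t) (i - int (w N * t)) (k - int (\<kappa> N * t))))"
proof -
  let ?S = "\<lambda>t. bidegree_set w \<kappa> N (slice N D t) (i - int (w N * t)) (k - int (\<kappa> N * t))"
  have eq: "bidegree_set w \<kappa> (Suc N) D i k = (\<Union>t<B. (\<lambda>u. u + single N t) ` ?S t)"
  proof (intro equalityI subsetI)
    fix v assume v: "v \<in> bidegree_set w \<kappa> (Suc N) D i k"
    then obtain u t where ut: "keys u \<subseteq> {..<N}" "v = u + single N t"
      using keys_subset_lessThan_SucE[of v N] by (auto simp: bidegree_set_def)
    have "int (w N * t) \<le> i" "int (\<kappa> N * t) \<le> k"
      using v wt_Suc_single[OF ut(1), of _ t] by (auto simp: bidegree_set_def ut(2))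
    then have "t < B" using B[of t] by force
    moreover have "u \<in> ?S t"
      using v ut wt_Suc_single[OF ut(1), of _ t] by (auto simp: bidegree_set_def slice_def)
    ultimately show "v \<in> (\<Union>t<B. (\<lambda>u. u + single N t) ` ?S t)" using ut by blast
  next
    fix v assume "v \<in> (\<Union>t<B. (\<lambda>u. u + single N t) ` ?S t)"
    then obtain t u where t: "v = u + single N t" "u \<in> ?S t" by auto
    then have u: "keys u \<subseteq> {..<N}" by (auto simp: bidegree_set_def)
    have "keys v \<subseteq> {..<Suc N}" using u keys_add[of u "single N t"] unfolding t
      by (fastforce split: if_splits)
    then show "v \<in> bidegree_set w \<kappa> (Suc N) D i k"
      using t wt_Suc_single[OF u, of _ t] by (auto simp: bidegree_set_def slice_def)
  qed
  have look: "lookup (u + single N t) N = t" if "u \<in> ?S t'" for u t t'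
  proof -
    have "N \<notin> keys u" using that by (auto simp: bidegree_set_def)
    then show ?thesis by (simp add: lookup_add in_keys_iff)
  qed
  have "card (bidegree_set w \<kappa> (Suc N) D i k) = (\<Sum>t<B. card ((\<lambda>u. u + single N t) ` ?S t))"
    unfolding eq
  proof (rule card_UN_disjoint)
    show "\<forall>t\<in>{..<B}. finite ((\<lambda>u. u + single N t) ` ?S t)"
      using pos by (auto intro!: finite_bidegree_set)
    show "\<forall>t\<in>{..<B}. \<forall>j\<in>{..<B}. t \<noteq> j \<longrightarrow> (\<lambda>u. u + single N t) ` ?S t \<inter> (\<lambda>u. u + single N j) ` ?S j = {}"
      using look by (smt (verit) disjoint_iff imageE)
  qed simp
  also have "\<dots> = (\<Sum>t<B. card (?S t))"
    by (intro sum.cong refl card_image) (auto simp: inj_on_def)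
  finally show ?thesis .
qed

lemma downclosed_slice: "downclosed D \<Longrightarrow> downclosed (slice N D t)"
  unfolding downclosed_def
proof (intro ballI allI impI)
  fix u v assume D: "\<forall>v\<in>D. \<forall>u. (\<forall>s. lookup u s \<le> lookup v s) \<longrightarrow> u \<in> D"
    and v: "v \<in> slice N D t" and le: "\<forall>s. lookup u s \<le> lookup v s"
  have "keys u \<subseteq> keys v"
  proof
    fix s assume "s \<in> keys u"
    then show "s \<in> keys v" using le[rule_format, of s] by (simp add: in_keys_iff)
  qed
  moreover have "u + single N t \<in> D"
    using D v le by (auto simp: slice_def lookup_add)
  ultimately show "u \<in> slice N D t" using v by (auto simp: slice_def)
qed

lemma slices_stabilise:
  assumes "downclosed D"
  shows "\<exists>t0. \<forall>t\<ge>t0. slice N D t = slice N D t0"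
proof (rule downclosed_chain_stabilises[of "{..<N}"])
  show "slice N D (Suc t) \<subseteq> slice N D t" for t
  proof
    fix u assume u: "u \<in> slice N D (Suc t)"
    have "lookup (u + single N t) s \<le> lookup (u + single N (Suc t)) s" for s
      by (simp add: lookup_add lookup_single when_def)
    then show "u \<in> slice N D t" using u downclosedD[OF assms] by (auto simp: slice_def)
  qed
qed (auto simp: slice_def intro: downclosed_slice[unfolded slice_def] assms)

text \<open>From \<open>t0\<close> on all slices agree, so the tail is a partial sum of a single
  eventually polynomial function; the finitely many earlier slices only enter with shifted
  arguments.\<close>

lemma eventually_poly_card:
  assumes "\<And>s. s < N \<Longrightarrow> \<kappa> s = 0 \<and> w s = 1" "downclosed D"
  shows "eventually_poly (\<lambda>i. card (bidegree_set w \<kappa> N D i k))"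
  using assms
proof (induction N arbitrary: D k)
  case 0
  show ?case
  proof (rule eventually_poly_eq_const)
    fix i :: int assume "0 \<le> i"
    then have "bidegree_set w \<kappa> 0 D i k = (if 0 \<in> D \<and> k = 0 then {0} else {})"
      by (auto simp: bidegree_set_def wt_def)
    then show "card (bidegree_set w \<kappa> 0 D i k) = (if 0 \<in> D \<and> k = 0 then 1 else 0)" by simp
  qed
next
  case (Suc N)
  obtain t0 where t0: "\<And>t. t \<ge> t0 \<Longrightarrow> slice N D t = slice N D t0"
    using slices_stabilise[OF Suc.prems(2)] by blast
  have st: "slice N D (t0 + t) = slice N D t0" for t by (rule t0) simp
  have N: "\<kappa> N = 0" "w N = 1" using Suc.prems(1) by auto
  let ?c = "\<lambda>t i. card (bidegree_set w \<kappa> N (slice N D t) i k)"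
  have ep: "eventually_poly (?c t)" for t
    using Suc.IH Suc.prems downclosed_slice by simp
  have "card (bidegree_set w \<kappa> (Suc N) D i k) =
      (\<Sum>t<t0. ?c t (i - int t)) + (\<Sum>t<nat ((i - int t0) + 1). ?c t0 ((i - int t0) - int t))" for i
  proof -
    have "card (bidegree_set w \<kappa> (Suc N) D i k) = (\<Sum>t<t0 + nat (i - int t0 + 1). ?c t (i - int t))"
      using Suc.prems(1) N
      by (subst card_bidegree_set_Suc[where B = "t0 + nat (i - int t0 + 1)"]) auto
    also have "\<dots> = (\<Sum>t<t0. ?c t (i - int t)) + (\<Sum>t<nat (i - int t0 + 1). ?c (t0 + t) (i - int (t0 + t)))"
      by (rule sum_lessThan_add)
    finally show ?thesis unfolding st by (simp add: algebra_simps)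
  qed
  moreover have "eventually_poly (\<lambda>i. (\<Sum>t<t0. ?c t (i - int t))
      + (\<Sum>t<nat ((i - int t0) + 1). ?c t0 ((i - int t0) - int t)))"
    by (intro eventually_poly_add eventually_poly_sum eventually_poly_shift[OF ep]
        eventually_poly_shift[OF eventually_poly_partial_sum[OF ep]])
  ultimately show ?case by simp
qed

text \<open>Induction on the generators of second weight 1, starting from the \<open>n\<close>
  variables alone, for which the count is zero as soon as \<open>k \<ge> 1\<close>. Each new
  generator contributes finitely many shifted slices and a diagonal sum of the stable one; the bound
  \<open>W\<close> on its degree keeps that sum polynomial on the region of slope
  \<open>W\<close>.\<close>

theorem asymp_bipoly_card:
  fixes n N :: nat
  assumes x: "\<And>s. s < n \<Longrightarrow> \<kappa> s = 0 \<and> w s = 1"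
    and y: "\<And>s. n \<le> s \<Longrightarrow> s < N \<Longrightarrow> \<kappa> s = 1 \<and> int (w s) \<le> W"
    and "0 \<le> W" "n \<le> N" "downclosed D"
  shows "asymp_bipoly W (\<lambda>i k. card (bidegree_set w \<kappa> N D i k))"
  using \<open>n \<le> N\<close> y \<open>downclosed D\<close>
proof (induction N arbitrary: D rule: dec_induct)
  case base
  show ?case
  proof (rule asymp_bipolyI[where K = 1 and P = "\<lambda>x y. 0" and c = 0])
    show "eventually_poly (\<lambda>i. card (bidegree_set w \<kappa> n D i k))" for k
      using eventually_poly_card[of n] x base by blast
    have "wt \<kappa> n v = 0" for v using x by (simp add: wt_def)
    then show "real (card (bidegree_set w \<kappa> n D i k)) = 0" if "1 \<le> k" for k i
      using that by (auto simp: bidegree_set_def)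
  qed (simp add: bipoly_const)
next
  case (step N)
  obtain t0 where t0: "\<And>t. t \<ge> t0 \<Longrightarrow> slice N D t = slice N D t0"
    using slices_stabilise[OF step.prems(2)] by blast
  have st: "slice N D (t0 + t) = slice N D t0" for t by (rule t0) simp
  have N: "\<kappa> N = 1" "int (w N) \<le> W" using step by auto
  let ?c = "\<lambda>t i k. card (bidegree_set w \<kappa> N (slice N D t) i k)"
  have ep: "asymp_bipoly W (?c t)" for t
    using step.IH step.prems downclosed_slice by simp
  let ?d = "int (w N)"
  let ?G = "\<lambda>i k. \<Sum>t<nat (k + 1). ?c t0 (i - ?d * int t) (k - int t)"
  have "card (bidegree_set w \<kappa> (Suc N) D i k) =
      (\<Sum>t<t0. ?c t (i - ?d * int t) (k - int t)) + ?G (i - ?d * int t0) (k - int t0)" for i k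
  proof -
    have "card (bidegree_set w \<kappa> (Suc N) D i k)
        = (\<Sum>t<t0 + nat (k - int t0 + 1). ?c t (i - ?d * int t) (k - int t))"
    proof (subst card_bidegree_set_Suc[where B = "t0 + nat (k - int t0 + 1)"])
      fix s assume "s \<le> N"
      show "1 \<le> w s + \<kappa> s"
      proof (cases "s < n")
        case True
        then show ?thesis using x by simp
      next
        case False
        then show ?thesis using step.prems(1)[of s] \<open>s \<le> N\<close> by simp
      qed
    qed (use N in auto)
    also have "\<dots> = (\<Sum>t<t0. ?c t (i - ?d * int t) (k - int t))
        + (\<Sum>t<nat (k - int t0 + 1). ?c (t0 + t) (i - ?d * int (t0 + t)) (k - int (t0 + t)))"
      by (rule sum_lessThan_add)
    finally show ?thesis unfolding st by (simp add: algebra_simps)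
  qed
  moreover have "asymp_bipoly W (\<lambda>i k. (\<Sum>t<t0. ?c t (i - ?d * int t) (k - int t))
      + ?G (i - ?d * int t0) (k - int t0))"
    using assms(3) N
    by (intro asymp_bipoly_add asymp_bipoly_sum asymp_bipoly_shift[OF ep]
        asymp_bipoly_shift[OF asymp_bipoly_diagonal_sum[OF ep]]) auto
  ultimately show ?case by simp
qed

text \<open>Each exponent has at most \<open>i + 1\<close> possible values. Applied to the variables
  alone, this controls the growth of \<open>M\<close> itself.\<close>

lemma card_bidegree_set_le:
  assumes "\<And>s. s < N \<Longrightarrow> \<kappa> s = 0 \<and> w s = 1"
  shows "card (bidegree_set w \<kappa> N D i k) \<le> nat (i + 1) ^ N"
  using assms
proof (induction N arbitrary: D i k)
  case 0
  have "bidegree_set w \<kappa> 0 D i k \<subseteq> {0}" by (auto simp: bidegree_set_def)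
  then show ?case using card_mono[of "{0}" "bidegree_set w \<kappa> 0 D i k"] by simp
next
  case (Suc N)
  have "card (bidegree_set w \<kappa> (Suc N) D i k) =
      (\<Sum>t<nat (i + 1). card (bidegree_set w \<kappa> N (slice N D t) (i - int (w N * t)) (k - int (\<kappa> N * t))))"
    using Suc.prems by (intro card_bidegree_set_Suc) auto
  also have "\<dots> \<le> (\<Sum>t<nat (i + 1). nat (i + 1) ^ N)"
  proof (rule sum_mono)
    fix t
    have "card (bidegree_set w \<kappa> N (slice N D t) (i - int (w N * t)) (k - int (\<kappa> N * t)))
        \<le> nat (i - int (w N * t) + 1) ^ N" using Suc by simp
    also have "\<dots> \<le> nat (i + 1) ^ N" by (intro power_mono nat_mono) auto
    finally show "card (bidegree_set w \<kappa> N (slice N D t) (i - int (w N * t)) (k - int (\<kappa> N * t)))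
        \<le> nat (i + 1) ^ N" .
  qed
  finally show ?case by simp
qed


section \<open>Ideals of a commutative ring as sets\<close>

lemma ideal_class_ring_iff:
  fixes A :: "'a::comm_ring_1 set"
  shows "ideal A class_ring \<longleftrightarrow> 0 \<in> A \<and> (\<forall>a\<in>A. \<forall>b\<in>A. a + b \<in> A) \<and> (\<forall>a\<in>A. \<forall>r. r * a \<in> A)"
    (is "?L \<longleftrightarrow> ?R")
proof
  assume ?L
  then interpret ideal A "class_ring :: 'a ring" .
  show ?R using zero_closed a_closed I_l_closed by auto
next
  assume R: ?R
  have neg: "- a \<in> A" if "a \<in> A" for a using that R by (metis mult_minus1)
  show ?L
  proof (rule idealI)
    show "subgroup A (add_monoid (class_ring :: 'a ring))"
    proof (rule group.subgroupI[OF abelian_group.a_group[OF ring.is_abelian_group[OF class_ring.ring_axioms]]])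
      fix a assume "a \<in> A"
      moreover have "a_inv (class_ring :: 'a ring) = uminus" by (rule class_ring_simps)
      then have "inv\<^bsub>add_monoid class_ring\<^esub> a = - a" unfolding a_inv_def by (rule fun_cong)
      ultimately show "inv\<^bsub>add_monoid class_ring\<^esub> a \<in> A" using neg by simp
    qed (use R in auto)
  qed (use R in \<open>auto simp: class_ring.ring_axioms mult.commute\<close>)
qed

lemma ideal_add: "ideal A (class_ring :: 'a::comm_ring_1 ring) \<Longrightarrow> a \<in> A \<Longrightarrow> b \<in> A \<Longrightarrow> a + b \<in> A"
  and ideal_mult: "ideal A (class_ring :: 'a::comm_ring_1 ring) \<Longrightarrow> a \<in> A \<Longrightarrow> r * a \<in> A"
  and ideal_zero: "ideal A (class_ring :: 'a::comm_ring_1 ring) \<Longrightarrow> 0 \<in> A"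
  by (auto simp: ideal_class_ring_iff)

lemma ideal_mult_right: "ideal A (class_ring :: 'a::comm_ring_1 ring) \<Longrightarrow> a \<in> A \<Longrightarrow> a * r \<in> A"
  by (metis ideal_mult mult.commute)

lemma ideal_diff: "ideal A (class_ring :: 'a::comm_ring_1 ring) \<Longrightarrow> a \<in> A \<Longrightarrow> b \<in> A \<Longrightarrow> a - b \<in> A"
  by (metis ideal_add ideal_mult mult_minus1 add_uminus_conv_diff)

lemma ideal_sum: "ideal A (class_ring :: 'a::comm_ring_1 ring) \<Longrightarrow> (\<And>i. i \<in> T \<Longrightarrow> f i \<in> A) \<Longrightarrow> sum f T \<in> A"
  by (induction T rule: infinite_finite_induct) (auto intro: ideal_zero ideal_add)

lemma ideal_UNIV_iff: "ideal A (class_ring :: 'a::comm_ring_1 ring) \<Longrightarrow> A = UNIV \<longleftrightarrow> 1 \<in> A"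
  by (metis UNIV_I UNIV_eq_I ideal_mult mult.right_neutral)

lemma primeideal_class_ring_iff:
  fixes P :: "'a::comm_ring_1 set"
  shows "primeideal P class_ring \<longleftrightarrow>
    ideal P class_ring \<and> P \<noteq> UNIV \<and> (\<forall>a b. a * b \<in> P \<longrightarrow> a \<in> P \<or> b \<in> P)"
  using class_cring.cring_axioms by (auto simp: primeideal_def primeideal_axioms_def)

definition ideal_insert :: "'a::comm_ring_1 \<Rightarrow> 'a set \<Rightarrow> 'a set"
  where "ideal_insert f A = {a + f * q | a q. a \<in> A}"

lemma ideal_insertI: "a \<in> A \<Longrightarrow> a + f * q \<in> ideal_insert f A"
  by (auto simp: ideal_insert_def)

lemma ideal_ideal_insert:
  assumes "ideal A (class_ring :: 'a::comm_ring_1 ring)"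
  shows "ideal (ideal_insert f A) class_ring"
  unfolding ideal_class_ring_iff
proof (intro conjI ballI allI)
  show "0 \<in> ideal_insert f A" using ideal_insertI[OF ideal_zero[OF assms], of f 0] by simp
  fix a assume "a \<in> ideal_insert f A"
  then obtain x q where a: "a = x + f * q" "x \<in> A" by (auto simp: ideal_insert_def)
  show "r * a \<in> ideal_insert f A" for r
    using ideal_insertI[OF ideal_mult[OF assms a(2), of r], of f "r * q"] a by (simp add: algebra_simps)
  show "a + b \<in> ideal_insert f A" if "b \<in> ideal_insert f A" for b
  proof -
    obtain y r where b: "b = y + f * r" "y \<in> A" using \<open>b \<in> _\<close> by (auto simp: ideal_insert_def)
    then show ?thesis using ideal_insertI[OF ideal_add[OF assms a(2) b(2)], of f "q + r"] a
      by (simp add: algebra_simps)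
  qed
qed

lemma ideal_insert_superset: "A \<subseteq> ideal_insert f A"
  using ideal_insertI[of _ A f 0] by auto

lemma ideal_insert_mem: "ideal A (class_ring :: 'a::comm_ring_1 ring) \<Longrightarrow> f \<in> ideal_insert f A"
  using ideal_insertI[of 0 A f 1] ideal_zero by auto

lemma Idl_ideal: "ideal (Idl\<^bsub>class_ring\<^esub> F) (class_ring :: 'a::comm_ring_1 ring)"
  using ring.genideal_ideal[OF class_ring.ring_axioms, of F] by simp

lemma Idl_superset: "F \<subseteq> Idl\<^bsub>class_ring :: 'a::comm_ring_1 ring\<^esub> F"
  using ring.genideal_self[OF class_ring.ring_axioms, of F] by simp

lemma Idl_minimal: "ideal A (class_ring :: 'a::comm_ring_1 ring) \<Longrightarrow> F \<subseteq> A \<Longrightarrow> Idl\<^bsub>class_ring\<^esub> F \<subseteq> A"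
  using ring.genideal_minimal[OF class_ring.ring_axioms, of A F] by simp

section \<open>The Hilbert basis theorem\<close>

text \<open>The order on exponents is lexicographic, with the smallest index most significant.
  Compatibility with addition and minimality of 0 make it a monomial order, so divisors come before
  multiples.\<close>

lemma zero_le_exponent: "(0 :: nat \<Rightarrow>\<^sub>0 nat) \<le> v"
proof (rule ccontr)
  assume "\<not> 0 \<le> v"
  then have "v < 0" by simp
  then show False by (simp add: less_poly_mapping.rep_eq less_fun_def)
qed

lemma exponent_le_of_pointwise:
  fixes u v :: "nat \<Rightarrow>\<^sub>0 nat"
  assumes "\<And>s. lookup u s \<le> lookup v s"
  shows "u \<le> v"
proof -
  have "v = u + (v - u)" using assms
    by (intro poly_mapping_eqI) (simp add: lookup_add lookup_minus)
  then show ?thesis using add_left_mono[OF zero_le_exponent, of u "v - u"] by simp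
qed

text \<open>Finitely many variables are essential: the unit exponents at 0, 1, 2, ... form an
  infinite descending chain. Otherwise Dickson yields an earlier member of the chain that divides,
  hence does not exceed, a later one.\<close>

lemma wf_exponents: "wf {(u, v :: nat \<Rightarrow>\<^sub>0 nat). u < v \<and> keys u \<subseteq> {..<N} \<and> keys v \<subseteq> {..<N}}"
  unfolding wf_iff_no_infinite_down_chain
proof
  assume "\<exists>g. \<forall>i. (g (Suc i), g i) \<in> {(u, v :: nat \<Rightarrow>\<^sub>0 nat). u < v \<and> keys u \<subseteq> {..<N} \<and> keys v \<subseteq> {..<N}}"
  then obtain g where g: "\<And>i. g (Suc i) < (g i :: nat \<Rightarrow>\<^sub>0 nat)" "\<And>i. keys (g i) \<subseteq> {..<N}" by auto
  obtain i j where ij: "i < j" "\<forall>s. lookup (g i) s \<le> lookup (g j) s"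
    using dickson[of "{..<N}" g] g(2) by auto
  have "g j < g i" using ij(1)
  proof (induction j)
    case (Suc j)
    then show ?case using g(1)[of j] by (cases "i = j") auto
  qed simp
  then show False using exponent_le_of_pointwise[of "g i" "g j"] ij(2) by simp
qed

text \<open>The type \<open>'n\<close> carries no order. An arbitrary numbering of the variables
  transports exponents to \<open>nat\<close> indices, where the lexicographic order is
  available.\<close>

definition enum_var :: "nat \<Rightarrow> 'n::finite"
  where "enum_var = (SOME \<sigma>. bij_betw \<sigma> {..<CARD('n)} UNIV)"

lemma bij_enum_var: "bij_betw (enum_var :: nat \<Rightarrow> 'n::finite) {..<CARD('n)} UNIV"
proof -
  have "\<exists>\<sigma>. bij_betw \<sigma> {..<CARD('n)} (UNIV :: 'n set)"
    using ex_bij_betw_nat_finite[of "UNIV :: 'n set"] by (simp add: atLeast0LessThan)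
  then show ?thesis unfolding enum_var_def by (rule someI_ex)
qed

lemma enum_varE:
  obtains s where "s < CARD('n)" "x = (enum_var s :: 'n::finite)"
  using bij_enum_var[where 'n = 'n] by (metis UNIV_I bij_betw_def imageE lessThan_iff)

definition encode :: "('n::finite \<Rightarrow>\<^sub>0 nat) \<Rightarrow> (nat \<Rightarrow>\<^sub>0 nat)"
  where "encode a = (\<Sum>s<CARD('n). single s (lookup a (enum_var s)))"

lemma lookup_encode: "lookup (encode a) s = (if s < CARD('n) then lookup a (enum_var s) else 0)"
  for a :: "'n::finite \<Rightarrow>\<^sub>0 nat"
  by (auto simp: encode_def lookup_sum lookup_single when_def)

lemma encode_add: "encode (a + b) = encode a + encode b"
  by (rule poly_mapping_eqI) (simp add: lookup_encode lookup_add)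

lemma keys_encode: "keys (encode a) \<subseteq> {..<CARD('n)}" for a :: "'n::finite \<Rightarrow>\<^sub>0 nat"
  by (auto simp: in_keys_iff lookup_encode split: if_splits)

lemma encode_pointwise:
  fixes a b :: "'n::finite \<Rightarrow>\<^sub>0 nat"
  assumes "\<And>s. lookup (encode a) s \<le> lookup (encode b) s"
  shows "lookup a x \<le> lookup b x"
proof -
  obtain s where "s < CARD('n)" "x = enum_var s" by (rule enum_varE)
  then show ?thesis using assms[of s] by (simp add: lookup_encode)
qed

lemma encode_inj: "encode a = encode b \<Longrightarrow> a = b"
  by (rule poly_mapping_eqI, rule antisym) (rule encode_pointwise, simp)+

lemma lookup_single_times:
  fixes p :: "('n \<Rightarrow>\<^sub>0 nat) \<Rightarrow>\<^sub>0 'k::field"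
  shows "lookup (single b c * p) (b + x) = c * lookup p x"
proof -
  have "lookup (single b c * p) (b + x) = (\<Sum>l. (c when b = l) * (\<Sum>q. lookup p q when b + x = l + q))"
    by (simp add: lookup_mult lookup_single)
  also have "\<dots> = (\<Sum>l. (c * (\<Sum>q. lookup p q when b + x = l + q)) when b = l)"
    by (simp add: when_mult)
  also have "\<dots> = c * (\<Sum>q. lookup p q when b + x = b + q)"
    by (rule Sum_any_when_equal')
  finally show ?thesis by simp
qed

lemma leading_exponent:
  fixes p :: "('n::finite, 'k::field) mpoly"
  assumes "p \<noteq> 0"
  obtains a where "a \<in> keys p" "\<And>b. b \<in> keys p \<Longrightarrow> encode b \<le> encode a"
proof -
  have "finite (encode ` keys p)" "encode ` keys p \<noteq> {}" using assms by auto
  then have "Max (encode ` keys p) \<in> encode ` keys p" by (rule Max_in)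
  then obtain a where "a \<in> keys p" "encode a = Max (encode ` keys p)" by auto
  then show ?thesis using that[of a] by simp
qed

text \<open>The reduction step of Groebner basis theory: the terms at \<open>a + b\<close> cancel,
  and translation by \<open>b\<close> preserves the order, so all surviving exponents are
  smaller.\<close>

lemma cancel_leading_term:
  fixes p q :: "('n::finite, 'k::field) mpoly"
  assumes a: "a \<in> keys p" "\<And>x. x \<in> keys p \<Longrightarrow> encode x \<le> encode a"
    and b: "a + b \<in> keys q" "\<And>x. x \<in> keys q \<Longrightarrow> encode x \<le> encode (a + b)"
    and x: "x \<in> keys (q - single b (lookup q (a + b) / lookup p a) * p)"
  shows "encode x < encode (a + b)"
proof -
  let ?c = "lookup q (a + b) / lookup p a"
  have pa: "lookup p a \<noteq> 0" using a(1) by (simp add: in_keys_iff)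
  have "lookup (single b ?c * p) (a + b) = lookup q (a + b)"
    using lookup_single_times[of b ?c p a] pa by (simp add: add.commute)
  then have "a + b \<notin> keys (q - single b ?c * p)" by (simp add: in_keys_iff lookup_minus)
  then have ne: "x \<noteq> a + b" using x by auto
  have "x \<in> keys q \<or> x \<in> keys (single b ?c * p)"
    using x by (auto simp: in_keys_iff lookup_minus)
  then have "encode x \<le> encode (a + b)"
  proof
    assume "x \<in> keys (single b ?c * p)"
    then obtain y where y: "y \<in> keys p" "x = b + y"
      using keys_mult[of "single b ?c" p] by (auto split: if_splits)
    then show ?thesis using a(2)[OF y(1)] by (simp add: encode_add add.commute[of _ "encode b"] add_left_mono)
  qed (rule b(2))
  then show ?thesis using ne encode_inj by (metis order_le_less)
qed

text \<open>If no finite set generates \<open>A\<close>, pick again and again an element outside the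
  ideal generated so far with minimal leading exponent. By Dickson the leading exponent of some
  \<open>P i\<close> divides that of a later \<open>P j\<close>; cancelling leading terms leaves an
  element still outside the ideal of \<open>G j\<close> but with smaller leading exponent, against
  the choice of \<open>P j\<close>.\<close>

theorem hilbert_basis:
  fixes A :: "('n::finite, 'k::field) mpoly set"
  assumes A: "ideal A \<S>"
  shows "\<exists>F. finite F \<and> F \<subseteq> A \<and> A = Idl\<^bsub>\<S>\<^esub> F"
proof (rule ccontr)
  assume no: "\<not> ?thesis"
  define lead :: "('n, 'k) mpoly \<Rightarrow> nat \<Rightarrow>\<^sub>0 nat" where "lead p = Max (encode ` keys p)" for p
  let ?r = "{(u, v :: nat \<Rightarrow>\<^sub>0 nat). u < v \<and> keys u \<subseteq> {..<CARD('n)} \<and> keys v \<subseteq> {..<CARD('n)}}"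
  have ex: "\<exists>p. p \<in> A \<and> p \<notin> Idl\<^bsub>\<S>\<^esub> F \<and> (\<forall>q. q \<in> A \<longrightarrow> q \<notin> Idl\<^bsub>\<S>\<^esub> F \<longrightarrow> (lead q, lead p) \<notin> ?r)"
    if "finite F" "F \<subseteq> A" for F
  proof -
    obtain p where p: "p \<in> A - Idl\<^bsub>\<S>\<^esub> F"
      using no \<open>finite F\<close> \<open>F \<subseteq> A\<close> Idl_minimal[OF A \<open>F \<subseteq> A\<close>] by blast
    obtain z where "z \<in> A - Idl\<^bsub>\<S>\<^esub> F" "\<And>y. (y, z) \<in> inv_image ?r lead \<Longrightarrow> y \<notin> A - Idl\<^bsub>\<S>\<^esub> F"
      using wfE_min[OF wf_inv_image[OF wf_exponents[of "CARD('n)"], of lead] p] by blast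
    then show ?thesis unfolding in_inv_image by blast
  qed
  define pick where "pick F = (SOME p. p \<in> A \<and> p \<notin> Idl\<^bsub>\<S>\<^esub> F \<and>
    (\<forall>q. q \<in> A \<longrightarrow> q \<notin> Idl\<^bsub>\<S>\<^esub> F \<longrightarrow> (lead q, lead p) \<notin> ?r))" for F
  define G where "G i = ((\<lambda>F. insert (pick F) F) ^^ i) {}" for i
  have pick: "pick F \<in> A" "pick F \<notin> Idl\<^bsub>\<S>\<^esub> F"
      "\<And>q. q \<in> A \<Longrightarrow> q \<notin> Idl\<^bsub>\<S>\<^esub> F \<Longrightarrow> (lead q, lead (pick F)) \<notin> ?r"
    if "finite F" "F \<subseteq> A" for F
    using someI_ex[OF ex[OF that], folded pick_def] by blast+
  have GS: "G (Suc i) = insert (pick (G i)) (G i)" for i by (simp add: G_def)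
  have G: "finite (G i) \<and> G i \<subseteq> A" for i
  proof (induction i)
    case (Suc i)
    then show ?case using pick(1) by (simp add: GS)
  qed (simp add: G_def)
  have Gmono: "G i \<subseteq> G j" if "i \<le> j" for i j
    using lift_Suc_mono_le[of G] GS that by auto
  define P where "P i = pick (G i)" for i
  have P: "P i \<in> A" "P i \<notin> Idl\<^bsub>\<S>\<^esub> (G i)"
    "\<And>q. q \<in> A \<Longrightarrow> q \<notin> Idl\<^bsub>\<S>\<^esub> (G i) \<Longrightarrow> (lead q, lead (P i)) \<notin> ?r" for i
    using pick[of "G i"] G[of i] unfolding P_def by blast+
  have nz: "P i \<noteq> 0" for i using P(2)[of i] ideal_zero[OF Idl_ideal] by metis
  have "\<exists>a. a \<in> keys (P i) \<and> (\<forall>b\<in>keys (P i). encode b \<le> encode a)" for i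
    using leading_exponent[OF nz[of i]] by metis
  then obtain e where e: "\<And>i. e i \<in> keys (P i)" "\<And>i b. b \<in> keys (P i) \<Longrightarrow> encode b \<le> encode (e i)" by metis
  have lead: "lead p = encode a" if "a \<in> keys p" "\<And>b. b \<in> keys p \<Longrightarrow> encode b \<le> encode a" for p a
    unfolding lead_def using that by (intro Max_eqI) auto
  obtain i j where ij: "i < j" "\<forall>s. lookup (encode (e i)) s \<le> lookup (encode (e j)) s"
    using dickson[of "{..<CARD('n)}" "\<lambda>i. encode (e i)"] keys_encode by blast
  define b where "b = e j - e i"
  have ej: "e j = e i + b" using encode_pointwise[of "e i" "e j"] ij(2)
    by (intro poly_mapping_eqI) (simp add: b_def lookup_add lookup_minus)
  define q where "q = P j - single b (lookup (P j) (e i + b) / lookup (P i) (e i)) * P i"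
  have qk: "encode x < encode (e j)" if "x \<in> keys q" for x
    using cancel_leading_term[of "e i" "P i" b "P j" x] e(1)[of i] e(1)[of j] e(2)[of _ i] e(2)[of _ j] that
    by (simp add: ej q_def)
  have "P i \<in> G j" using Gmono[of "Suc i" j] ij(1) GS by (auto simp: P_def)
  then have Pi: "P i \<in> Idl\<^bsub>\<S>\<^esub> (G j)" using Idl_superset by blast
  have qA: "q \<in> A" unfolding q_def using P(1) A by (intro ideal_diff ideal_mult) auto
  have qn: "q \<notin> Idl\<^bsub>\<S>\<^esub> (G j)"
  proof
    assume "q \<in> Idl\<^bsub>\<S>\<^esub> (G j)"
    then have "q + single b (lookup (P j) (e i + b) / lookup (P i) (e i)) * P i \<in> Idl\<^bsub>\<S>\<^esub> (G j)"
      using Pi by (intro ideal_add ideal_mult Idl_ideal) auto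
    then show False using P(2)[of j] by (simp add: q_def)
  qed
  have "(lead q, lead (P j)) \<in> ?r"
  proof -
    have "q \<noteq> 0" using qn ideal_zero[OF Idl_ideal] by metis
    then obtain a where a: "a \<in> keys q" "\<And>b. b \<in> keys q \<Longrightarrow> encode b \<le> encode a"
      using leading_exponent by metis
    then show ?thesis using qk[of a] keys_encode[of a] keys_encode[of "e j"]
      lead[of a q] lead[of "e j" "P j"] e by simp
  qed
  then show False using P(3)[OF qA qn] by blast
qed

text \<open>The finitely many generators of the union of a chain lie in one of its members. Larger
  ideals count as smaller in this relation, so induction may assume a claim for all strictly larger
  ideals.\<close>

lemma wf_ideals: "wf {(B, A :: ('n::finite, 'k::field) mpoly set). ideal A \<S> \<and> ideal B \<S> \<and> A \<subset> B}"
  unfolding wf_iff_no_infinite_down_chain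
proof
  assume "\<exists>g. \<forall>i. (g (Suc i), g i) \<in> {(B, A :: ('n, 'k) mpoly set). ideal A \<S> \<and> ideal B \<S> \<and> A \<subset> B}"
  then obtain g :: "nat \<Rightarrow> ('n, 'k) mpoly set"
    where "\<forall>i. (g (Suc i), g i) \<in> {(B, A). ideal A \<S> \<and> ideal B \<S> \<and> A \<subset> B}" by (elim exE)
  then have g: "\<And>i. ideal (g i) \<S>" "\<And>i. g i \<subset> g (Suc i)" by simp_all
  have mono: "g i \<subseteq> g j" if "i \<le> j" for i j using lift_Suc_mono_le[of g] g(2) that by blast
  let ?U = "\<Union>i. g i"
  have U: "ideal ?U \<S>"
    unfolding ideal_class_ring_iff
  proof (intro conjI ballI allI)
    show "0 \<in> ?U" using ideal_zero[OF g(1)[of 0]] by auto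
    show "r * a \<in> ?U" if a: "a \<in> ?U" for a r
    proof -
      obtain i where "a \<in> g i" using a by auto
      then have "r * a \<in> g i" by (rule ideal_mult[OF g(1)])
      then show ?thesis by auto
    qed
    fix a b assume "a \<in> ?U" "b \<in> ?U"
    then obtain i j where "a \<in> g i" "b \<in> g j" by auto
    then have "a \<in> g (max i j)" "b \<in> g (max i j)" using mono[of i "max i j"] mono[of j "max i j"] by auto
    then have "a + b \<in> g (max i j)" by (rule ideal_add[OF g(1)])
    then show "a + b \<in> ?U" by auto
  qed
  obtain F where F: "finite F" "F \<subseteq> ?U" "?U = Idl\<^bsub>\<S>\<^esub> F" using hilbert_basis[OF U] by (elim exE conjE)
  have "\<exists>m. F \<subseteq> g m" using F(1,2)
  proof (induction F)
    case (insert x F)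
    then obtain m where m: "F \<subseteq> g m" by auto
    obtain k where k: "x \<in> g k" using insert.prems by auto
    have "insert x F \<subseteq> g (max m k)" using mono[of m "max m k"] mono[of k "max m k"] m k by auto
    then show ?case by blast
  qed auto
  then obtain m where "F \<subseteq> g m" by blast
  then have "?U \<subseteq> g m" using F(3) Idl_minimal[OF g(1)] by metis
  then show False using g(2)[of m] by blast
qed


section \<open>Homogeneous parts\<close>

interpretation mpoly_vs: vector_space "\<lambda>c p. mpoly_const c * p :: ('n::finite, 'k::field) mpoly"
  by unfold_locales (auto simp: mpoly_const_def algebra_simps single_add mult_single)

lemma lookup_hom_part: "lookup (mpoly_hom_part i f) m = (if mono_deg m = i then lookup f m else 0)"
proof -
  have "lookup (mpoly_hom_part i f) m =
      (\<Sum>m'\<in>{m \<in> keys f. mono_deg m = i}. if m' = m then lookup f m' else 0)"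
    by (simp add: mpoly_hom_part_def lookup_sum lookup_single when_def)
  also have "\<dots> = (if m \<in> {m \<in> keys f. mono_deg m = i} then lookup f m else 0)"
    by (rule sum.delta) simp
  finally show ?thesis by (auto simp: in_keys_iff)
qed

lemma hom_part_add: "mpoly_hom_part i (f + g) = mpoly_hom_part i f + mpoly_hom_part i g"
  by (rule poly_mapping_eqI) (simp add: lookup_hom_part lookup_add)

lemma hom_part_zero: "mpoly_hom_part i 0 = 0"
  by (rule poly_mapping_eqI) (simp add: lookup_hom_part)

lemma hom_part_sum: "mpoly_hom_part i (sum f T) = (\<Sum>t\<in>T. mpoly_hom_part i (f t))"
  by (induction T rule: infinite_finite_induct) (auto simp: hom_part_add hom_part_zero)

lemma hom_componentD: "f \<in> mpoly_hom_component i \<Longrightarrow> lookup f m \<noteq> 0 \<Longrightarrow> mono_deg m = i"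
  by (auto simp: mpoly_hom_component_def in_keys_iff)

lemma hom_componentI: "(\<And>m. lookup f m \<noteq> 0 \<Longrightarrow> mono_deg m = i) \<Longrightarrow> f \<in> mpoly_hom_component i"
  by (auto simp: mpoly_hom_component_def in_keys_iff)

lemma hom_part_component: "mpoly_hom_part i f \<in> mpoly_hom_component i"
  by (rule hom_componentI) (auto simp: lookup_hom_part split: if_splits)

lemma hom_part_of_component:
  assumes "f \<in> mpoly_hom_component i"
  shows "mpoly_hom_part j f = (if j = i then f else 0)"
  by (rule poly_mapping_eqI) (use hom_componentD[OF assms] in \<open>auto simp: lookup_hom_part\<close>)

lemma sum_hom_parts:
  assumes "finite T" "\<And>m. m \<in> keys f \<Longrightarrow> mono_deg m \<in> T"
  shows "(\<Sum>i\<in>T. mpoly_hom_part i f) = f"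
  by (rule poly_mapping_eqI)
     (use assms in \<open>auto simp: lookup_sum lookup_hom_part sum.delta in_keys_iff\<close>)

lemma hom_part_eq_0: "i \<notin> mono_deg ` keys f \<Longrightarrow> mpoly_hom_part i f = 0"
  by (rule poly_mapping_eqI) (auto simp: lookup_hom_part in_keys_iff)

lemma mono_deg_add: "mono_deg (a + b) = mono_deg a + mono_deg b"
  by (simp add: mono_deg_def lookup_add sum.distrib)

lemma hom_component_mult:
  "f \<in> mpoly_hom_component a \<Longrightarrow> g \<in> mpoly_hom_component b \<Longrightarrow> f * g \<in> mpoly_hom_component (a + b)"
  using keys_mult[of f g] by (fastforce simp: mpoly_hom_component_def mono_deg_add)

lemma hom_component_add:
  "f \<in> mpoly_hom_component a \<Longrightarrow> g \<in> mpoly_hom_component a \<Longrightarrow> f + g \<in> mpoly_hom_component a"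
  using keys_add[of f g] by (fastforce simp: mpoly_hom_component_def)

lemma hom_component_zero: "0 \<in> mpoly_hom_component a"
  by (simp add: mpoly_hom_component_def)

lemma hom_component_const: "mpoly_const c \<in> mpoly_hom_component 0"
  by (simp add: mpoly_hom_component_def mpoly_const_def mono_deg_def)

lemma hom_component_subspace: "mpoly_vs.subspace (mpoly_hom_component a)"
  unfolding mpoly_vs.subspace_def
  using hom_component_add hom_component_zero hom_component_mult[OF hom_component_const] by fastforce

lemma hom_part_mult:
  assumes "f \<in> mpoly_hom_component a"
  shows "mpoly_hom_part j (f * g) = (if a \<le> j then f * mpoly_hom_part (j - a) g else 0)"
proof -
  let ?T = "mono_deg ` keys g"
  have "f * g = (\<Sum>i\<in>?T. f * mpoly_hom_part i g)"
    using sum_hom_parts[of ?T g] by (simp add: sum_distrib_left[symmetric])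
  then have "mpoly_hom_part j (f * g) = (\<Sum>i\<in>?T. mpoly_hom_part j (f * mpoly_hom_part i g))"
    by (simp add: hom_part_sum)
  also have "\<dots> = (\<Sum>i\<in>?T. if j = a + i then f * mpoly_hom_part i g else 0)"
    using hom_part_of_component[OF hom_component_mult[OF assms hom_part_component]] by simp
  also have "\<dots> = (if a \<le> j then f * mpoly_hom_part (j - a) g else 0)"
  proof (cases "a \<le> j")
    case True
    then have "(\<Sum>i\<in>?T. if j = a + i then f * mpoly_hom_part i g else 0)
        = (\<Sum>i\<in>?T. if i = j - a then f * mpoly_hom_part i g else 0)"
      by (intro sum.cong refl) auto
    also have "\<dots> = (if j - a \<in> ?T then f * mpoly_hom_part (j - a) g else 0)"
      by (rule sum.delta) simp
    finally show ?thesis using True hom_part_eq_0[of "j - a" g] by auto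
  next
    case False
    then show ?thesis by (intro trans[OF sum.neutral]) auto
  qed
  finally show ?thesis .
qed

lemma graded_idealD: "graded_ideal I \<Longrightarrow> ideal I \<S>" "graded_ideal I \<Longrightarrow> f \<in> I \<Longrightarrow> mpoly_hom_part i f \<in> I"
  by (auto simp: graded_ideal_def)

lemma graded_ideal_insert:
  assumes "graded_ideal A" "f \<in> mpoly_hom_component a"
  shows "graded_ideal (ideal_insert f A)"
  unfolding graded_ideal_def
proof (intro conjI ballI allI)
  show "ideal (ideal_insert f A) \<S>" using assms ideal_ideal_insert graded_idealD by blast
  fix p i assume "p \<in> ideal_insert f A"
  then obtain x q where p: "p = x + f * q" "x \<in> A" by (auto simp: ideal_insert_def)
  have "mpoly_hom_part i p = mpoly_hom_part i x + f * (if a \<le> i then mpoly_hom_part (i - a) q else 0)"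
    by (simp add: p(1) hom_part_add hom_part_mult[OF assms(2)])
  then show "mpoly_hom_part i p \<in> ideal_insert f A"
    using ideal_insertI[OF graded_idealD(2)[OF assms(1) p(2)]] by metis
qed

lemma graded_ideal_homogeneous_generators:
  fixes I :: "('n::finite, 'k::field) mpoly set"
  assumes "graded_ideal I"
  shows "\<exists>F. finite F \<and> F \<subseteq> I \<and> (\<forall>f\<in>F. \<exists>d. f \<in> mpoly_hom_component d) \<and> I = Idl\<^bsub>\<S>\<^esub> F"
proof -
  obtain G where G: "finite G" "G \<subseteq> I" "I = Idl\<^bsub>\<S>\<^esub> G"
    using hilbert_basis graded_idealD(1)[OF assms] by blast
  define F where "F = (\<Union>g\<in>G. (\<lambda>i. mpoly_hom_part i g) ` mono_deg ` keys g)"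
  have FI: "F \<subseteq> I" using G(2) graded_idealD(2)[OF assms] by (auto simp: F_def)
  have "g \<in> Idl\<^bsub>\<S>\<^esub> F" if "g \<in> G" for g
  proof -
    have "(\<Sum>i\<in>mono_deg ` keys g. mpoly_hom_part i g) \<in> Idl\<^bsub>\<S>\<^esub> F"
      using that Idl_superset[of F] by (intro ideal_sum[OF Idl_ideal]) (auto simp: F_def)
    then show ?thesis using sum_hom_parts[of "mono_deg ` keys g" g] by simp
  qed
  then have "I = Idl\<^bsub>\<S>\<^esub> F"
    using Idl_minimal[OF Idl_ideal[of F], of G] Idl_minimal[OF graded_idealD(1)[OF assms] FI] G(3) by blast
  moreover have "\<forall>f\<in>F. \<exists>d. f \<in> mpoly_hom_component d" using hom_part_component by (fastforce simp: F_def)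
  ultimately show ?thesis using FI G(1) by (intro exI[of _ F]) (auto simp: F_def)
qed

lemma hom_part_product:
  assumes "\<And>m. m \<in> keys u \<Longrightarrow> mono_deg m \<le> M"
  shows "mpoly_hom_part k (u * v) = (\<Sum>i\<le>M. if i \<le> k then mpoly_hom_part i u * mpoly_hom_part (k - i) v else 0)"
proof -
  have "u * v = (\<Sum>i\<le>M. mpoly_hom_part i u * v)"
    using sum_hom_parts[of "{..M}" u] assms by (simp add: sum_distrib_right[symmetric])
  then show ?thesis
    by (simp add: hom_part_sum hom_part_mult[OF hom_part_component])
qed

lemma top_part_outside:
  assumes "ideal A \<S>" "u \<notin> A"
  obtains a where "mpoly_hom_part a u \<notin> A" "\<And>i. i > a \<Longrightarrow> mpoly_hom_part i u \<in> A"
proof -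
  let ?B = "{i. mpoly_hom_part i u \<notin> A}"
  have "?B \<subseteq> mono_deg ` keys u" using hom_part_eq_0 ideal_zero[OF assms(1)] by fastforce
  then have fin: "finite ?B" by (rule finite_subset) simp
  have "?B \<noteq> {}"
  proof
    assume "?B = {}"
    then have "(\<Sum>i\<in>mono_deg ` keys u. mpoly_hom_part i u) \<in> A" by (intro ideal_sum[OF assms(1)]) auto
    then show False using assms(2) sum_hom_parts[of "mono_deg ` keys u" u] by simp
  qed
  then have "Max ?B \<in> ?B" using fin Max_in by blast
  moreover have "mpoly_hom_part i u \<in> A" if "i > Max ?B" for i
    using Max_ge[OF fin, of i] that by auto
  ultimately show ?thesis using that by blast
qed

text \<open>For \<open>u * v\<close> in \<open>A\<close> with both factors outside, take their
  topmost parts outside \<open>A\<close>, of degrees \<open>a\<close> and \<open>b\<close>. In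
  degree \<open>a + b\<close> of \<open>u * v\<close> every other product involves a part of
  \<open>u\<close> above \<open>a\<close> or of \<open>v\<close> above \<open>b\<close> and so lies
  in \<open>A\<close>; hence the product of the two top parts does as well.\<close>

lemma graded_ideal_prime_test:
  fixes A :: "('n::finite, 'k::field) mpoly set"
  assumes A: "graded_ideal A" "A \<noteq> UNIV" "\<not> primeideal A \<S>"
  obtains f g a b where "f \<in> mpoly_hom_component a" "g \<in> mpoly_hom_component b" "f \<notin> A" "g \<notin> A" "f * g \<in> A"
proof -
  note id = graded_idealD(1)[OF A(1)]
  obtain u v where uv: "u * v \<in> A" "u \<notin> A" "v \<notin> A"
    using A id by (auto simp: primeideal_class_ring_iff)
  obtain a where a: "mpoly_hom_part a u \<notin> A" "\<And>i. i > a \<Longrightarrow> mpoly_hom_part i u \<in> A"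
    using top_part_outside[OF id uv(2)] by blast
  obtain b where b: "mpoly_hom_part b v \<notin> A" "\<And>i. i > b \<Longrightarrow> mpoly_hom_part i v \<in> A"
    using top_part_outside[OF id uv(3)] by blast
  define M where "M = Max (insert a (mono_deg ` keys u))"
  have M: "a \<le> M" "\<And>m. m \<in> keys u \<Longrightarrow> mono_deg m \<le> M" by (auto simp: M_def)
  let ?h = "\<lambda>i. if i \<le> a + b then mpoly_hom_part i u * mpoly_hom_part (a + b - i) v else 0"
  have "mpoly_hom_part (a + b) (u * v) = (\<Sum>i\<le>M. ?h i)" by (rule hom_part_product[OF M(2)])
  also have "\<dots> = ?h a + (\<Sum>i\<in>{..M} - {a}. ?h i)" using M(1) by (subst sum.remove[of _ a]) auto
  finally have "?h a = mpoly_hom_part (a + b) (u * v) - (\<Sum>i\<in>{..M} - {a}. ?h i)" by simp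
  moreover have "(\<Sum>i\<in>{..M} - {a}. ?h i) \<in> A"
  proof (rule ideal_sum[OF id])
    fix i assume i: "i \<in> {..M} - {a}"
    show "?h i \<in> A"
    proof (cases "i > a")
      case True
      then show ?thesis using a(2) ideal_mult_right[OF id] ideal_zero[OF id] by auto
    next
      case False
      then have "a + b - i > b" using i by auto
      then show ?thesis using b(2) ideal_mult[OF id] ideal_zero[OF id] by auto
    qed
  qed
  ultimately have "mpoly_hom_part a u * mpoly_hom_part b v \<in> A"
    using ideal_diff[OF id graded_idealD(2)[OF A(1) uv(1)]] by simp
  then show ?thesis using that[OF hom_part_component hom_part_component a(1) b(1)] by blast
qed

definition mvar :: "'n::finite \<Rightarrow> ('n, 'k::field) mpoly"
  where "mvar s = single (single s 1) 1"

lemma mono_deg_single: "mono_deg (single s c) = c"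
  by (simp add: mono_deg_def lookup_single when_def)

lemma mvar_component: "mvar s \<in> mpoly_hom_component 1"
  by (simp add: mpoly_hom_component_def mvar_def mono_deg_single)

section \<open>Krull dimension bounds the growth of the Hilbert function\<close>

text \<open>\<open>D\<close> counts the members of a prime chain and is thus one more than a
  dimension: the growth has degree \<open>D - 1\<close>, and \<open>D = 0\<close> stands for the
  zero module.\<close>

definition growth_bound :: "nat \<Rightarrow> nat \<Rightarrow> nat"
  where "growth_bound D i = (if D = 0 then 0 else (i + 1) ^ (D - 1))"

text \<open>Homogeneous spanning sets modulo \<open>A\<close> replace dimensions of the graded
  pieces of the quotient by \<open>A\<close>. They need not be minimal, so upper bounds can be
  combined by forming unions and multiplying by elements, without exact sequences.\<close>

definition growth_witness ::
    "('n::finite, 'k::field) mpoly set \<Rightarrow> nat \<Rightarrow> (nat \<Rightarrow> ('n, 'k) mpoly set) \<Rightarrow> nat \<Rightarrow> bool"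
  where "growth_witness A D E C \<longleftrightarrow>
    (\<forall>j. finite (E j) \<and> E j \<subseteq> mpoly_hom_component j) \<and>
    (\<forall>j. \<forall>p\<in>mpoly_hom_component j. \<exists>a\<in>A. \<exists>e\<in>mpoly_vs.span (E j). p = a + e) \<and>
    (\<forall>i. (\<Sum>j\<le>i. card (E j)) \<le> C * growth_bound D i)"

definition growth_bounded :: "('n::finite, 'k::field) mpoly set \<Rightarrow> nat \<Rightarrow> bool"
  where "growth_bounded A D \<longleftrightarrow> (\<exists>E C. growth_witness A D E C)"

lemma growth_witnessD:
  assumes "growth_witness A D E C"
  shows "finite (E j)" "E j \<subseteq> mpoly_hom_component j"
    "p \<in> mpoly_hom_component j \<Longrightarrow> \<exists>a\<in>A. \<exists>e\<in>mpoly_vs.span (E j). p = a + e"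
    "(\<Sum>j\<le>i. card (E j)) \<le> C * growth_bound D i"
  using assms by (simp_all add: growth_witness_def)

lemma growth_boundedI:
  assumes "\<And>j. finite (E j)" "\<And>j. E j \<subseteq> mpoly_hom_component j"
    "\<And>j p. p \<in> mpoly_hom_component j \<Longrightarrow> \<exists>a\<in>A. \<exists>e\<in>mpoly_vs.span (E j). p = a + e"
    "\<And>i. (\<Sum>j\<le>i. card (E j)) \<le> C * growth_bound D i"
  shows "growth_bounded A D"
  unfolding growth_bounded_def growth_witness_def
  by (intro exI[of _ E] exI[of _ C] conjI allI ballI assms)

lemma span_times:
  assumes "e \<in> mpoly_vs.span E"
  shows "f * e \<in> mpoly_vs.span ((*) f ` E)"
  using assms
proof (induction rule: mpoly_vs.span_induct_alt)
  case base
  then show ?case by (simp add: mpoly_vs.span_zero)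
next
  case (step c x y)
  have "f * (mpoly_const c * x + y) = mpoly_const c * (f * x) + f * y" by (simp add: algebra_simps)
  then show ?case using step
    by (simp add: mpoly_vs.span_add mpoly_vs.span_scale mpoly_vs.span_base)
qed

lemma span_component: "E \<subseteq> mpoly_hom_component j \<Longrightarrow> mpoly_vs.span E \<subseteq> mpoly_hom_component j"
  by (rule mpoly_vs.span_minimal[OF _ hom_component_subspace])

text \<open>Taking degree-\<open>j\<close> parts makes the multiplier of \<open>f\<close>
  homogeneous of degree \<open>j - a\<close>. If \<open>a\<close> exceeds \<open>j\<close> the
  multiple of \<open>f\<close> drops out, which the case distinction guards against truncated
  subtraction.\<close>

lemma insert_decompose:
  assumes A: "graded_ideal A" and f: "f \<in> mpoly_hom_component a"
    and p: "p \<in> mpoly_hom_component j" "p = a' + e" "a' \<in> ideal_insert f A" "e \<in> mpoly_hom_component j"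
  obtains x q where "x \<in> A" "q \<in> mpoly_hom_component (j - a)" "p = x + (if a \<le> j then f * q else 0) + e"
proof -
  obtain y q where y: "a' = y + f * q" "y \<in> A" using p(3) by (auto simp: ideal_insert_def)
  have "p = mpoly_hom_part j p" using hom_part_of_component[OF p(1), of j] by simp
  also have "\<dots> = mpoly_hom_part j y + (if a \<le> j then f * mpoly_hom_part (j - a) q else 0) + e"
    using hom_part_of_component[OF p(4), of j] by (simp add: p(2) y(1) hom_part_add hom_part_mult[OF f])
  finally show ?thesis by (rule that[OF graded_idealD(2)[OF A y(2)] hom_part_component])
qed

text \<open>Modulo \<open>A\<close>, an element is \<open>f * q + e1\<close> with \<open>e1\<close>
  in the first span. Reducing \<open>q\<close> modulo \<open>A + (g)\<close> leaves
  \<open>f * e2\<close>, because the multiple of \<open>g\<close> becomes a multiple of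
  \<open>f * g\<close> and lies in \<open>A\<close>. So the first spanning set and \<open>f\<close>
  times the second one suffice.\<close>

lemma growth_bounded_product:
  fixes A :: "('n::finite, 'k::field) mpoly set"
  assumes A: "graded_ideal A" and f: "f \<in> mpoly_hom_component a" and fg: "f * g \<in> A"
    and 1: "growth_bounded (ideal_insert f A) D" and 2: "growth_bounded (ideal_insert g A) D"
  shows "growth_bounded A D"
proof -
  note id = graded_idealD(1)[OF A]
  obtain E1 C1 where "growth_witness (ideal_insert f A) D E1 C1"
    using 1 by (auto simp: growth_bounded_def)
  note E1 = growth_witnessD[OF this]
  obtain E2 C2 where "growth_witness (ideal_insert g A) D E2 C2"
    using 2 by (auto simp: growth_bounded_def)
  note E2 = growth_witnessD[OF this]
  define E where "E j = E1 j \<union> (if a \<le> j then (*) f ` E2 (j - a) else {})" for j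
  show ?thesis
  proof (rule growth_boundedI[where E = E and C = "C1 + C2"])
    show "finite (E j)" for j using E1(1) E2(1) by (simp add: E_def)
    show "E j \<subseteq> mpoly_hom_component j" for j
      using E1(2) E2(2)[of "j - a"] hom_component_mult[OF f, of _ "j - a"] by (auto simp: E_def)
    show "(\<Sum>j\<le>i. card (E j)) \<le> (C1 + C2) * growth_bound D i" for i
    proof -
      have "(\<Sum>j\<le>i. card (E j)) \<le> (\<Sum>j\<le>i. card (E1 j) + (if a \<le> j then card (E2 (j - a)) else 0))"
      proof (rule sum_mono)
        fix j
        have "card (E j) \<le> card (E1 j) + card (if a \<le> j then (*) f ` E2 (j - a) else {})"
          unfolding E_def by (rule card_Un_le)
        also have "card (if a \<le> j then (*) f ` E2 (j - a) else {}) \<le> (if a \<le> j then card (E2 (j - a)) else 0)"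
          using card_image_le[OF E2(1)] by auto
        finally show "card (E j) \<le> card (E1 j) + (if a \<le> j then card (E2 (j - a)) else 0)" by simp
      qed
      also have "\<dots> = (\<Sum>j\<le>i. card (E1 j)) + (\<Sum>j\<le>i. if a \<le> j then card (E2 (j - a)) else 0)"
        by (rule sum.distrib)
      also have "(\<Sum>j\<le>i. if a \<le> j then card (E2 (j - a)) else 0) = (\<Sum>j\<in>{a..i}. card (E2 (j - a)))"
        by (intro sum.mono_neutral_cong_right) auto
      also have "\<dots> = (\<Sum>j\<in>(\<lambda>j. j - a) ` {a..i}. card (E2 j))"
        by (subst sum.reindex) (auto simp: inj_on_def)
      also have "\<dots> \<le> (\<Sum>j\<le>i. card (E2 j))" by (rule sum_mono2) auto
      finally have "(\<Sum>j\<le>i. card (E j)) \<le> (\<Sum>j\<le>i. card (E1 j)) + (\<Sum>j\<le>i. card (E2 j))" by simp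
      then show ?thesis using E1(4)[of i] E2(4)[of i] by (simp add: distrib_right)
    qed
    fix j and p :: "('n, 'k) mpoly" assume p: "p \<in> mpoly_hom_component j"
    obtain a1 e1 where a1: "a1 \<in> ideal_insert f A" "e1 \<in> mpoly_vs.span (E1 j)" "p = a1 + e1"
      using E1(3)[OF p] by blast
    have e1: "e1 \<in> mpoly_hom_component j" using span_component[OF E1(2)] a1(2) by blast
    obtain x q where x: "x \<in> A" "q \<in> mpoly_hom_component (j - a)" "p = x + (if a \<le> j then f * q else 0) + e1"
      by (rule insert_decompose[OF A f p a1(3,1) e1])
    have e1': "e1 \<in> mpoly_vs.span (E j)" using a1(2) mpoly_vs.span_mono[of "E1 j" "E j"] by (auto simp: E_def)
    show "\<exists>a\<in>A. \<exists>e\<in>mpoly_vs.span (E j). p = a + e"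
    proof (cases "a \<le> j")
      case True
      obtain a2 e2 where a2: "a2 \<in> ideal_insert g A" "e2 \<in> mpoly_vs.span (E2 (j - a))" "q = a2 + e2"
        using E2(3)[OF x(2)] by blast
      obtain y r where y: "a2 = y + g * r" "y \<in> A" using a2(1) by (auto simp: ideal_insert_def)
      have "f * e2 \<in> mpoly_vs.span ((*) f ` E2 (j - a))" using span_times a2(2) by blast
      then have e2': "f * e2 \<in> mpoly_vs.span (E j)"
        using mpoly_vs.span_mono[of "(*) f ` E2 (j - a)" "E j"] True by (auto simp: E_def)
      have "x + f * y + (f * g) * r \<in> A"
        by (rule ideal_add[OF id ideal_add[OF id x(1) ideal_mult[OF id y(2)]] ideal_mult_right[OF id fg]])
      moreover have "f * e2 + e1 \<in> mpoly_vs.span (E j)" by (rule mpoly_vs.span_add[OF e2' e1'])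
      moreover have "p = (x + f * y + (f * g) * r) + (f * e2 + e1)"
        using x(3) True by (simp add: a2(3) y(1) algebra_simps)
      ultimately show ?thesis by blast
    next
      case False
      then show ?thesis using x e1' by auto
    qed
  qed
qed

text \<open>Modulo \<open>A\<close>, an element of degree \<open>j + 1\<close> is
  \<open>f * q + e1\<close> with \<open>q\<close> of degree \<open>j\<close>, to which the same
  reduction applies. The spanning set in degree \<open>j\<close> thus collects those of
  \<open>A + (f)\<close> in all degrees up to \<open>j\<close>, and summing once more raises the
  growth by one degree.\<close>

lemma growth_bounded_hyperplane:
  fixes A :: "('n::finite, 'k::field) mpoly set"
  assumes A: "graded_ideal A" and f: "f \<in> mpoly_hom_component 1"
    and "growth_bounded (ideal_insert f A) D"
  shows "growth_bounded A (Suc D)"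
proof -
  obtain E1 C1 where "growth_witness (ideal_insert f A) D E1 C1"
    using assms(3) by (auto simp: growth_bounded_def)
  note E1 = growth_witnessD[OF this]
  define E where "E = rec_nat (E1 0) (\<lambda>j F. E1 (Suc j) \<union> (*) f ` F)"
  have E0: "E 0 = E1 0" and ES: "E (Suc j) = E1 (Suc j) \<union> (*) f ` E j" for j by (simp_all add: E_def)
  have fin: "finite (E j)" for j by (induction j) (auto simp: E0 ES E1(1))
  have sub: "E1 j \<subseteq> E j" for j by (cases j) (auto simp: E0 ES)
  have comp: "E j \<subseteq> mpoly_hom_component j" for j
  proof (induction j)
    case (Suc j)
    then show ?case using E1(2)[of "Suc j"] hom_component_mult[OF f, of _ j] by (auto simp: ES)
  qed (use E1(2) E0 in auto)
  have cardE: "card (E j) \<le> (\<Sum>t\<le>j. card (E1 t))" for j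
  proof (induction j)
    case (Suc j)
    have "card (E (Suc j)) \<le> card (E1 (Suc j)) + card ((*) f ` E j)" unfolding ES by (rule card_Un_le)
    also have "card ((*) f ` E j) \<le> card (E j)" by (rule card_image_le[OF fin])
    finally show ?case using Suc by simp
  qed (simp add: E0)
  show ?thesis
  proof (rule growth_boundedI[where E = E and C = C1])
    show "finite (E j)" "E j \<subseteq> mpoly_hom_component j" for j by (fact fin comp)+
    show "(\<Sum>j\<le>i. card (E j)) \<le> C1 * growth_bound (Suc D) i" for i
    proof -
      have "card (E j) \<le> C1 * growth_bound D i" if "j \<le> i" for j
      proof -
        have "card (E j) \<le> (\<Sum>t\<le>i. card (E1 t))"
          using cardE[of j] sum_mono2[of "{..i}" "{..j}" "\<lambda>t. card (E1 t)"] that by (auto intro: order_trans)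
        then show ?thesis using E1(4)[of i] by simp
      qed
      then have "(\<Sum>j\<le>i. card (E j)) \<le> (\<Sum>j\<le>i. C1 * growth_bound D i)" by (intro sum_mono) simp
      also have "\<dots> \<le> C1 * growth_bound (Suc D) i"
      proof (cases D)
        case (Suc D')
        then show ?thesis by (simp add: growth_bound_def mult.left_commute)
      qed (simp add: growth_bound_def)
      finally show ?thesis .
    qed
    fix j and p :: "('n, 'k) mpoly" assume "p \<in> mpoly_hom_component j"
    then show "\<exists>a\<in>A. \<exists>e\<in>mpoly_vs.span (E j). p = a + e"
    proof (induction j arbitrary: p)
      case 0
      obtain a1 e1 where a1: "a1 \<in> ideal_insert f A" "e1 \<in> mpoly_vs.span (E1 0)" "p = a1 + e1"
        using E1(3)[OF 0] by blast
      have e1: "e1 \<in> mpoly_hom_component 0" using span_component[OF E1(2)] a1(2) by blast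
      obtain x q where "x \<in> A" "q \<in> mpoly_hom_component (0 - 1)" "p = x + (if 1 \<le> (0::nat) then f * q else 0) + e1"
        by (rule insert_decompose[OF A f 0 a1(3,1) e1])
      then show ?case using a1(2) E0 by auto
    next
      case (Suc j)
      obtain a1 e1 where a1: "a1 \<in> ideal_insert f A" "e1 \<in> mpoly_vs.span (E1 (Suc j))" "p = a1 + e1"
        using E1(3)[OF Suc.prems] by blast
      have e1: "e1 \<in> mpoly_hom_component (Suc j)" using span_component[OF E1(2)] a1(2) by blast
      obtain x q where "x \<in> A" "q \<in> mpoly_hom_component (Suc j - 1)" "p = x + (if 1 \<le> Suc j then f * q else 0) + e1"
        by (rule insert_decompose[OF A f Suc.prems a1(3,1) e1])
      then have x: "x \<in> A" "q \<in> mpoly_hom_component j" "p = x + f * q + e1" by simp_all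
      obtain y e2 where y: "y \<in> A" "e2 \<in> mpoly_vs.span (E j)" "q = y + e2" using Suc.IH[OF x(2)] by blast
      have "f * e2 \<in> mpoly_vs.span (E (Suc j))"
        using span_times[OF y(2), of f] mpoly_vs.span_mono[of "(*) f ` E j" "E (Suc j)"] by (auto simp: ES)
      moreover have "e1 \<in> mpoly_vs.span (E (Suc j))" using a1(2) mpoly_vs.span_mono[OF sub] by blast
      ultimately have "f * e2 + e1 \<in> mpoly_vs.span (E (Suc j))" by (rule mpoly_vs.span_add)
      moreover have "x + f * y \<in> A"
        using x(1) y(1) graded_idealD(1)[OF A] by (intro ideal_add ideal_mult) auto
      moreover have "p = (x + f * y) + (f * e2 + e1)" using x(3) y(3) by (simp add: algebra_simps)
      ultimately show ?case by blast
    qed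
  qed
qed

lemma positive_component_in_ideal:
  fixes A :: "('n::finite, 'k::field) mpoly set"
  assumes A: "ideal A \<S>" and vars: "\<And>s. mvar s \<in> A" and p: "p \<in> mpoly_hom_component (Suc j)"
  shows "p \<in> A"
proof -
  have sg: "single m c \<in> A" if "mono_deg m = Suc j" for m :: "'n \<Rightarrow>\<^sub>0 nat" and c :: 'k
  proof -
    obtain s where s: "lookup m s \<noteq> 0" using \<open>mono_deg m = Suc j\<close> by (force simp: mono_deg_def)
    have m: "single s 1 + (m - single s 1) = m"
      using s by (intro poly_mapping_eqI) (auto simp: lookup_add lookup_minus lookup_single when_def)
    have "mvar s * single (m - single s 1) c = single (single s 1 + (m - single s 1)) c"
      by (simp add: mvar_def mult_single)
    then have "mvar s * single (m - single s 1) c = single m c" unfolding m .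
    then show ?thesis using ideal_mult_right[OF A vars[of s], of "single (m - single s 1) c"] by simp
  qed
  have "p = mpoly_hom_part (Suc j) p" using hom_part_of_component[OF p, of "Suc j"] by simp
  also have "\<dots> \<in> A" unfolding mpoly_hom_part_def
    by (rule ideal_sum[OF A], rule sg) simp
  finally show ?thesis .
qed

lemma subset_chain_mono: "subset.chain X C \<Longrightarrow> X \<subseteq> Y \<Longrightarrow> subset.chain Y C"
  by (auto simp: subset.chain_def)

lemma subset_chain_mem: "subset.chain X C \<Longrightarrow> P \<in> C \<Longrightarrow> P \<in> X"
  by (auto simp: subset.chain_def)

lemma subset_chain_insert_bottom:
  "subset.chain X C \<Longrightarrow> A \<in> X \<Longrightarrow> (\<And>P. P \<in> C \<Longrightarrow> A \<subseteq> P) \<Longrightarrow> subset.chain X (insert A C)"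
  unfolding subset.chain_def by auto

abbreviation prime_chain :: "('n::finite, 'k::field) mpoly set \<Rightarrow> ('n, 'k) mpoly set set \<Rightarrow> bool"
  where "prime_chain A C \<equiv> finite C \<and> subset.chain {P. primeideal P \<S> \<and> A \<subseteq> P} C"

theorem prime_chain_growth:
  fixes A :: "('n::finite, 'k::field) mpoly set"
  assumes "graded_ideal A" "\<And>C. prime_chain A C \<Longrightarrow> card C \<le> D"
  shows "growth_bounded A D"
  using wf_ideals assms
proof (induction A arbitrary: D rule: wf_induct_rule)
  case (less A)
  note id = graded_idealD(1)[OF less.prems(1)]
  have IH: "growth_bounded (ideal_insert f A) D'"
    if "f \<in> mpoly_hom_component a" "f \<notin> A" "\<And>C. prime_chain (ideal_insert f A) C \<Longrightarrow> card C \<le> D'" for f a D'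
  proof (rule less.IH)
    have "A \<subset> ideal_insert f A"
      using that(2) ideal_insert_mem[OF id, of f] ideal_insert_superset[of A f] by blast
    then show "(ideal_insert f A, A) \<in> {(B, A). ideal A \<S> \<and> ideal B \<S> \<and> A \<subset> B}"
      using id ideal_ideal_insert[OF id] by blast
    show "graded_ideal (ideal_insert f A)" by (rule graded_ideal_insert[OF less.prems(1) that(1)])
  qed (rule that(3))
  consider "A = UNIV" | "A \<noteq> UNIV" "\<not> primeideal A \<S>" | "primeideal A \<S>" by blast
  then show ?case
  proof cases
    case 1
    show ?thesis
      by (rule growth_boundedI[where E = "\<lambda>_. {}" and C = 0]) (auto simp: 1)
  next
    case 2
    obtain f g a b where fg: "f \<in> mpoly_hom_component a" "g \<in> mpoly_hom_component b"
        "f \<notin> A" "g \<notin> A" "f * g \<in> A"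
      by (rule graded_ideal_prime_test[OF less.prems(1) 2])
    have ch: "card C \<le> D" if "prime_chain (ideal_insert h A) C" for h C
    proof (rule less.prems(2))
      have sub: "{P. primeideal P \<S> \<and> ideal_insert h A \<subseteq> P} \<subseteq> {P. primeideal P \<S> \<and> A \<subseteq> P}"
        using ideal_insert_superset[of A h] by blast
      show "prime_chain A C"
        by (rule conjI[OF conjunct1[OF that] subset_chain_mono[OF conjunct2[OF that] sub]])
    qed
    show ?thesis
      by (rule growth_bounded_product[OF less.prems(1) fg(1,5) IH[OF fg(1,3) ch] IH[OF fg(2,4) ch]])
  next
    case 3
    show ?thesis
    proof (cases "\<forall>s. mvar s \<in> A")
      case True
      \<comment> \<open>Here only constants survive modulo \<open>A\<close>, so the cumulative count
        is 1. The chain with the single member \<open>A\<close> shows \<open>D \<ge> 1\<close>,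
        which makes \<open>growth_bound\<close> at least 1.\<close>
      have "prime_chain A {A}" using 3 by (auto simp: subset.chain_def)
      then have D: "D \<ge> 1" using less.prems(2)[of "{A}"] by simp
      define E :: "nat \<Rightarrow> ('n, 'k) mpoly set" where "E j = (if j = 0 then {1} else {})" for j
      show ?thesis
      proof (rule growth_boundedI[where E = E and C = 1])
        show "finite (E j)" for j by (simp add: E_def)
        have "(1 :: ('n, 'k) mpoly) \<in> mpoly_hom_component 0"
          by (simp add: mpoly_hom_component_def mono_deg_def)
        then show "E j \<subseteq> mpoly_hom_component j" for j by (simp add: E_def)
        have "(\<Sum>j\<le>i. card (E j)) = 1" for i by (induction i) (auto simp: E_def)
        then show "(\<Sum>j\<le>i. card (E j)) \<le> 1 * growth_bound D i" for i
          using D by (simp add: growth_bound_def)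
        fix j and p :: "('n, 'k) mpoly" assume p: "p \<in> mpoly_hom_component j"
        show "\<exists>a\<in>A. \<exists>e\<in>mpoly_vs.span (E j). p = a + e"
        proof (cases j)
          case 0
          have "p = mpoly_const (lookup p 0) * 1"
          proof (rule poly_mapping_eqI)
            fix m :: "'n \<Rightarrow>\<^sub>0 nat"
            have "lookup p m = 0" if "m \<noteq> 0"
            proof -
              have "mono_deg m \<noteq> 0" using that
                by (auto simp: mono_deg_def intro: poly_mapping_eqI)
              then show ?thesis using hom_componentD[OF p, of m] 0 by auto
            qed
            then show "lookup p m = lookup (mpoly_const (lookup p 0) * 1) m"
              by (auto simp: mpoly_const_def lookup_single when_def)
          qed
          then have "p \<in> mpoly_vs.span (E j)"
            using mpoly_vs.span_scale[OF mpoly_vs.span_base[of 1 "E 0"], of "lookup p 0"] 0 by (simp add: E_def)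
          then show ?thesis using ideal_zero[OF id] by (intro bexI[of _ 0] bexI[of _ p]) auto
        next
          case (Suc i)
          then have "p \<in> A" using positive_component_in_ideal[OF id] True p by blast
          then show ?thesis using mpoly_vs.span_zero by (intro bexI[of _ p] bexI[of _ 0]) auto
        qed
      qed
    next
      case False
      then obtain s where s: "mvar s \<notin> A" by blast
      \<comment> \<open>Every chain of primes above \<open>A + (x)\<close> can be extended at the
        bottom by the prime \<open>A\<close>, which is a new member because it omits
        \<open>x\<close>.\<close>
      have "card C < D" if C: "prime_chain (ideal_insert (mvar s) A) C" for C
      proof -
        have sup: "ideal_insert (mvar s) A \<subseteq> P" if "P \<in> C" for P
          using subset_chain_mem[OF conjunct2[OF C] that] by simp
        have "mvar s \<in> ideal_insert (mvar s) A" "A \<subseteq> ideal_insert (mvar s) A"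
          using ideal_insert_mem[OF id] ideal_insert_superset by blast+
        then have "A \<notin> C" and AP: "\<And>P. P \<in> C \<Longrightarrow> A \<subseteq> P" using sup s by blast+
        have "subset.chain {P. primeideal P \<S> \<and> A \<subseteq> P} C"
          by (rule subset_chain_mono[OF conjunct2[OF C]]) (use \<open>A \<subseteq> ideal_insert (mvar s) A\<close> in auto)
        then have "subset.chain {P. primeideal P \<S> \<and> A \<subseteq> P} (insert A C)"
          by (rule subset_chain_insert_bottom) (use 3 AP in auto)
        then have "prime_chain A (insert A C)" using conjunct1[OF C] by simp
        then have "card (insert A C) \<le> D" by (rule less.prems(2))
        then show ?thesis using \<open>A \<notin> C\<close> C by simp
      qed
      then have lt: "\<And>C. prime_chain (ideal_insert (mvar s) A) C \<Longrightarrow> card C \<le> D - 1" by fastforce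
      \<comment> \<open>The empty chain excludes \<open>D = 0\<close>, so that
        \<open>Suc (D - 1)\<close> is \<open>D\<close>.\<close>
      have "prime_chain (ideal_insert (mvar s) A) {}" by (simp add: subset.chain_def)
      then have "D \<ge> 1" using \<open>\<And>C. prime_chain (ideal_insert (mvar s) A) C \<Longrightarrow> card C < D\<close>[of "{}"] by simp
      moreover have "growth_bounded A (Suc (D - 1))"
        using growth_bounded_hyperplane[OF less.prems(1) mvar_component IH[OF mvar_component s lt]] .
      ultimately show ?thesis by simp
    qed
  qed
qed


section \<open>Chains of primes have bounded length\<close>

definition mon :: "(nat \<Rightarrow> 'a::comm_monoid_mult) \<Rightarrow> nat \<Rightarrow> (nat \<Rightarrow>\<^sub>0 nat) \<Rightarrow> 'a"
  where "mon r N v = (\<Prod>s<N. r s ^ lookup v s)"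

lemma mon_add: "mon r N (u + v) = mon r N u * mon r N v"
  by (simp add: mon_def lookup_add power_add prod.distrib)

lemma mon_Suc_single: "keys u \<subseteq> {..<N} \<Longrightarrow> mon r (Suc N) (u + single N t) = mon r N u * r N ^ t"
proof -
  assume u: "keys u \<subseteq> {..<N}"
  then have "lookup u N = 0" by (meson in_keys_iff lessThan_iff less_irrefl subsetD)
  then show ?thesis by (simp add: mon_def lookup_add lookup_single when_def)
qed

lemma power_mem_prime:
  assumes "primeideal P (class_ring :: 'a::comm_ring_1 ring)" "f ^ t * x \<in> P" "f \<notin> P"
  shows "x \<in> P"
  using assms(2)
proof (induction t)
  case (Suc t)
  have "f * (f ^ t * x) \<in> P" using Suc.prems by (simp add: mult.assoc)
  then have "f ^ t * x \<in> P" using assms(1,3) unfolding primeideal_class_ring_iff by metis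
  then show ?case by (rule Suc.IH)
qed simp

text \<open>Independence is claimed modulo \<open>Q l\<close>, which makes induction on
  \<open>l\<close> possible. Divide a relation modulo \<open>Q (Suc l)\<close> by the least power of
  \<open>f l\<close> occurring in it; this is allowed since \<open>f l\<close> is outside that
  prime. Modulo the larger \<open>Q l\<close> all terms still divisible by \<open>f l\<close>
  vanish, and what remains is a nontrivial relation among monomials in the earlier elements.\<close>

lemma chain_monomials_independent:
  fixes Q :: "nat \<Rightarrow> ('n::finite, 'k::field) mpoly set"
  assumes "\<And>s. s \<le> l \<Longrightarrow> primeideal (Q s) \<S>" "\<And>s. s < l \<Longrightarrow> Q (Suc s) \<subseteq> Q s"
    and "\<And>s. s < l \<Longrightarrow> f s \<in> Q s" "\<And>s. s < l \<Longrightarrow> f s \<notin> Q (Suc s)"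
    and "finite T" "\<And>v. v \<in> T \<Longrightarrow> keys v \<subseteq> {..<l}"
    and "(\<Sum>v\<in>T. mpoly_const (c v) * mon f l v) \<in> Q l" "v \<in> T"
  shows "c v = 0"
  using assms
proof (induction l arbitrary: T c v)
  case 0
  then have "T \<subseteq> {0}" by auto
  then have T: "T = {0}" "v = 0" using \<open>v \<in> T\<close> by auto
  have "mpoly_const (c 0) \<in> Q 0" using 0 by (simp add: T mon_def)
  then have m: "mpoly_const (inverse (c 0)) * mpoly_const (c 0) \<in> Q 0"
    using 0(1)[of 0] by (intro ideal_mult) (auto simp: primeideal_class_ring_iff)
  have "1 \<notin> Q 0" using 0(1)[of 0] ideal_UNIV_iff by (auto simp: primeideal_class_ring_iff)
  then show ?case using m T by (cases "c 0 = 0") (auto simp: mpoly_const_def mult_single)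
next
  case (Suc l)
  have prime: "primeideal (Q (Suc l)) \<S>" "primeideal (Q l) \<S>" using Suc.prems(1) by auto
  then have id: "ideal (Q l) \<S>" by (simp add: primeideal_class_ring_iff)
  show ?case
  proof (rule ccontr)
    assume "c v \<noteq> 0"
    define T' where "T' = {v \<in> T. c v \<noteq> 0}"
    have T': "finite T'" "v \<in> T'" using Suc.prems(5,8) \<open>c v \<noteq> 0\<close> by (auto simp: T'_def)
    define t where "t = Min ((\<lambda>v. lookup v l) ` T')"
    have tle: "t \<le> lookup u l" if "u \<in> T'" for u using T' that by (auto simp: t_def)
    have "t \<in> (\<lambda>v. lookup v l) ` T'" unfolding t_def using T' by (intro Min_in) auto
    then obtain w where w: "w \<in> T'" "lookup w l = t" by auto
    define g where "g u = u - single l t" for u :: "nat \<Rightarrow>\<^sub>0 nat"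
    have g: "u = g u + single l t" if "u \<in> T'" for u
      using tle[OF that] by (intro poly_mapping_eqI)
        (auto simp: g_def lookup_add lookup_minus lookup_single when_def)
    have monS: "mon f (Suc l) u = f l ^ t * mon f (Suc l) (g u)" if "u \<in> T'" for u
    proof -
      have "mon f (Suc l) u = mon f (Suc l) (g u + single l t)" using g[OF that] by simp
      also have "\<dots> = mon f (Suc l) (g u) * mon f (Suc l) (single l t)" by (rule mon_add)
      also have "mon f (Suc l) (single l t) = f l ^ t" using mon_Suc_single[of 0 l f t] by (simp add: mon_def)
      finally show ?thesis by (simp add: mult.commute)
    qed
    have "(\<Sum>v\<in>T. mpoly_const (c v) * mon f (Suc l) v) = (\<Sum>v\<in>T'. mpoly_const (c v) * mon f (Suc l) v)"
      using Suc.prems(5) by (intro sum.mono_neutral_right) (auto simp: T'_def mpoly_const_def)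
    also have "\<dots> = f l ^ t * (\<Sum>v\<in>T'. mpoly_const (c v) * mon f (Suc l) (g v))"
      unfolding sum_distrib_left by (intro sum.cong refl) (simp add: monS mult.left_commute)
    finally have "f l ^ t * (\<Sum>v\<in>T'. mpoly_const (c v) * mon f (Suc l) (g v)) \<in> Q (Suc l)"
      using Suc.prems(7) by simp
    then have "(\<Sum>v\<in>T'. mpoly_const (c v) * mon f (Suc l) (g v)) \<in> Q (Suc l)"
      using power_mem_prime[OF prime(1)] Suc.prems(4) by blast
    then have all: "(\<Sum>v\<in>T'. mpoly_const (c v) * mon f (Suc l) (g v)) \<in> Q l" using Suc.prems(2) by blast
    define T0 where "T0 = {v \<in> T'. lookup v l = t}"
    have rest: "(\<Sum>v\<in>T' - T0. mpoly_const (c v) * mon f (Suc l) (g v)) \<in> Q l"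
    proof (rule ideal_sum[OF id])
      fix u assume u: "u \<in> T' - T0"
      then have "lookup (g u) l \<noteq> 0" using tle[of u] by (auto simp: T0_def g_def lookup_minus)
      then have "f l ^ lookup (g u) l = f l * f l ^ (lookup (g u) l - 1)"
        by (metis power_Suc Suc_pred' gr0I)
      then have "mpoly_const (c u) * mon f (Suc l) (g u)
          = (mpoly_const (c u) * mon f l (g u) * f l ^ (lookup (g u) l - 1)) * f l"
        by (simp add: mon_def mult_ac)
      then show "mpoly_const (c u) * mon f (Suc l) (g u) \<in> Q l"
        using ideal_mult[OF id Suc.prems(3)[of l]] by simp
    qed
    have split: "(\<Sum>v\<in>T'. mpoly_const (c v) * mon f (Suc l) (g v)) =
        (\<Sum>v\<in>T' - T0. mpoly_const (c v) * mon f (Suc l) (g v)) + (\<Sum>v\<in>T0. mpoly_const (c v) * mon f (Suc l) (g v))"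
      using T'(1) by (intro sum.subset_diff) (auto simp: T0_def)
    have "(\<Sum>v\<in>T0. mpoly_const (c v) * mon f (Suc l) (g v)) \<in> Q l"
      using ideal_diff[OF id all rest] unfolding split by simp
    moreover have "mon f (Suc l) (g u) = mon f l (g u)" if "u \<in> T0" for u
      using that by (simp add: mon_def T0_def g_def lookup_minus)
    ultimately have mem: "(\<Sum>v\<in>T0. mpoly_const (c v) * mon f l (g v)) \<in> Q l" by simp
    have inj: "inj_on g T0"
    proof (rule inj_onI)
      fix x y assume "x \<in> T0" "y \<in> T0" "g x = g y"
      then show "x = y" using g[of x] g[of y] by (simp add: T0_def)
    qed
    have "(\<Sum>u\<in>g ` T0. mpoly_const (c (u + single l t)) * mon f l u)
        = (\<Sum>v\<in>T0. mpoly_const (c v) * mon f l (g v))"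
      unfolding sum.reindex[OF inj] comp_def
      by (intro sum.cong refl) (use g in \<open>auto simp: T0_def\<close>)
    with mem have mem': "(\<Sum>u\<in>g ` T0. mpoly_const (c (u + single l t)) * mon f l u) \<in> Q l" by simp
    have "c (g w + single l t) = 0"
    proof (rule Suc.IH[where T = "g ` T0" and c = "\<lambda>u. c (u + single l t)"])
      show "keys u \<subseteq> {..<l}" if u: "u \<in> g ` T0" for u
      proof
        fix s assume s: "s \<in> keys u"
        obtain v where v: "v \<in> T0" "u = g v" using u by auto
        have "s \<in> keys v" using s v by (auto simp: g_def in_keys_iff lookup_minus)
        moreover have "s \<noteq> l" using s v by (auto simp: g_def in_keys_iff lookup_minus T0_def)
        ultimately show "s \<in> {..<l}" using Suc.prems(6)[of v] v by (force simp: T0_def T'_def)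
      qed
      show "finite (g ` T0)" using T'(1) by (simp add: T0_def)
      show "g w \<in> g ` T0" using w by (auto simp: T0_def)
    qed (use Suc.prems mem' in auto)
    then show False using w g[OF w(1)] by (simp add: T'_def)
  qed
qed

section \<open>Counting monomials of bounded degree\<close>

lemma card_bounded_exponents: "card {v :: nat \<Rightarrow>\<^sub>0 nat. keys v \<subseteq> {..<l} \<and> (\<forall>s. lookup v s \<le> t)} = (t + 1) ^ l"
proof -
  define E where "E g = (\<Sum>s<l. single s (g s :: nat))" for g
  have look: "lookup (E g) s = (if s < l then g s else 0)" for g s
    by (simp add: E_def lookup_sum lookup_single when_def)
  have "bij_betw E ({..<l} \<rightarrow>\<^sub>E {..t}) {v. keys v \<subseteq> {..<l} \<and> (\<forall>s. lookup v s \<le> t)}"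
  proof (rule bij_betwI')
    fix x y assume xy: "x \<in> {..<l} \<rightarrow>\<^sub>E {..t}" "y \<in> {..<l} \<rightarrow>\<^sub>E {..t}"
    show "(E x = E y) = (x = y)"
    proof
      assume "E x = E y"
      then have "x s = y s" if "s < l" for s using look[of x s] look[of y s] that by simp
      then show "x = y" using PiE_ext[OF xy] by simp
    qed simp
  next
    fix x assume x: "x \<in> {..<l} \<rightarrow>\<^sub>E {..t}"
    have "lookup (E x) s \<le> t" for s using x by (auto simp: look PiE_def Pi_def)
    then show "E x \<in> {v. keys v \<subseteq> {..<l} \<and> (\<forall>s. lookup v s \<le> t)}"
      by (auto simp: in_keys_iff look split: if_splits)
  next
    fix v :: "nat \<Rightarrow>\<^sub>0 nat" assume v: "v \<in> {v. keys v \<subseteq> {..<l} \<and> (\<forall>s. lookup v s \<le> t)}"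
    have "v = E (restrict (lookup v) {..<l})"
    proof (rule poly_mapping_eqI)
      fix s
      have "lookup v s = 0" if "\<not> s < l"
        using v that by (metis (mono_tags, lifting) in_keys_iff lessThan_iff mem_Collect_eq subsetD)
      then show "lookup v s = lookup (E (restrict (lookup v) {..<l})) s" by (simp add: look)
    qed
    moreover have "restrict (lookup v) {..<l} \<in> {..<l} \<rightarrow>\<^sub>E {..t}" using v by auto
    ultimately show "\<exists>x\<in>{..<l} \<rightarrow>\<^sub>E {..t}. v = E x" by blast
  qed
  then have "card {v :: nat \<Rightarrow>\<^sub>0 nat. keys v \<subseteq> {..<l} \<and> (\<forall>s. lookup v s \<le> t)} = card ({..<l} \<rightarrow>\<^sub>E {..t})"
    by (simp add: bij_betw_same_card)
  also have "\<dots> = (t + 1) ^ l" by (simp add: card_PiE)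
  finally show ?thesis .
qed

definition deg_le :: "nat \<Rightarrow> ('n::finite, 'k::field) mpoly set"
  where "deg_le m = {p. \<forall>a\<in>keys p. mono_deg a \<le> m}"

lemma deg_le_mult: "p \<in> deg_le a \<Longrightarrow> q \<in> deg_le b \<Longrightarrow> p * q \<in> deg_le (a + b)"
  using keys_mult[of p q] by (fastforce simp: deg_le_def mono_deg_add add_mono)

lemma deg_le_one: "1 \<in> deg_le 0"
  by (simp add: deg_le_def mono_deg_def)

lemma deg_le_power: "p \<in> deg_le a \<Longrightarrow> p ^ t \<in> deg_le (t * a)"
  by (induction t) (auto simp: deg_le_one intro: deg_le_mult)

lemma deg_le_prod:
  "(\<And>s. s < l \<Longrightarrow> p s \<in> deg_le (a s)) \<Longrightarrow> (\<Prod>s<l. p s) \<in> deg_le (\<Sum>s<l. a s)" for l :: nat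
  by (induction l) (auto simp: deg_le_one intro: deg_le_mult)

lemma deg_le_mono: "a \<le> b \<Longrightarrow> deg_le a \<subseteq> deg_le b"
  by (force simp: deg_le_def)

lemma deg_le_span:
  fixes p :: "('n::finite, 'k::field) mpoly"
  assumes "p \<in> deg_le m"
  shows "p \<in> mpoly_vs.span ((\<lambda>a. single a 1) ` {a. mono_deg a \<le> m})"
proof -
  have "p = (\<Sum>a\<in>keys p. mpoly_const (lookup p a) * single a 1)"
    by (rule poly_mapping_eqI)
       (simp add: lookup_sum mpoly_const_def mult_single lookup_single when_def in_keys_iff)
  also have "\<dots> \<in> mpoly_vs.span ((\<lambda>a. single a 1) ` {a. mono_deg a \<le> m})"
    using assms by (intro mpoly_vs.span_sum mpoly_vs.span_scale mpoly_vs.span_base) (auto simp: deg_le_def)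
  finally show ?thesis .
qed

lemma card_mono_deg_le:
  "finite {a :: 'n::finite \<Rightarrow>\<^sub>0 nat. mono_deg a \<le> m}" "card {a :: 'n \<Rightarrow>\<^sub>0 nat. mono_deg a \<le> m} \<le> (m + 1) ^ CARD('n)"
proof -
  have inj: "inj_on encode {a :: 'n \<Rightarrow>\<^sub>0 nat. mono_deg a \<le> m}" by (auto intro: inj_onI encode_inj)
  let ?B = "{v :: nat \<Rightarrow>\<^sub>0 nat. keys v \<subseteq> {..<CARD('n)} \<and> (\<forall>s. lookup v s \<le> m)}"
  have sub: "encode ` {a :: 'n \<Rightarrow>\<^sub>0 nat. mono_deg a \<le> m} \<subseteq> ?B"
  proof
    fix v assume "v \<in> encode ` {a :: 'n \<Rightarrow>\<^sub>0 nat. mono_deg a \<le> m}"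
    then obtain a :: "'n \<Rightarrow>\<^sub>0 nat" where a: "v = encode a" "mono_deg a \<le> m" by auto
    have "lookup a x \<le> m" for x
      using member_le_sum[of x UNIV "lookup a"] a(2) by (simp add: mono_deg_def)
    then have "lookup v s \<le> m" for s by (simp add: a lookup_encode)
    then show "v \<in> ?B" using keys_encode a by auto
  qed
  have fin: "finite ?B" by (rule finite_bounded_exponents) simp
  show "finite {a :: 'n \<Rightarrow>\<^sub>0 nat. mono_deg a \<le> m}" using finite_imageD[OF finite_subset[OF sub fin] inj] .
  show "card {a :: 'n \<Rightarrow>\<^sub>0 nat. mono_deg a \<le> m} \<le> (m + 1) ^ CARD('n)"
    using card_mono[OF fin sub] card_image[OF inj] card_bounded_exponents[of "CARD('n)" m] by simp
qed

text \<open>Each strict inclusion supplies one element, \<open>n + 1\<close> in all. Their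
  \<open>(t + 1)^(n + 1)\<close> monomials with exponents up to \<open>t\<close> are independent and
  of degree at most a constant times \<open>t\<close>, whereas polynomials of degree at most
  \<open>m\<close> span a space of dimension at most \<open>(m + 1)^n\<close>; for large
  \<open>t\<close> these counts conflict.\<close>

lemma descending_prime_sequence_bounded:
  fixes Q :: "nat \<Rightarrow> ('n::finite, 'k::field) mpoly set"
  assumes prime: "\<And>s. s \<le> Suc CARD('n) \<Longrightarrow> primeideal (Q s) \<S>"
    and dec: "\<And>s. s < Suc CARD('n) \<Longrightarrow> Q (Suc s) \<subset> Q s"
  shows False
proof -
  define l where "l = Suc CARD('n)"
  have "\<forall>s. \<exists>f. s < l \<longrightarrow> f \<in> Q s \<and> f \<notin> Q (Suc s)" using dec by (auto simp: l_def)
  then obtain f where f: "\<And>s. s < l \<Longrightarrow> f s \<in> Q s \<and> f s \<notin> Q (Suc s)" by metis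
  \<comment> \<open>The inserted 1 makes the set non-empty and ensures \<open>d \<ge> 1\<close>,
    which the final estimate uses.\<close>
  define d where "d = Max (insert 1 (\<Union>s<l. mono_deg ` keys (f s)))"
  have d1: "d \<ge> 1" by (auto simp: d_def)
  have d: "f s \<in> deg_le d" if "s < l" for s
    unfolding deg_le_def d_def using that by (auto intro!: Max_ge)
  have ineq: "(t + 1) ^ l \<le> (l * t * d + 1) ^ CARD('n)" for t
  proof -
    let ?T = "{v :: nat \<Rightarrow>\<^sub>0 nat. keys v \<subseteq> {..<l} \<and> (\<forall>s. lookup v s \<le> t)}"
    have finT: "finite ?T" by (rule finite_bounded_exponents) simp
    have Q: "\<And>s. s \<le> l \<Longrightarrow> primeideal (Q s) \<S>" "\<And>s. s < l \<Longrightarrow> Q (Suc s) \<subseteq> Q s"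
      using prime dec by (auto simp: l_def)
    have zero: "0 \<in> Q l" using Q(1)[of l] ideal_zero by (auto simp: primeideal_class_ring_iff)
    have indep: "c v = 0" if "finite T" "T \<subseteq> ?T" "(\<Sum>v\<in>T. mpoly_const (c v) * mon f l v) = 0" "v \<in> T" for T c v
      by (rule chain_monomials_independent[of l Q f T c v]) (use Q f that zero in auto)
    have inj: "inj_on (mon f l) ?T"
    proof (rule inj_onI, rule ccontr)
      fix u v assume uv: "u \<in> ?T" "v \<in> ?T" "mon f l u = mon f l v" "u \<noteq> v"
      \<comment> \<open>Equal monomials give the relation with coefficients 1 and -1; independence
        would force the coefficient 1 at \<open>u\<close> to vanish.\<close>
      have "(if u = u then 1 else -1 :: 'k) = 0"
      proof (rule indep[of "{u, v}" "\<lambda>x. if x = u then 1 else -1"])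
        have m: "mpoly_const (-1 :: 'k) = - (1 :: ('n, 'k) mpoly)" "mpoly_const (1 :: 'k) = (1 :: ('n, 'k) mpoly)"
          by (simp_all add: mpoly_const_def single_uminus)
        show "(\<Sum>x\<in>{u, v}. mpoly_const (if x = u then 1 else -1) * mon f l x) = 0"
          using uv(3,4) by (simp add: m)
      qed (use uv in auto)
      then show False by simp
    qed
    have "mpoly_vs.independent (mon f l ` ?T)"
      unfolding mpoly_vs.independent_explicit_finite_subsets
    proof (intro allI impI ballI)
      fix A :: "('n, 'k) mpoly set" and c x
      assume A: "A \<subseteq> mon f l ` ?T" "finite A" "(\<Sum>v\<in>A. mpoly_const (c v) * v) = 0" "x \<in> A"
      obtain T where T: "T \<subseteq> ?T" "A = mon f l ` T" using A(1) by (auto simp: subset_image_iff)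
      have injT: "inj_on (mon f l) T" using inj T(1) by (rule inj_on_subset)
      obtain v where v: "v \<in> T" "x = mon f l v" using A(4) T(2) by auto
      have "c (mon f l v) = 0"
        by (rule indep[of T "\<lambda>v. c (mon f l v)"])
           (use A(3) T v finT injT in \<open>auto simp: sum.reindex[OF injT] finite_subset\<close>)
      then show "c x = 0" by (simp add: v)
    qed
    moreover have "mon f l ` ?T \<subseteq> mpoly_vs.span ((\<lambda>a. single a 1) ` {a. mono_deg a \<le> l * t * d})"
    proof
      fix p assume "p \<in> mon f l ` ?T"
      then obtain v where v: "v \<in> ?T" "p = mon f l v" by auto
      have "p \<in> deg_le (\<Sum>s<l. lookup v s * d)"
        unfolding v mon_def by (intro deg_le_prod deg_le_power d)
      moreover have "(\<Sum>s<l. lookup v s * d) \<le> (\<Sum>s<l. t * d)" using v by (intro sum_mono mult_right_mono) auto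
      ultimately have "p \<in> deg_le (l * t * d)" using deg_le_mono by (fastforce simp: mult.assoc)
      then show "p \<in> mpoly_vs.span ((\<lambda>a. single a 1) ` {a. mono_deg a \<le> l * t * d})" by (rule deg_le_span)
    qed
    ultimately have "card (mon f l ` ?T) \<le> card ((\<lambda>a. single a 1 :: ('n, 'k) mpoly) ` {a. mono_deg a \<le> l * t * d})"
      using mpoly_vs.independent_span_bound finite_imageI[OF card_mono_deg_le(1)] by blast
    also have "\<dots> \<le> card {a :: 'n \<Rightarrow>\<^sub>0 nat. mono_deg a \<le> l * t * d}" by (rule card_image_le[OF card_mono_deg_le(1)])
    also have "\<dots> \<le> (l * t * d + 1) ^ CARD('n)" by (rule card_mono_deg_le(2))
    finally show ?thesis using card_image[OF inj] card_bounded_exponents[of l t] by simp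
  qed
  \<comment> \<open>With this choice \<open>(l d (t + 1))^n\<close> equals
    \<open>t (t + 1)^n\<close>, which is just below \<open>(t + 1)^(n + 1)\<close>.\<close>
  define t where "t = (l * d) ^ CARD('n)"
  have "l * d \<ge> 1" using d1 by (simp add: l_def)
  then have "l * t * d + 1 \<le> (l * d) * (t + 1)" by (simp add: algebra_simps)
  then have "(l * t * d + 1) ^ CARD('n) \<le> ((l * d) * (t + 1)) ^ CARD('n)" by (rule power_mono) simp
  also have "\<dots> = t * (t + 1) ^ CARD('n)" by (simp only: power_mult_distrib[of "l * d" "t + 1"] t_def[symmetric])
  also have "\<dots> < (t + 1) ^ l" by (simp add: l_def)
  finally show False using ineq[of t] by simp
qed

text \<open>A finite non-empty chain contains its union as largest member, so members can be removed
  from the top one at a time.\<close>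

lemma finite_chain_descending_sequence:
  assumes "finite C" "subset.chain X C" "card C > l"
  shows "\<exists>Q. (\<forall>s\<le>l. Q s \<in> C) \<and> (\<forall>s<l. Q (Suc s) \<subset> (Q s :: 'a set))"
  using assms
proof (induction l arbitrary: C)
  case 0
  then obtain A where "A \<in> C" by (metis card.empty equals0I less_irrefl)
  then show ?case by (intro exI[of _ "\<lambda>_. A"]) auto
next
  case (Suc l)
  have "C \<noteq> {}" using Suc.prems by auto
  then have top: "\<Union>C \<in> C" using Union_in_chain[OF Suc.prems(1)] Suc.prems(2) by blast
  let ?C = "C - {\<Union>C}"
  have "subset.chain X ?C" using Suc.prems(2) by (auto simp: subset.chain_def)
  moreover have "card ?C > l" using Suc.prems top by simp
  ultimately obtain Q where Q: "\<forall>s\<le>l. Q s \<in> ?C" "\<forall>s<l. Q (Suc s) \<subset> Q s"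
    using Suc.IH[of ?C] Suc.prems(1) by auto
  define R where "R s = (case s of 0 \<Rightarrow> \<Union>C | Suc s \<Rightarrow> Q s)" for s
  have "\<forall>s\<le>Suc l. R s \<in> C" using Q(1) top by (auto simp: R_def split: nat.split)
  moreover have "R (Suc s) \<subset> R s" if "s < Suc l" for s
  proof (cases s)
    case 0
    then show ?thesis using Q(1) by (auto simp: R_def)
  next
    case (Suc s')
    then show ?thesis using Q(2) that by (simp add: R_def)
  qed
  ultimately show ?case by blast
qed

text \<open>A chain of \<open>n + 2\<close> primes, listed from the top, would be a sequence of the
  kind just excluded. The bound makes the supremum in \<open>module_dim\<close>, which is taken in
  \<open>nat\<close>, a genuine upper bound.\<close>

theorem prime_chain_card_le:
  fixes A :: "('n::finite, 'k::field) mpoly set"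
  assumes "prime_chain A C"
  shows "card C \<le> Suc CARD('n)"
proof (rule ccontr)
  assume "\<not> ?thesis"
  then have lt: "card C > Suc CARD('n)" by simp
  obtain Q where Q: "\<forall>s\<le>Suc CARD('n). Q s \<in> C" "\<forall>s<Suc CARD('n). Q (Suc s) \<subset> Q s"
    using finite_chain_descending_sequence[OF conjunct1[OF assms] conjunct2[OF assms] lt] by (elim exE conjE)
  show False
  proof (rule descending_prime_sequence_bounded)
    show "primeideal (Q s) \<S>" if "s \<le> Suc CARD('n)" for s
      using subset_chain_mem[OF conjunct2[OF assms], of "Q s"] Q(1) that by simp
    show "Q (Suc s) \<subset> Q s" if "s < Suc CARD('n)" for s using Q(2) that by simp
  qed
qed


section \<open>Graded modules as vector spaces\<close>

definition kspace :: "(('n::finite, 'k::field) mpoly, 'm) graded_module \<Rightarrow> ('k, 'm) module"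
  where "kspace M = \<lparr>carrier = carrier M, mult = mult M, one = one M, zero = zero M, add = add M,
     smult = (\<lambda>c x. mpoly_const c \<odot>\<^bsub>M\<^esub> x)\<rparr>"

lemma kspace_simps [simp]:
  "carrier (kspace M) = carrier M" "zero (kspace M) = zero M" "add (kspace M) = add M"
  "smult (kspace M) c x = mpoly_const c \<odot>\<^bsub>M\<^esub> x"
  by (simp_all add: kspace_def)

lemma mpoly_const_add: "mpoly_const (a + b) = mpoly_const a + mpoly_const b"
  and mpoly_const_mult: "mpoly_const (a * b) = mpoly_const a * mpoly_const b"
  and mpoly_const_0: "mpoly_const 0 = 0" and mpoly_const_1: "mpoly_const 1 = 1"
  by (simp_all add: mpoly_const_def single_add mult_single)

text \<open>Constants and variables generate the polynomial ring as a ring. This reduces being a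
  submodule, for a subspace, to closure under multiplication by variables.\<close>

lemma mpoly_ring_induct:
  fixes P :: "('n::finite, 'k::field) mpoly \<Rightarrow> bool"
  assumes const: "\<And>c. P (mpoly_const c)" and var: "\<And>s. P (mvar s)"
    and add: "\<And>p q. P p \<Longrightarrow> P q \<Longrightarrow> P (p + q)" and mult: "\<And>p q. P p \<Longrightarrow> P q \<Longrightarrow> P (p * q)"
  shows "P p"
proof -
  have mono: "P (single a 1)" if "mono_deg a = m" for a :: "'n \<Rightarrow>\<^sub>0 nat" and m
    using that
  proof (induction m arbitrary: a)
    case 0
    then have "lookup a s = 0" for s by (simp add: mono_deg_def)
    then have "a = 0" by (intro poly_mapping_eqI) simp
    then show ?case using const[of 1] by (simp add: mpoly_const_1)
  next
    case (Suc m)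
    obtain s where s: "lookup a s \<noteq> 0" using Suc.prems by (force simp: mono_deg_def)
    have a: "single s 1 + (a - single s 1) = a"
      using s by (intro poly_mapping_eqI) (auto simp: lookup_add lookup_minus lookup_single when_def)
    have "mono_deg (single s 1) + mono_deg (a - single s 1) = Suc m"
      unfolding mono_deg_add[symmetric] a by (rule Suc.prems)
    then have "P (single (a - single s 1) 1)" by (intro Suc.IH) (simp add: mono_deg_single)
    then have "P (mvar s * single (a - single s 1) 1)" using var mult by blast
    moreover have "mvar s * single (a - single s 1) (1 :: 'k) = single (single s 1 + (a - single s 1)) 1"
      by (simp add: mvar_def mult_single)
    ultimately show ?case by (simp only: a)
  qed
  have "P (\<Sum>a\<in>A. mpoly_const (lookup p a) * single a 1)" if "finite A" for A
    using that
  proof (induction A)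
    case empty
    then show ?case using const[of 0] by (simp add: mpoly_const_0)
  next
    case (insert a A)
    then show ?case using add mult const mono by simp
  qed
  moreover have "p = (\<Sum>a\<in>keys p. mpoly_const (lookup p a) * single a 1)"
    by (rule poly_mapping_eqI)
       (simp add: lookup_sum mpoly_const_def mult_single lookup_single when_def in_keys_iff)
  ultimately show ?thesis by (metis finite_keys)
qed

context graded_module
begin

lemma smult_one' [simp]: "x \<in> carrier M \<Longrightarrow> 1 \<odot> x = x"
  using smult_one by simp

lemma smult_mult: "x \<in> carrier M \<Longrightarrow> (a * b) \<odot> x = a \<odot> (b \<odot> x)"
  using smult_assoc1[of a b x] by simp

lemma smult_add_left: "x \<in> carrier M \<Longrightarrow> (a + b) \<odot> x = a \<odot> x \<oplus> b \<odot> x"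
  using smult_l_distr[of a b x] by simp

lemma smult_add_right: "x \<in> carrier M \<Longrightarrow> y \<in> carrier M \<Longrightarrow> a \<odot> (x \<oplus> y) = a \<odot> x \<oplus> a \<odot> y"
  using smult_r_distr[of a x y] by simp

lemma smult_in_carrier: "x \<in> carrier M \<Longrightarrow> a \<odot> x \<in> carrier M"
  using smult_closed[of a x] by simp

lemma smult_0_left: "x \<in> carrier M \<Longrightarrow> 0 \<odot> x = \<zero>"
  using lmult_0[of x] by simp

lemma smult_0_right: "a \<odot> \<zero> = \<zero>"
  using rmult_0[of a] by simp

lemma uminus_eq_smult: "x \<in> carrier M \<Longrightarrow> \<ominus> x = (-1) \<odot> x"
  using smult_minus_1[of x] by (simp add: class_ring_simps)

lemma kspace_vectorspace: "vectorspace class_ring (kspace M)"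
proof (rule vs_criteria)
  show "\<forall>v\<in>carrier (kspace M). \<exists>u\<in>carrier (kspace M). v \<oplus>\<^bsub>kspace M\<^esub> u = \<zero>\<^bsub>kspace M\<^esub>"
    using M.r_neg by auto
qed (auto simp: class_field.field_axioms smult_in_carrier M.a_ac mpoly_const_mult mpoly_const_add
  mpoly_const_1 smult_mult smult_add_left smult_add_right)

sublocale K: vectorspace "class_ring :: 'k ring" "kspace M"
  by (rule kspace_vectorspace)

definition ksubspace :: "'m set \<Rightarrow> bool"
  where "ksubspace W \<longleftrightarrow> W \<subseteq> carrier M \<and> \<zero> \<in> W \<and> (\<forall>x\<in>W. \<forall>y\<in>W. x \<oplus> y \<in> W)
    \<and> (\<forall>x\<in>W. \<forall>c. mpoly_const c \<odot> x \<in> W)"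

lemma ksubspace_iff: "ksubspace W \<longleftrightarrow> LinearCombinations.submodule class_ring W (kspace M)"
  using K.module_axioms by (auto simp: ksubspace_def LinearCombinations.submodule_def)

abbreviation "kspan X \<equiv> LinearCombinations.module.span class_ring (kspace M) X"

lemma kspan_ksubspace: "X \<subseteq> carrier M \<Longrightarrow> ksubspace (kspan X)"
  unfolding ksubspace_iff by (rule K.span_is_submodule) simp

lemma kspan_base: "X \<subseteq> carrier M \<Longrightarrow> x \<in> X \<Longrightarrow> x \<in> kspan X"
  using K.in_own_span[of X] by auto

lemma kspan_minimal: "ksubspace W \<Longrightarrow> X \<subseteq> W \<Longrightarrow> kspan X \<subseteq> W"
  unfolding ksubspace_iff by (rule K.span_is_subset)

lemma kspan_mono: "X \<subseteq> Y \<Longrightarrow> Y \<subseteq> carrier M \<Longrightarrow> kspan X \<subseteq> kspan Y"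
  using kspan_minimal[OF kspan_ksubspace[of Y], of X] kspan_base[of Y] by blast

definition smodule :: "'m set \<Rightarrow> bool"
  where "smodule W \<longleftrightarrow> W \<subseteq> carrier M \<and> \<zero> \<in> W \<and> (\<forall>x\<in>W. \<forall>y\<in>W. x \<oplus> y \<in> W)
    \<and> (\<forall>x\<in>W. \<forall>p. p \<odot> x \<in> W)"

lemma smodule_iff: "smodule W \<longleftrightarrow> LinearCombinations.submodule \<S> W M"
  using module_axioms by (auto simp: smodule_def LinearCombinations.submodule_def)

lemma smodule_ksubspace: "smodule W \<Longrightarrow> ksubspace W"
  by (auto simp: smodule_def ksubspace_def)

lemma smodule_carrier: "smodule (carrier M)"
  by (auto simp: smodule_def smult_in_carrier)

lemma smodule_Int: "smodule V \<Longrightarrow> smodule W \<Longrightarrow> smodule (V \<inter> W)"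
  by (auto simp: smodule_def)

lemma smoduleD:
  assumes "smodule W"
  shows "x \<in> W \<Longrightarrow> x \<in> carrier M" "\<zero> \<in> W" "x \<in> W \<Longrightarrow> y \<in> W \<Longrightarrow> x \<oplus> y \<in> W" "x \<in> W \<Longrightarrow> p \<odot> x \<in> W"
    "x \<in> W \<Longrightarrow> y \<in> W \<Longrightarrow> x \<ominus> y \<in> W"
  using assms uminus_eq_smult[of y] by (auto simp: smodule_def a_minus_def)

abbreviation "sspan X \<equiv> LinearCombinations.module.span \<S> M X"

lemma sspan_smodule: "X \<subseteq> carrier M \<Longrightarrow> smodule (sspan X)"
  unfolding smodule_iff by (rule span_is_submodule)

lemma sspan_base: "X \<subseteq> carrier M \<Longrightarrow> x \<in> X \<Longrightarrow> x \<in> sspan X"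
  using in_own_span[of X] by auto

lemma sspan_minimal: "smodule W \<Longrightarrow> X \<subseteq> W \<Longrightarrow> sspan X \<subseteq> W"
  unfolding smodule_iff by (rule span_is_subset)

lemma sspan_mono: "X \<subseteq> Y \<Longrightarrow> Y \<subseteq> carrier M \<Longrightarrow> sspan X \<subseteq> sspan Y"
  using sspan_minimal[OF sspan_smodule[of Y], of X] sspan_base[of Y] by blast

lemma ksubspace_mvar_smodule:
  assumes W: "ksubspace W" and var: "\<And>s x. x \<in> W \<Longrightarrow> mvar s \<odot> x \<in> W"
  shows "smodule W"
proof -
  have car: "x \<in> W \<Longrightarrow> x \<in> carrier M" for x using W by (auto simp: ksubspace_def)
  have "\<forall>x\<in>W. p \<odot> x \<in> W" for p
    by (rule mpoly_ring_induct[of "\<lambda>p. \<forall>x\<in>W. p \<odot> x \<in> W"])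
       (use W var in \<open>auto simp: ksubspace_def smult_add_left smult_mult car\<close>)
  then show ?thesis using W by (auto simp: ksubspace_def smodule_def)
qed

lemma sspan_insert:
  assumes "X \<subseteq> carrier M" "g \<in> carrier M" "x \<in> sspan (insert g X)"
  shows "\<exists>p y. y \<in> sspan X \<and> x = p \<odot> g \<oplus> y"
proof -
  let ?W = "{p \<odot> g \<oplus> y | p y. y \<in> sspan X}"
  have X: "smodule (sspan X)" by (rule sspan_smodule[OF assms(1)])
  note c = smoduleD[OF X]
  have "smodule ?W" unfolding smodule_def
  proof (intro conjI ballI allI)
    show "?W \<subseteq> carrier M" using c(1) smult_in_carrier[OF assms(2)] by auto
    show "\<zero> \<in> ?W" using c(2) smult_0_left[OF assms(2)] by (intro CollectI exI[of _ 0] exI[of _ "\<zero>"]) simp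
    fix a assume "a \<in> ?W"
    then obtain p y where a: "a = p \<odot> g \<oplus> y" "y \<in> sspan X" by auto
    show "r \<odot> a \<in> ?W" for r
      using a c smult_in_carrier assms(2)
      by (intro CollectI exI[of _ "r * p"] exI[of _ "r \<odot> y"]) (simp add: smult_add_right smult_mult)
    fix b assume "b \<in> ?W"
    then obtain q z where b: "b = q \<odot> g \<oplus> z" "z \<in> sspan X" by auto
    show "a \<oplus> b \<in> ?W"
      using a b c smult_in_carrier assms(2)
      by (intro CollectI exI[of _ "p + q"] exI[of _ "y \<oplus> z"]) (simp add: smult_add_left M.a_ac)
  qed
  moreover have "insert g X \<subseteq> ?W"
  proof
    fix a assume "a \<in> insert g X"
    then show "a \<in> ?W"
    proof
      assume "a = g"
      then show ?thesis using assms(2) c(2) by (intro CollectI exI[of _ 1] exI[of _ "\<zero>"]) simp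
    next
      assume "a \<in> X"
      then have "a \<in> sspan X" by (rule sspan_base[OF assms(1)])
      then show ?thesis using c(1) assms(2)
        by (intro CollectI exI[of _ 0] exI[of _ a]) (simp add: smult_0_left)
    qed
  qed
  ultimately have "x \<in> ?W" using sspan_minimal[of ?W "insert g X"] assms(3) by blast
  then show ?thesis by auto
qed

text \<open>The coefficients of the generator \<open>g\<close> in elements of \<open>N\<close> form an ideal, so the Hilbert basis
  theorem allows induction on the number of generators.\<close>

lemma smodule_fin_gen:
  assumes "finite X" "X \<subseteq> carrier M" "smodule N" "N \<subseteq> sspan X"
  shows "\<exists>Y. finite Y \<and> Y \<subseteq> N \<and> N = sspan Y"
  using assms
proof (induction X arbitrary: N)
  case empty
  have "smodule {\<zero>}" by (auto simp: smodule_def smult_0_right)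
  then have "sspan {} \<subseteq> {\<zero>}" by (rule sspan_minimal) simp
  then have "N = sspan {}"
    using empty smoduleD(2)[OF empty(2)] smoduleD(2)[OF sspan_smodule[of "{}"]] by auto
  then show ?case by (intro exI[of _ "{}"]) simp
next
  case (insert g X)
  have gX: "g \<in> carrier M" "X \<subseteq> carrier M" using insert.prems(1) by auto
  note Xs = smoduleD[OF sspan_smodule[OF gX(2)]]
  note Ns = smoduleD[OF insert.prems(2)]
  define A where "A = {p. \<exists>y\<in>sspan X. p \<odot> g \<oplus> y \<in> N}"
  have A: "ideal A \<S>" unfolding ideal_class_ring_iff
  proof (intro conjI ballI allI)
    show "0 \<in> A" using Xs(2) Ns(2) by (auto simp: A_def smult_0_left[OF gX(1)] intro!: bexI[of _ "\<zero>"])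
    fix a assume "a \<in> A"
    then obtain y where y: "y \<in> sspan X" "a \<odot> g \<oplus> y \<in> N" by (auto simp: A_def)
    show "r * a \<in> A" for r
    proof -
      have "r \<odot> (a \<odot> g \<oplus> y) = (r * a) \<odot> g \<oplus> r \<odot> y"
        using y Xs gX smult_in_carrier by (simp add: smult_add_right smult_mult)
      then show ?thesis using Ns(4)[OF y(2), of r] Xs(4)[OF y(1), of r] by (auto simp: A_def)
    qed
    fix b assume "b \<in> A"
    then obtain z where z: "z \<in> sspan X" "b \<odot> g \<oplus> z \<in> N" by (auto simp: A_def)
    have "(a \<odot> g \<oplus> y) \<oplus> (b \<odot> g \<oplus> z) = (a + b) \<odot> g \<oplus> (y \<oplus> z)"
      using y z Xs gX smult_in_carrier by (simp add: smult_add_left M.a_ac)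
    then show "a + b \<in> A" using Ns(3)[OF y(2) z(2)] Xs(3)[OF y(1) z(1)] by (auto simp: A_def)
  qed
  obtain F where F: "finite F" "F \<subseteq> A" "A = Idl\<^bsub>\<S>\<^esub> F" using hilbert_basis[OF A] by (elim exE conjE)
  have "\<forall>f\<in>F. \<exists>y. y \<in> sspan X \<and> f \<odot> g \<oplus> y \<in> N" using F(2) by (auto simp: A_def)
  then obtain y where y: "\<forall>f\<in>F. y f \<in> sspan X \<and> f \<odot> g \<oplus> y f \<in> N" by (rule bchoice[THEN exE])
  define Z where "Z = (\<lambda>f. f \<odot> g \<oplus> y f) ` F"
  have ZN: "Z \<subseteq> N" "finite Z" using y F(1) by (auto simp: Z_def)
  then have Zc: "Z \<subseteq> carrier M" using Ns(1) by auto
  note Zs = smoduleD[OF sspan_smodule[OF Zc]]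
  obtain Y where Y: "finite Y" "Y \<subseteq> N \<inter> sspan X" "N \<inter> sspan X = sspan Y"
    using insert.IH[OF gX(2) smodule_Int[OF insert.prems(2) sspan_smodule[OF gX(2)]]] by auto
  have Yc: "Y \<subseteq> carrier M" using Y(2) Ns(1) by auto
  \<comment> \<open>\<open>B\<close> collects the coefficients of \<open>g\<close> in elements of
    \<open>sspan Z\<close>. It is an ideal containing the generators \<open>F\<close> of
    \<open>A\<close>, so every coefficient occurring in \<open>N\<close> occurs in
    \<open>sspan Z\<close>, and subtracting such an element of \<open>sspan Z\<close> leaves a
    remainder in \<open>N \<inter> sspan X\<close>.\<close>
  define B where "B = {p. \<exists>z\<in>sspan Z. \<exists>u\<in>sspan X. z = p \<odot> g \<oplus> u}"
  have "ideal B \<S>" unfolding ideal_class_ring_iff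
  proof (intro conjI ballI allI)
    show "0 \<in> B" using Xs(2) Zs(2)
      by (auto simp: B_def smult_0_left[OF gX(1)] intro!: bexI[of _ "\<zero>"])
    fix a assume "a \<in> B"
    then obtain z u where z: "z \<in> sspan Z" "u \<in> sspan X" "z = a \<odot> g \<oplus> u" by (auto simp: B_def)
    show "r * a \<in> B" for r
    proof -
      have "r \<odot> z = (r * a) \<odot> g \<oplus> r \<odot> u"
        using z Xs gX smult_in_carrier by (simp add: smult_add_right smult_mult)
      then show ?thesis using Zs(4)[OF z(1), of r] Xs(4)[OF z(2), of r] by (auto simp: B_def)
    qed
    fix b assume "b \<in> B"
    then obtain z' u' where z': "z' \<in> sspan Z" "u' \<in> sspan X" "z' = b \<odot> g \<oplus> u'" by (auto simp: B_def)
    have "z \<oplus> z' = (a + b) \<odot> g \<oplus> (u \<oplus> u')"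
      using z z' Xs gX smult_in_carrier by (simp add: smult_add_left M.a_ac)
    then show "a + b \<in> B" using Zs(3)[OF z(1) z'(1)] Xs(3)[OF z(2) z'(2)] by (auto simp: B_def)
  qed
  moreover have "F \<subseteq> B"
  proof
    fix f assume f: "f \<in> F"
    then have "f \<odot> g \<oplus> y f \<in> sspan Z" by (intro sspan_base[OF Zc]) (simp add: Z_def)
    then show "f \<in> B" using y f by (auto simp: B_def)
  qed
  ultimately have AB: "A \<subseteq> B" using Idl_minimal F(3) by metis
  have YZ: "Y \<union> Z \<subseteq> carrier M" using Yc Zc by auto
  note YZs = smoduleD[OF sspan_smodule[OF YZ]]
  have "N \<subseteq> sspan (Y \<union> Z)"
  proof
    fix x assume x: "x \<in> N"
    have xs: "x \<in> sspan (insert g X)" using x insert.prems(3) by auto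
    obtain p v where p: "v \<in> sspan X" "x = p \<odot> g \<oplus> v"
      using sspan_insert[OF gX(2,1) xs] by (elim exE conjE)
    then have "p \<in> B" using AB x by (auto simp: A_def)
    then obtain z u where z: "z \<in> sspan Z" "u \<in> sspan X" "z = p \<odot> g \<oplus> u" by (auto simp: B_def)
    have zN: "z \<in> N" using sspan_minimal[OF insert.prems(2) ZN(1)] z(1) by auto
    have cs: "v \<in> carrier M" "u \<in> carrier M" "p \<odot> g \<in> carrier M" "z \<in> carrier M"
      using p(1) z(1,2) Xs(1) Zs(1) smult_in_carrier[OF gX(1)] by auto
    have "x \<ominus> z = v \<ominus> u"
      using cs unfolding p(2) z(3) a_minus_def by (simp add: M.minus_add M.a_ac M.r_neg1 M.r_neg)
    then have "x \<ominus> z \<in> N \<inter> sspan X" using Ns(5)[OF x zN] Xs(5)[OF p(1) z(2)] by simp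
    then have "x \<ominus> z \<in> sspan (Y \<union> Z)" using sspan_mono[of Y "Y \<union> Z"] YZ Y(3) by auto
    moreover have "z \<in> sspan (Y \<union> Z)" using sspan_mono[of Z "Y \<union> Z"] YZ z(1) by auto
    ultimately have "(x \<ominus> z) \<oplus> z \<in> sspan (Y \<union> Z)" by (rule YZs(3))
    moreover have "(x \<ominus> z) \<oplus> z = x" using cs Ns(1)[OF x] by (simp add: a_minus_def M.a_assoc M.l_neg)
    ultimately show "x \<in> sspan (Y \<union> Z)" by simp
  qed
  moreover have "Y \<union> Z \<subseteq> N" using Y(2) ZN by auto
  moreover have "sspan (Y \<union> Z) \<subseteq> N" by (rule sspan_minimal[OF insert.prems(2)]) fact
  ultimately show ?case using Y(1) ZN(2) by (intro exI[of _ "Y \<union> Z"]) auto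
qed

end


text \<open>Each vector is tested against all its predecessors and not only against the kept ones;
  the spans agree because a discarded vector adds nothing. In this form a failed test is a relation
  with smaller indices, which for exponents can be multiplied by a monomial.\<close>

lemma (in vectorspace) greedy_basis:
  fixes \<phi> :: "'i::linorder \<Rightarrow> 'c"
  assumes "finite X" "\<phi> ` X \<subseteq> carrier V"
  defines "Std \<equiv> \<lambda>X. {v \<in> X. \<phi> v \<notin> span (\<phi> ` {u \<in> X. u < v})}"
  shows "inj_on \<phi> (Std X) \<and> lin_indpt (\<phi> ` Std X) \<and> span (\<phi> ` Std X) = span (\<phi> ` X)"
  using assms(1,2)
proof (induction X rule: finite_linorder_max_induct)
  case empty
  then show ?case by (auto simp: Std_def lin_dep_def)
next
  case (insert b X)
  then have IH: "inj_on \<phi> (Std X)" "lin_indpt (\<phi> ` Std X)" "span (\<phi> ` Std X) = span (\<phi> ` X)"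
    and car: "\<phi> b \<in> carrier V" "\<phi> ` X \<subseteq> carrier V" by auto
  have lt: "{u \<in> insert b X. u < v} = {u \<in> X. u < v}" if "v \<in> X" for v using insert(2) that by force
  have ltb: "{u \<in> insert b X. u < b} = X" using insert(2) by auto
  have bX: "b \<notin> X" using insert(2) by auto
  have StdX: "Std X \<subseteq> X" by (auto simp: Std_def)
  have Std_ins: "v \<in> Std (insert b X) \<longleftrightarrow> v \<in> Std X \<or> v = b \<and> \<phi> b \<notin> span (\<phi> ` X)" for v
  proof (cases "v = b")
    case True
    have "b \<in> Std (insert b X) \<longleftrightarrow> \<phi> b \<notin> span (\<phi> ` X)" unfolding Std_def mem_Collect_eq ltb by simp
    moreover have "b \<notin> Std X" using bX StdX by auto
    ultimately show ?thesis unfolding True by simp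
  next
    case False
    show ?thesis
    proof (cases "v \<in> X")
      case True
      then show ?thesis using False unfolding Std_def mem_Collect_eq lt[OF True] by simp
    next
      case F: False
      then show ?thesis using False by (simp add: Std_def)
    qed
  qed
  have stdc: "\<phi> ` Std X \<subseteq> carrier V" using StdX car(2) by auto
  show ?case
  proof (cases "\<phi> b \<in> span (\<phi> ` X)")
    case True
    have "Std (insert b X) = Std X" using Std_ins True bX StdX by auto
    moreover have "span (\<phi> ` insert b X) = span (\<phi> ` X)"
      using already_in_span[OF car(2) True] by simp
    ultimately show ?thesis using IH by simp
  next
    case False
    have S: "Std (insert b X) = insert b (Std X)" using Std_ins False by auto
    have nb: "\<phi> b \<notin> span (\<phi> ` Std X)" using False IH(3) by simp
    then have nb': "\<phi> b \<notin> \<phi> ` Std X" using in_own_span[OF stdc] by auto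
    have "inj_on \<phi> (insert b (Std X))" using IH(1) nb' bX StdX by auto
    moreover have "lin_indpt (\<phi> ` insert b (Std X))"
      using lin_dep_iff_in_span[OF stdc IH(2) car(1) nb'] nb by simp
    moreover have "span (\<phi> ` insert b (Std X)) = span (\<phi> ` insert b X)"
    proof
      show "span (\<phi> ` insert b (Std X)) \<subseteq> span (\<phi> ` insert b X)"
        using StdX car by (intro span_is_monotone) auto
      have sm: "submodule K (span (\<phi> ` insert b (Std X))) V"
        by (rule span_is_submodule) (use stdc car in auto)
      have "span (\<phi> ` Std X) \<subseteq> span (\<phi> ` insert b (Std X))"
        using stdc car by (intro span_is_monotone) auto
      then have "\<phi> ` X \<subseteq> span (\<phi> ` insert b (Std X))" using IH(3) in_own_span[OF car(2)] by auto
      moreover have "\<phi> b \<in> span (\<phi> ` insert b (Std X))"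
        using in_own_span[of "\<phi> ` insert b (Std X)"] stdc car by auto
      ultimately show "span (\<phi> ` insert b X) \<subseteq> span (\<phi> ` insert b (Std X))"
        by (intro span_is_subset[OF _ sm]) auto
    qed
    ultimately show ?thesis by (simp add: S)
  qed
qed

lemma (in vectorspace) span_vs:
  assumes "S \<subseteq> carrier V"
  shows "vectorspace K (vs (span S))" "LinearCombinations.module.span K (vs (span S)) S = span S"
    "LinearCombinations.module.lin_dep K (vs (span S)) S = lin_dep S"
proof -
  have sub: "submodule K (span S) V" by (rule span_is_submodule[OF assms])
  show "vectorspace K (vs (span S))" by (rule subspace_is_vs[OF span_is_subspace[OF assms]])
  show "LinearCombinations.module.span K (vs (span S)) S = span S" "LinearCombinations.module.lin_dep K (vs (span S)) S = lin_dep S"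
    using span_li_not_depend[OF in_own_span[OF assms] sub] by auto
qed

lemma (in vectorspace) fin_dim_span:
  assumes "finite S" "S \<subseteq> carrier V"
  shows "vectorspace.fin_dim K (vs (span S))"
proof -
  interpret W: vectorspace K "vs (span S)" by (rule span_vs[OF assms(2)])
  show ?thesis unfolding W.fin_dim_def
    using assms in_own_span[OF assms(2)] span_vs(2)[OF assms(2)] by (intro exI[of _ S]) auto
qed

lemma (in vectorspace) dim_span_le_card:
  assumes "finite S" "S \<subseteq> carrier V"
  shows "vectorspace.dim K (vs (span S)) \<le> card S"
proof -
  interpret W: vectorspace K "vs (span S)" by (rule span_vs[OF assms(2)])
  show ?thesis
    using W.gen_ge_dim[of S] assms in_own_span[OF assms(2)] span_vs(2)[OF assms(2)] by simp
qed

lemma (in vectorspace) greedy_dim: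
  fixes \<phi> :: "'i::linorder \<Rightarrow> 'c"
  assumes "finite X" "\<phi> ` X \<subseteq> carrier V"
  shows "vectorspace.dim K (vs (span (\<phi> ` X))) = card {v \<in> X. \<phi> v \<notin> span (\<phi> ` {u \<in> X. u < v})}"
proof -
  let ?S = "{v \<in> X. \<phi> v \<notin> span (\<phi> ` {u \<in> X. u < v})}"
  have g: "inj_on \<phi> ?S" "lin_indpt (\<phi> ` ?S)" "span (\<phi> ` ?S) = span (\<phi> ` X)"
    using greedy_basis[OF assms] by auto
  have c: "\<phi> ` ?S \<subseteq> carrier V" using assms(2) by auto
  interpret W: vectorspace K "vs (span (\<phi> ` ?S))" by (rule span_vs[OF c])
  have "W.basis (\<phi> ` ?S)"
    using span_vs(2,3)[OF c] g(2) in_own_span[OF c] by (auto simp: W.basis_def)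
  then have "W.dim = card (\<phi> ` ?S)" by (intro W.dim_basis) (use assms in auto)
  then show ?thesis using card_image[OF g(1)] by (simp add: g(3))
qed

section \<open>Homogeneous components of module elements\<close>

context graded_module
begin

lemma component_carrier: "x \<in> component M j \<Longrightarrow> x \<in> carrier M"
  using additive_subgroup.a_subset[OF component_subgroup] by blast

lemma component_zero: "\<zero> \<in> component M j"
  by (rule additive_subgroup.zero_closed[OF component_subgroup])

lemma component_ksubspace: "ksubspace (component M j)"
  unfolding ksubspace_def
  using additive_subgroup.a_closed[OF component_subgroup] component_zero component_carrier
    smult_component[OF hom_component_const, of _ j] by auto

lemma hom_decompositionI:
  assumes "finite T" "\<And>j. c j \<in> component M j" "\<And>j. j \<notin> T \<Longrightarrow> c j = \<zero>" "x = (\<Oplus>j\<in>T. c j)"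
  shows "hom_decomposition M x c"
proof -
  have sub: "{j. c j \<noteq> \<zero>} \<subseteq> T" using assms(3) by auto
  have "(\<Oplus>j\<in>{j. c j \<noteq> \<zero>}. c j) = (\<Oplus>j\<in>T. c j)"
    using assms(1,2) sub component_carrier by (intro M.add.finprod_mono_neutral_cong_left) auto
  then show ?thesis
    unfolding hom_decomposition_def using assms sub finite_subset by auto
qed

definition hpart :: "int \<Rightarrow> 'm \<Rightarrow> 'm"
  where "hpart j x = (THE c. hom_decomposition M x c) j"

lemma hom_decomposition_hpart: "x \<in> carrier M \<Longrightarrow> hom_decomposition M x (\<lambda>j. hpart j x)"
  using theI'[OF decomposition[of x]] by (simp add: hpart_def)

lemma hpart_eqI: "x \<in> carrier M \<Longrightarrow> hom_decomposition M x c \<Longrightarrow> hpart j x = c j"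
  using the1_equality[OF decomposition[of x]] by (simp add: hpart_def)

lemma hpart_component: "x \<in> carrier M \<Longrightarrow> hpart j x \<in> component M j"
  using hom_decomposition_hpart[of x] by (simp add: hom_decomposition_def)

lemma hpart_carrier: "x \<in> carrier M \<Longrightarrow> hpart j x \<in> carrier M"
  using hpart_component component_carrier by blast

lemma finite_hparts: "x \<in> carrier M \<Longrightarrow> finite {j. hpart j x \<noteq> \<zero>}"
  using hom_decomposition_hpart[of x] by (simp add: hom_decomposition_def)

lemma finsum_hparts:
  assumes "x \<in> carrier M" "finite T" "{j. hpart j x \<noteq> \<zero>} \<subseteq> T"
  shows "(\<Oplus>j\<in>T. hpart j x) = x"
proof -
  have "(\<Oplus>j\<in>{j. hpart j x \<noteq> \<zero>}. hpart j x) = (\<Oplus>j\<in>T. hpart j x)"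
    using assms hpart_carrier by (intro M.add.finprod_mono_neutral_cong_left) auto
  then show ?thesis using hom_decomposition_hpart[OF assms(1)] by (simp add: hom_decomposition_def)
qed

lemma hpart_add:
  assumes "x \<in> carrier M" "y \<in> carrier M"
  shows "hpart j (x \<oplus> y) = hpart j x \<oplus> hpart j y"
proof (rule hpart_eqI)
  let ?T = "{j. hpart j x \<noteq> \<zero>} \<union> {j. hpart j y \<noteq> \<zero>}"
  show "hom_decomposition M (x \<oplus> y) (\<lambda>j. hpart j x \<oplus> hpart j y)"
  proof (rule hom_decompositionI[of ?T])
    show fin: "finite ?T" using finite_hparts assms by simp
    show "hpart j x \<oplus> hpart j y \<in> component M j" for j
      using hpart_component assms component_ksubspace[of j] by (auto simp: ksubspace_def)
    have "(\<Oplus>j\<in>?T. hpart j x \<oplus> hpart j y) = (\<Oplus>j\<in>?T. hpart j x) \<oplus> (\<Oplus>j\<in>?T. hpart j y)"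
      using assms hpart_carrier by (intro M.finsum_addf) auto
    then show "x \<oplus> y = (\<Oplus>j\<in>?T. hpart j x \<oplus> hpart j y)"
      using finsum_hparts[OF assms(1) fin] finsum_hparts[OF assms(2) fin] by simp
  qed auto
qed (use assms in simp)

lemma hpart_smult:
  assumes x: "x \<in> carrier M" and f: "f \<in> mpoly_hom_component i"
  shows "hpart (int i + j) (f \<odot> x) = f \<odot> hpart j x"
proof -
  let ?T = "{j. hpart j x \<noteq> \<zero>}" and ?c = "\<lambda>j. f \<odot> hpart (j - int i) x"
  have "hom_decomposition M (f \<odot> x) ?c"
  proof (rule hom_decompositionI[of "(\<lambda>j. int i + j) ` ?T"])
    show "finite ((\<lambda>j. int i + j) ` ?T)" using finite_hparts[OF x] by simp
    show "?c j \<in> component M j" for j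
      using smult_component[OF f hpart_component[OF x, of "j - int i"]] by simp
    show "?c j = \<zero>" if "j \<notin> (\<lambda>j. int i + j) ` ?T" for j
    proof -
      have "hpart (j - int i) x = \<zero>"
      proof (rule ccontr)
        assume "hpart (j - int i) x \<noteq> \<zero>"
        then have "int i + (j - int i) \<in> (\<lambda>j. int i + j) ` ?T" by blast
        then show False using that by simp
      qed
      then show ?thesis by (simp add: smult_0_right)
    qed
    have "(\<Oplus>j\<in>(\<lambda>j. int i + j) ` ?T. ?c j) = (\<Oplus>j\<in>?T. ?c (int i + j))"
      using smult_in_carrier hpart_carrier[OF x] by (intro M.add.finprod_reindex) (auto simp: inj_on_def)
    also have "\<dots> = (\<Oplus>j\<in>?T. f \<odot> hpart j x)" by simp
    also have "\<dots> = f \<odot> (\<Oplus>j\<in>?T. hpart j x)"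
      using finsum_smult[of f "\<lambda>j. hpart j x" ?T] hpart_carrier[OF x] by auto
    finally show "f \<odot> x = (\<Oplus>j\<in>(\<lambda>j. int i + j) ` ?T. ?c j)"
      using finsum_hparts[OF x finite_hparts[OF x]] by simp
  qed
  then show ?thesis using hpart_eqI[OF smult_in_carrier[OF x], of f ?c "int i + j"] by simp
qed

lemma hpart_of_component:
  assumes "x \<in> component M j"
  shows "hpart i x = (if i = j then x else \<zero>)"
proof (rule hpart_eqI)
  show x: "x \<in> carrier M" by (rule component_carrier[OF assms])
  show "hom_decomposition M x (\<lambda>i. if i = j then x else \<zero>)"
    by (rule hom_decompositionI[of "{j}"]) (use x assms component_zero in auto)
qed

definition graded :: "'m set \<Rightarrow> bool"
  where "graded W \<longleftrightarrow> smodule W \<and> (\<forall>x\<in>W. \<forall>j. hpart j x \<in> W)"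

lemma graded_submodule_iff: "graded_submodule W M \<longleftrightarrow> graded W"
proof
  assume "graded_submodule W M"
  then have W: "smodule W" "\<forall>x\<in>W. \<forall>c. hom_decomposition M x c \<longrightarrow> (\<forall>j. c j \<in> W)"
    by (auto simp: graded_submodule_def smodule_iff)
  have "hpart j x \<in> W" if x: "x \<in> W" for x j
    by (rule W(2)[rule_format, OF x hom_decomposition_hpart[OF smoduleD(1)[OF W(1) x]]])
  then show "graded W" using W(1) by (simp add: graded_def)
next
  assume "graded W"
  then have W: "smodule W" "\<And>x j. x \<in> W \<Longrightarrow> hpart j x \<in> W" by (auto simp: graded_def)
  have "c j \<in> W" if "x \<in> W" "hom_decomposition M x c" for x c j
    using hpart_eqI[OF smoduleD(1)[OF W(1) that(1)] that(2), of j] W(2)[OF that(1), of j] by simp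
  then show "graded_submodule W M" using W(1) by (auto simp: graded_submodule_def smodule_iff)
qed

lemma graded_carrier: "graded (carrier M)"
  using smodule_carrier hpart_carrier by (simp add: graded_def)

lemma finsum_mem_smodule:
  assumes W: "smodule W" and "finite T" "\<And>j. j \<in> T \<Longrightarrow> c j \<in> W"
  shows "(\<Oplus>j\<in>T. c j) \<in> W"
  using assms(2,3)
proof (induction T)
  case empty
  then show ?case using smoduleD(2)[OF W] by simp
next
  case (insert a T)
  have "(\<Oplus>j\<in>insert a T. c j) = c a \<oplus> (\<Oplus>j\<in>T. c j)"
    using insert smoduleD(1)[OF W] by (intro M.finsum_insert) auto
  then show ?case using insert smoduleD(3)[OF W] by simp
qed

text \<open>The homogeneous parts of finitely many generators generate as well. They are numbered by
  naturals so that the number of a generator can be an entry of an exponent vector.\<close>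

lemma graded_homogeneous_generators:
  assumes "fin_gen_module M" "graded W"
  obtains r :: nat and h \<delta> where "\<And>l. l < r \<Longrightarrow> h l \<in> component M (\<delta> l)" "h ` {..<r} \<subseteq> W" "W = sspan (h ` {..<r})"
proof -
  have W: "smodule W" "\<And>x j. x \<in> W \<Longrightarrow> hpart j x \<in> W" using assms(2) by (auto simp: graded_def)
  obtain X where X: "finite X" "X \<subseteq> carrier M" "sspan X = carrier M"
    using assms(1) unfolding fin_gen_module_def by (elim exE conjE)
  have "W \<subseteq> sspan X" using X(3) smoduleD(1)[OF W(1)] by auto
  from smodule_fin_gen[OF X(1,2) W(1) this] obtain Y where Y: "finite Y" "Y \<subseteq> W" "W = sspan Y"
    by (elim exE conjE)
  have Yc: "y \<in> carrier M" if "y \<in> Y" for y using Y(2) smoduleD(1)[OF W(1)] that by auto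
  define Z where "Z = (\<Union>y\<in>Y. (\<lambda>j. hpart j y) ` {j. hpart j y \<noteq> \<zero>})"
  have Z: "finite Z" "Z \<subseteq> W" using Y(1,2) finite_hparts[OF Yc] W(2) by (auto simp: Z_def)
  have Zc: "Z \<subseteq> carrier M" using Z(2) smoduleD(1)[OF W(1)] by auto
  have "Y \<subseteq> sspan Z"
  proof
    fix y assume y: "y \<in> Y"
    have "hpart j y \<in> Z" if "hpart j y \<noteq> \<zero>" for j using y that by (auto simp: Z_def)
    then have "(\<Oplus>j\<in>{j. hpart j y \<noteq> \<zero>}. hpart j y) \<in> sspan Z"
      by (intro finsum_mem_smodule[OF sspan_smodule[OF Zc] finite_hparts[OF Yc[OF y]]] sspan_base[OF Zc]) simp
    then show "y \<in> sspan Z" using finsum_hparts[OF Yc[OF y] finite_hparts[OF Yc[OF y]]] by simp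
  qed
  then have WZ: "W = sspan Z"
    using sspan_minimal[OF sspan_smodule[OF Zc], of Y] sspan_minimal[OF W(1) Z(2)] Y(3) by auto
  have "\<forall>z\<in>Z. \<exists>j. z \<in> component M j" using hpart_component Yc by (auto simp: Z_def)
  then obtain \<epsilon> where \<epsilon>: "\<forall>z\<in>Z. z \<in> component M (\<epsilon> z)" by (rule bchoice[THEN exE])
  obtain h where h: "bij_betw h {0..<card Z} Z" using ex_bij_betw_nat_finite[OF Z(1)] by blast
  then have hZ: "h ` {..<card Z} = Z" by (auto simp: bij_betw_def atLeast0LessThan)
  show ?thesis
  proof (rule that[of "card Z" h "\<lambda>l. \<epsilon> (h l)"])
    show "h l \<in> component M (\<epsilon> (h l))" if "l < card Z" for l using hZ \<epsilon> that by blast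
  qed (use hZ Z(2) WZ in auto)
qed

abbreviation kdim :: "'m set \<Rightarrow> nat"
  where "kdim W \<equiv> vectorspace.dim class_ring ((kspace M)\<lparr>carrier := W\<rparr>)"

lemma smult_kspan:
  assumes "X \<subseteq> carrier M" "ksubspace W" "\<And>x. x \<in> X \<Longrightarrow> p \<odot> x \<in> W" "x \<in> kspan X"
  shows "p \<odot> x \<in> W"
proof -
  let ?V = "{x \<in> carrier M. p \<odot> x \<in> W}"
  have com: "p \<odot> (mpoly_const c \<odot> x) = mpoly_const c \<odot> (p \<odot> x)" if "x \<in> carrier M" for c x
    using that by (simp add: smult_mult[symmetric] mult.commute)
  have "ksubspace ?V"
    using assms(2) com by (auto simp: ksubspace_def smult_in_carrier smult_0_right smult_add_right)
  then have "kspan X \<subseteq> ?V" using assms(1,3) by (intro kspan_minimal) auto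
  then show ?thesis using assms(4) by auto
qed

end


section \<open>Hilbert functions of the Rees module\<close>

lemma mon_component:
  assumes "\<And>s. s < N \<Longrightarrow> r s \<in> mpoly_hom_component (w s)"
  shows "mon r N v \<in> mpoly_hom_component (wt w N v)"
  using assms
proof (induction N)
  case 0
  have "(1 :: ('n::finite, 'k::field) mpoly) \<in> mpoly_hom_component 0"
    using hom_component_const[of 1] by (simp add: mpoly_const_1)
  then show ?case by (simp add: mon_def wt_def)
next
  case (Suc N)
  have pow: "r N ^ t \<in> mpoly_hom_component (w N * t)" for t
  proof (induction t)
    case 0
    then show ?case using hom_component_const[of 1] by (simp add: mpoly_const_1)
  next
    case (Suc t)
    then show ?case using hom_component_mult[OF Suc.prems] Suc.IH \<open>\<And>s. s < Suc N \<Longrightarrow> _\<close>[of N]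
      by (auto intro!: hom_component_mult)
  qed
  have "mon r (Suc N) v = mon r N v * r N ^ lookup v N" by (simp add: mon_def)
  moreover have "wt w (Suc N) v = wt w N v + w N * lookup v N" by (simp add: wt_def)
  ultimately show ?case using hom_component_mult[OF _ pow] Suc by simp
qed

abbreviation ideal_power :: "('n::finite, 'k::field) mpoly set \<Rightarrow> nat \<Rightarrow> ('n, 'k) mpoly set"
  where "ideal_power I k \<equiv> I [^]\<^bsub>ideals_set \<S>\<^esub> k"

lemma ideal_power_0: "ideal_power I 0 = UNIV"
  by (simp add: ideals_set_def nat_pow_def)

lemma ideal_power_Suc: "ideal_power I (Suc k) = ideal_prod \<S> (ideal_power I k) I"
  by (simp add: ideals_set_def nat_pow_def)

lemma ideal_prod_closed: "a \<in> A \<Longrightarrow> b \<in> B \<Longrightarrow> a * b \<in> ideal_prod (class_ring :: 'a::comm_ring_1 ring) A B"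
  using ideal_prod.prod[of a A b B class_ring] by simp

lemma ideal_power_ideal: "ideal I \<S> \<Longrightarrow> ideal (ideal_power I k) \<S>"
proof (induction k)
  case 0
  then show ?case unfolding ideal_power_0 by (simp add: ideal_class_ring_iff)
next
  case (Suc k)
  then show ?case unfolding ideal_power_Suc
    by (intro ring.ideal_prod_is_ideal[OF class_ring.ring_axioms])
qed

lemma ideal_power_mult:
  assumes "x \<in> ideal_power I a" "y \<in> I"
  shows "x * y ^ t \<in> ideal_power I (a + t)"
proof (induction t)
  case 0
  then show ?case using assms by simp
next
  case (Suc t)
  have "x * y ^ t * y \<in> ideal_power I (Suc (a + t))"
    unfolding ideal_power_Suc by (rule ideal_prod_closed[OF Suc.IH assms(2)])
  then show ?case by (simp add: mult_ac)
qed

lemma ideal_power_mono: "J \<subseteq> I \<Longrightarrow> ideal_power J k \<subseteq> ideal_power I k"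
proof (induction k)
  case 0
  then show ?case by (simp add: ideal_power_0)
next
  case (Suc k)
  have "x \<in> ideal_prod \<S> (ideal_power I k) I" if "x \<in> ideal_prod \<S> (ideal_power J k) J" for x
    using that
  proof (induction rule: ideal_prod.induct)
    case (prod i j)
    then show ?case using Suc by (intro ideal_prod.prod) auto
  next
    case (sum s t)
    then show ?case by (intro ideal_prod.sum)
  qed
  then show ?case unfolding ideal_power_Suc by auto
qed

lemma mon_ideal_power:
  assumes "ideal I \<S>" "\<And>s. s < N \<Longrightarrow> \<kappa> s = 0 \<or> \<kappa> s = 1 \<and> r s \<in> I"
  shows "mon r N v \<in> ideal_power I (wt \<kappa> N v)"
  using assms(2)
proof (induction N)
  case 0
  have "wt \<kappa> 0 v = 0" by (simp add: wt_def)
  then show ?case by (simp only: ideal_power_0 UNIV_I)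
next
  case (Suc N)
  have IH: "mon r N v \<in> ideal_power I (wt \<kappa> N v)" using Suc by simp
  have m: "mon r (Suc N) v = mon r N v * r N ^ lookup v N" by (simp add: mon_def)
  have w: "wt \<kappa> (Suc N) v = wt \<kappa> N v + \<kappa> N * lookup v N" by (simp add: wt_def)
  from Suc.prems[of N] show ?case
  proof
    assume "\<kappa> N = 0"
    then show ?thesis using ideal_mult_right[OF ideal_power_ideal[OF assms(1)] IH] by (simp add: m w)
  next
    assume "\<kappa> N = 1 \<and> r N \<in> I"
    then show ?thesis using ideal_power_mult[OF IH] by (simp add: m w)
  qed simp
qed

text \<open>A choice of homogeneous generators for an ideal and a submodule. It is instantiated for
  \<open>I\<close> with \<open>M\<close>, for \<open>J\<close> with \<open>N\<close>, and with the
  zero ideal in order to measure \<open>M\<close> alone.\<close>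

locale rees_data = graded_module M
  for M :: "(('n::finite, 'k::field) mpoly, 'm) graded_module" (structure) +
  fixes I :: "('n, 'k) mpoly set" and N :: "'m set" and f :: "nat \<Rightarrow> ('n, 'k) mpoly" and m :: nat
    and d :: "nat \<Rightarrow> nat" and h :: "nat \<Rightarrow> 'm" and \<delta> :: "nat \<Rightarrow> int" and r :: nat
  assumes ideal_gen: "I = Idl\<^bsub>\<S>\<^esub> (f ` {..<m})" and f_comp: "\<And>j. j < m \<Longrightarrow> f j \<in> mpoly_hom_component (d j)"
    and module_gen: "N = sspan (h ` {..<r})" and h_comp: "\<And>l. l < r \<Longrightarrow> h l \<in> component M (\<delta> l)"
begin

text \<open>An exponent vector encodes a monomial in the variables \<open>x\<^sub>1, \<dots>, x\<^sub>n\<close>, the generators of \<open>I\<close>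
  and the generators of \<open>N\<close>: the entries below \<open>n\<close> are exponents of variables, the next \<open>m\<close> entries
  are exponents of the generators of \<open>I\<close>, and the entry at \<open>n + m\<close> is the index of a generator of \<open>N\<close>.\<close>

definition nv :: nat where "nv = CARD('n) + m"

definition rv :: "nat \<Rightarrow> ('n, 'k) mpoly"
  where "rv s = (if s < CARD('n) then mvar (enum_var s) else f (s - CARD('n)))"

definition \<omega> :: "nat \<Rightarrow> nat" where "\<omega> s = (if s < CARD('n) then 1 else d (s - CARD('n)))"

definition \<kappa> :: "nat \<Rightarrow> nat" where "\<kappa> s = (if s < CARD('n) then 0 else 1)"

definition \<phi> :: "(nat \<Rightarrow>\<^sub>0 nat) \<Rightarrow> 'm" where "\<phi> u = mon rv nv u \<odot> h (lookup u nv)"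

definition deg :: "(nat \<Rightarrow>\<^sub>0 nat) \<Rightarrow> int" where "deg u = int (wt \<omega> nv u) + \<delta> (lookup u nv)"

definition expos :: "nat \<Rightarrow> (nat \<Rightarrow>\<^sub>0 nat) set"
  where "expos k = {u. keys u \<subseteq> {..<Suc nv} \<and> lookup u nv < r \<and> wt \<kappa> nv u = k}"

lemma I_ideal: "ideal I \<S>"
  unfolding ideal_gen by (rule Idl_ideal)

lemma f_mem: "j < m \<Longrightarrow> f j \<in> I"
  using Idl_superset[of "f ` {..<m}"] ideal_gen by auto

lemma h_carrier: "l < r \<Longrightarrow> h l \<in> carrier M"
  using h_comp component_carrier by blast

lemma gens_carrier: "h ` {..<r} \<subseteq> carrier M"
  using h_carrier by auto

lemma N_smodule: "smodule N"
  unfolding module_gen by (rule sspan_smodule[OF gens_carrier])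

lemma h_mem: "l < r \<Longrightarrow> h l \<in> N"
  unfolding module_gen by (rule sspan_base[OF gens_carrier]) simp

lemma rv_component: "s < nv \<Longrightarrow> rv s \<in> mpoly_hom_component (\<omega> s)"
  using f_comp[of "s - CARD('n)"] mvar_component[of "enum_var s"] by (auto simp: rv_def \<omega>_def nv_def)

lemma \<phi>_component: "u \<in> expos k \<Longrightarrow> \<phi> u \<in> component M (deg u)"
  unfolding \<phi>_def deg_def using mon_component[of nv rv \<omega> u] rv_component h_comp
  by (intro smult_component) (auto simp: expos_def)

lemma \<phi>_carrier: "u \<in> expos k \<Longrightarrow> \<phi> u \<in> carrier M"
  using \<phi>_component component_carrier by blast

lemma \<phi>_image_carrier: "\<phi> ` expos k \<subseteq> carrier M"
  using \<phi>_carrier by auto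

lemma mon_rv_single: "s < nv \<Longrightarrow> mon rv nv (single s 1) = rv s"
proof -
  assume "s < nv"
  have "mon rv nv (single s 1) = (\<Prod>t<nv. if t = s then rv t else 1)"
    unfolding mon_def by (intro prod.cong refl) (auto simp: lookup_single when_def)
  then show ?thesis using \<open>s < nv\<close> by simp
qed

lemma \<phi>_add:
  assumes "keys w \<subseteq> {..<nv}" "u \<in> expos k"
  shows "\<phi> (u + w) = mon rv nv w \<odot> \<phi> u" "u + w \<in> expos (k + wt \<kappa> nv w)" "deg (u + w) = deg u + int (wt \<omega> nv w)"
proof -
  have w: "lookup w nv = 0" using assms(1) by (meson in_keys_iff lessThan_iff less_irrefl subsetD)
  have h: "h (lookup u nv) \<in> carrier M" using assms(2) h_carrier by (auto simp: expos_def)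
  show "\<phi> (u + w) = mon rv nv w \<odot> \<phi> u"
    by (simp add: \<phi>_def lookup_add w mon_add mult.commute[of "mon rv nv u"] smult_mult[OF h])
  show "u + w \<in> expos (k + wt \<kappa> nv w)"
    using assms keys_add[of u w] by (fastforce simp: expos_def wt_add lookup_add w)
  show "deg (u + w) = deg u + int (wt \<omega> nv w)"
    by (simp add: deg_def wt_add lookup_add w)
qed

lemma wt_single: "s < nv \<Longrightarrow> wt w nv (single s 1) = w s"
proof -
  assume "s < nv"
  have "wt w nv (single s 1) = (\<Sum>t<nv. if t = s then w t else 0)"
    unfolding wt_def by (intro sum.cong refl) (auto simp: lookup_single when_def)
  then show ?thesis using \<open>s < nv\<close> by simp
qed

lemma rv_smult_\<phi>:
  assumes "s < nv" "u \<in> expos k"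
  shows "rv s \<odot> \<phi> u \<in> \<phi> ` expos (k + \<kappa> s)"
proof -
  have "keys (single s (1::nat)) \<subseteq> {..<nv}" using assms(1) by simp
  note a = \<phi>_add[OF this assms(2)]
  have "\<phi> (u + single s 1) = rv s \<odot> \<phi> u" using a(1) unfolding mon_rv_single[OF assms(1)] .
  moreover have "u + single s 1 \<in> expos (k + \<kappa> s)" using a(2) unfolding wt_single[OF assms(1)] .
  ultimately show ?thesis by (metis imageI)
qed

text \<open>Multiplication by a variable raises an exponent of second weight 0 and so maps the
  elements for \<open>k\<close> to elements for the same \<open>k\<close>; for a subspace, closure
  under variables is enough.\<close>

lemma kspan_expos_smodule: "smodule (kspan (\<phi> ` expos k))"
proof (rule ksubspace_mvar_smodule[OF kspan_ksubspace[OF \<phi>_image_carrier]])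
  fix x and s :: 'n assume x: "x \<in> kspan (\<phi> ` expos k)"
  obtain t where t: "t < CARD('n)" "s = enum_var t" by (rule enum_varE)
  have "rv t \<odot> x \<in> kspan (\<phi> ` expos k)"
  proof (rule smult_kspan[OF \<phi>_image_carrier kspan_ksubspace[OF \<phi>_image_carrier] _ x])
    fix y assume "y \<in> \<phi> ` expos k"
    then have "rv t \<odot> y \<in> \<phi> ` expos (k + \<kappa> t)" using rv_smult_\<phi>[of t] t(1) by (auto simp: nv_def)
    then have "rv t \<odot> y \<in> \<phi> ` expos k" using t(1) by (simp add: \<kappa>_def)
    then show "rv t \<odot> y \<in> kspan (\<phi> ` expos k)" by (rule kspan_base[OF \<phi>_image_carrier])
  qed
  then show "mvar s \<odot> x \<in> kspan (\<phi> ` expos k)" using t by (simp add: rv_def)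
qed

lemma ideal_power_smult_mem:
  "p \<in> ideal_power I k \<Longrightarrow> x \<in> N \<Longrightarrow> p \<odot> x \<in> kspan (\<phi> ` expos k)"
proof (induction k arbitrary: p x)
  case 0
  have "h ` {..<r} \<subseteq> kspan (\<phi> ` expos 0)"
  proof
    fix y assume "y \<in> h ` {..<r}"
    then obtain l where l: "l < r" "y = h l" by auto
    have "single nv l \<in> expos 0" using l by (auto simp: expos_def wt_def lookup_single when_def)
    moreover have "\<phi> (single nv l) = h l"
    proof -
      have "mon rv nv (single nv l) = 1" by (simp add: mon_def lookup_single when_def)
      then show ?thesis using h_carrier[OF l(1)] by (simp add: \<phi>_def)
    qed
    ultimately show "y \<in> kspan (\<phi> ` expos 0)" using l(2) by (metis kspan_base[OF \<phi>_image_carrier] imageI)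
  qed
  then have "N \<subseteq> kspan (\<phi> ` expos 0)"
    unfolding module_gen by (rule sspan_minimal[OF kspan_expos_smodule])
  then show ?case using 0 smoduleD(4)[OF kspan_expos_smodule] by auto
next
  case (Suc k)
  let ?W = "kspan (\<phi> ` expos (Suc k))"
  note W = smoduleD[OF kspan_expos_smodule[of "Suc k"]]
  \<comment> \<open>The multipliers that take the span for \<open>k\<close> into the span for
    \<open>k + 1\<close> form an ideal. It contains the generators \<open>f j\<close>, hence all of
    \<open>I\<close>.\<close>
  define T where "T = {q. \<forall>y\<in>kspan (\<phi> ` expos k). q \<odot> y \<in> ?W}"
  have car: "y \<in> carrier M" if "y \<in> kspan (\<phi> ` expos k)" for y
    using smoduleD(1)[OF kspan_expos_smodule that] .
  have "ideal T \<S>" unfolding ideal_class_ring_iff T_def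
    using W car by (auto simp: smult_0_left smult_add_left smult_mult)
  moreover have "f ` {..<m} \<subseteq> T"
  proof
    fix q assume "q \<in> f ` {..<m}"
    then obtain j where j: "j < m" "q = f j" by auto
    let ?s = "CARD('n) + j"
    have s: "?s < nv" "rv ?s = q" "\<kappa> ?s = 1" using j by (auto simp: nv_def rv_def \<kappa>_def)
    have "q \<odot> y \<in> ?W" if y: "y \<in> kspan (\<phi> ` expos k)" for y
    proof (rule smult_kspan[OF \<phi>_image_carrier kspan_ksubspace[OF \<phi>_image_carrier] _ y])
      fix z assume "z \<in> \<phi> ` expos k"
      then have "q \<odot> z \<in> \<phi> ` expos (Suc k)" using rv_smult_\<phi>[OF s(1)] s by auto
      then show "q \<odot> z \<in> ?W" by (rule kspan_base[OF \<phi>_image_carrier])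
    qed
    then show "q \<in> T" by (simp add: T_def)
  qed
  ultimately have IT: "I \<subseteq> T" unfolding ideal_gen by (rule Idl_minimal)
  have x: "x \<in> carrier M" using smoduleD(1)[OF N_smodule Suc.prems(2)] .
  from Suc.prems(1) show ?case unfolding ideal_power_Suc
  proof (induction rule: ideal_prod.induct)
    case (prod i j)
    have "i \<odot> x \<in> kspan (\<phi> ` expos k)" using Suc.IH[OF prod(1) Suc.prems(2)] .
    then have "j \<odot> (i \<odot> x) \<in> ?W" using IT prod(2) by (auto simp: T_def)
    then show ?case using x by (simp add: smult_mult[symmetric] mult.commute)
  next
    case (sum s t)
    then show ?case using W(3) x by (simp add: smult_add_left)
  qed
qed

lemma ideal_smult_eq: "ideal_smult (ideal_power I k) M N = kspan (\<phi> ` expos k)"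
proof
  let ?G = "{p \<odot> x | p x. p \<in> ideal_power I k \<and> x \<in> N}"
  have "?G \<subseteq> kspan (\<phi> ` expos k)" using ideal_power_smult_mem by auto
  then show "ideal_smult (ideal_power I k) M N \<subseteq> kspan (\<phi> ` expos k)"
    unfolding ideal_smult_def by (rule sspan_minimal[OF kspan_expos_smodule])
  have G: "?G \<subseteq> carrier M" using smoduleD(1,4)[OF N_smodule] by auto
  have "\<phi> ` expos k \<subseteq> sspan ?G"
  proof
    fix y assume "y \<in> \<phi> ` expos k"
    then obtain u where u: "u \<in> expos k" "y = \<phi> u" by auto
    have "mon rv nv u \<in> ideal_power I (wt \<kappa> nv u)"
      by (rule mon_ideal_power[OF I_ideal]) (auto simp: \<kappa>_def rv_def nv_def intro: f_mem)
    then have "y \<in> ?G" using u h_mem by (auto simp: expos_def \<phi>_def)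
    then show "y \<in> sspan ?G" by (rule sspan_base[OF G])
  qed
  then show "kspan (\<phi> ` expos k) \<subseteq> ideal_smult (ideal_power I k) M N"
    unfolding ideal_smult_def by (rule kspan_minimal[OF smodule_ksubspace[OF sspan_smodule[OF G]]])
qed

definition hexpos :: "nat \<Rightarrow> int \<Rightarrow> (nat \<Rightarrow>\<^sub>0 nat) set"
  where "hexpos k j = {u \<in> expos k. deg u = j}"

lemma hexpos_image_carrier: "\<phi> ` hexpos k j \<subseteq> carrier M"
  using \<phi>_image_carrier by (auto simp: hexpos_def)

lemma finite_hexpos: "finite (hexpos k j)"
proof (rule finite_subset)
  \<comment> \<open>A generator of \<open>I\<close> may have degree 0, so its exponent is bounded by
    \<open>k\<close> through \<open>\<kappa>\<close> and not through the degree; the last entry is a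
    generator index below \<open>r\<close>.\<close>
  let ?B = "nat (\<bar>j\<bar> + (\<Sum>l<r. \<bar>\<delta> l\<bar>)) + k + r"
  show "hexpos k j \<subseteq> {v. keys v \<subseteq> {..<Suc nv} \<and> (\<forall>s. lookup v s \<le> ?B)}"
  proof
    fix u assume u: "u \<in> hexpos k j"
    then have e: "keys u \<subseteq> {..<Suc nv}" "lookup u nv < r" "wt \<kappa> nv u = k" "int (wt \<omega> nv u) + \<delta> (lookup u nv) = j"
      by (auto simp: hexpos_def expos_def deg_def)
    have "\<bar>\<delta> (lookup u nv)\<bar> \<le> (\<Sum>l<r. \<bar>\<delta> l\<bar>)" using e(2) by (intro member_le_sum) auto
    then have wb: "wt \<omega> nv u \<le> nat (\<bar>j\<bar> + (\<Sum>l<r. \<bar>\<delta> l\<bar>))" using e(4) by linarith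
    have "lookup u s \<le> ?B" for s
    proof -
      consider "s < nv" | "s = nv" | "s \<notin> {..<Suc nv}" by fastforce
      then show ?thesis
      proof cases
        case 1
        have "lookup u s \<le> (\<omega> s + \<kappa> s) * lookup u s" by (simp add: \<omega>_def \<kappa>_def)
        also have "\<dots> \<le> wt \<omega> nv u + wt \<kappa> nv u" using wt_le[OF 1] by (simp add: distrib_right add_mono)
        finally show ?thesis using wb e(3) by simp
      next
        case 2
        then show ?thesis using e(2) by simp
      next
        case 3
        then have "s \<notin> keys u" using e(1) by blast
        then show ?thesis by (simp add: in_keys_iff)
      qed
    qed
    then show "u \<in> {v. keys v \<subseteq> {..<Suc nv} \<and> (\<forall>s. lookup v s \<le> ?B)}" using e(1) by simp
  qed
qed (rule finite_bounded_exponents, simp)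

lemma hpart_kspan:
  assumes "x \<in> kspan (\<phi> ` expos k)"
  shows "hpart j x \<in> kspan (\<phi> ` hexpos k j)"
proof -
  let ?W = "kspan (\<phi> ` hexpos k j)"
  have W: "ksubspace ?W" by (rule kspan_ksubspace[OF hexpos_image_carrier])
  let ?V = "{x \<in> carrier M. hpart j x \<in> ?W}"
  have const: "hpart j (mpoly_const c \<odot> x) = mpoly_const c \<odot> hpart j x" if "x \<in> carrier M" for c x
    using hpart_smult[OF that hom_component_const, of j c] by simp
  have "hpart j \<zero> = \<zero>" using hpart_of_component[OF component_zero, of j j] by simp
  then have "ksubspace ?V" using W const by (auto simp: ksubspace_def hpart_add smult_in_carrier)
  moreover have "\<phi> ` expos k \<subseteq> ?V"
  proof
    fix y assume "y \<in> \<phi> ` expos k"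
    then obtain u where u: "u \<in> expos k" "y = \<phi> u" by auto
    have "hpart j y = (if j = deg u then y else \<zero>)"
      using hpart_of_component[OF \<phi>_component[OF u(1)], of j] by (simp add: u(2))
    moreover have "y \<in> ?W" if "j = deg u"
      using kspan_base[OF hexpos_image_carrier, of y k j] u that by (auto simp: hexpos_def)
    moreover have "\<zero> \<in> ?W" using W by (simp add: ksubspace_def)
    ultimately show "y \<in> ?V" using \<phi>_carrier u by auto
  qed
  ultimately have "kspan (\<phi> ` expos k) \<subseteq> ?V" by (rule kspan_minimal)
  then show ?thesis using assms by auto
qed

lemma kspan_hexpos_subset: "kspan (\<phi> ` hexpos k j) \<subseteq> kspan (\<phi> ` expos k)"
  by (rule kspan_mono) (use \<phi>_carrier in \<open>auto simp: hexpos_def\<close>)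

lemma component_kspan: "component M j \<inter> kspan (\<phi> ` expos k) = kspan (\<phi> ` hexpos k j)"
proof
  have "kspan (\<phi> ` hexpos k j) \<subseteq> component M j"
    by (rule kspan_minimal[OF component_ksubspace]) (auto simp: hexpos_def intro: \<phi>_component)
  then show "kspan (\<phi> ` hexpos k j) \<subseteq> component M j \<inter> kspan (\<phi> ` expos k)"
    using kspan_hexpos_subset by auto
  show "component M j \<inter> kspan (\<phi> ` expos k) \<subseteq> kspan (\<phi> ` hexpos k j)"
  proof
    fix x assume x: "x \<in> component M j \<inter> kspan (\<phi> ` expos k)"
    then have "hpart j x = x" using hpart_of_component[of x j j] by simp
    then show "x \<in> kspan (\<phi> ` hexpos k j)" using x hpart_kspan[of x k j] by simp
  qed
qed

text \<open>The bidegree is read off from \<open>u\<close> itself, so that standardness is one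
  predicate for all powers and degrees at once and can be compared between an exponent and its
  multiples.\<close>

definition standard :: "(nat \<Rightarrow>\<^sub>0 nat) \<Rightarrow> bool"
  where "standard u \<longleftrightarrow> \<phi> u \<notin> kspan (\<phi> ` {u' \<in> hexpos (wt \<kappa> nv u) (deg u). u' < u})"

lemma kdim_eq_card_standard:
  "kdim (component M j \<inter> ideal_smult (ideal_power I k) M N) = card {u \<in> hexpos k j. standard u}"
proof -
  have "kdim (kspan (\<phi> ` hexpos k j)) = card {v \<in> hexpos k j. \<phi> v \<notin> kspan (\<phi> ` {u \<in> hexpos k j. u < v})}"
    by (rule K.greedy_dim[OF finite_hexpos]) (use hexpos_image_carrier in simp)
  also have "{v \<in> hexpos k j. \<phi> v \<notin> kspan (\<phi> ` {u \<in> hexpos k j. u < v})} = {u \<in> hexpos k j. standard u}"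
    by (auto simp: standard_def hexpos_def expos_def)
  finally show ?thesis unfolding ideal_smult_eq component_kspan .
qed

text \<open>The entry at \<open>nv\<close> is a generator index and not an exponent, so it is fixed
  before divisors are considered.\<close>

definition standard_slice :: "nat \<Rightarrow> (nat \<Rightarrow>\<^sub>0 nat) set"
  where "standard_slice l = {v. keys v \<subseteq> {..<nv} \<and> standard (v + single nv l)}"

lemma expos_decode:
  assumes "keys v \<subseteq> {..<nv}" "l < r"
  shows "v + single nv l \<in> expos (wt \<kappa> nv v)" "lookup (v + single nv l) nv = l"
    "deg (v + single nv l) = int (wt \<omega> nv v) + \<delta> l"
proof -
  have v: "lookup v nv = 0" using assms(1) by (meson in_keys_iff lessThan_iff less_irrefl subsetD)
  have z: "wt w nv (single nv l) = 0" for w by (simp add: wt_def lookup_single when_def)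
  show l: "lookup (v + single nv l) nv = l" by (simp add: lookup_add v)
  have "keys (v + single nv l) \<subseteq> {..<Suc nv}" using assms(1) keys_add[of v "single nv l"]
    by (fastforce split: if_splits)
  then show "v + single nv l \<in> expos (wt \<kappa> nv v)" using l assms(2) by (simp add: expos_def wt_add z)
  show "deg (v + single nv l) = int (wt \<omega> nv v) + \<delta> l" by (simp add: deg_def l wt_add z)
qed

text \<open>Multiplying a relation that expresses \<open>\<phi> u\<close> by smaller monomials with a monomial gives
  such a relation for the product, so standardness passes to divisors.\<close>

lemma downclosed_standard_slice:
  assumes "l < r"
  shows "downclosed (standard_slice l)"
  unfolding downclosed_def
proof (intro ballI allI impI)
  fix v u assume v: "v \<in> standard_slice l" and le: "\<forall>s. lookup u s \<le> lookup v s"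
  have kv: "keys v \<subseteq> {..<nv}" "standard (v + single nv l)" using v by (auto simp: standard_slice_def)
  have ku: "keys u \<subseteq> {..<nv}"
  proof
    fix s assume "s \<in> keys u"
    then have "s \<in> keys v" using le[rule_format, of s] by (simp add: in_keys_iff)
    then show "s \<in> {..<nv}" using kv by auto
  qed
  define w where "w = v - u"
  have vw: "v = u + w" using le by (intro poly_mapping_eqI) (simp add: w_def lookup_add lookup_minus)
  have kw: "keys w \<subseteq> {..<nv}"
  proof
    fix s assume "s \<in> keys w"
    then have "s \<in> keys v" by (simp add: w_def in_keys_iff lookup_minus)
    then show "s \<in> {..<nv}" using kv by auto
  qed
  let ?u = "u + single nv l" and ?v = "v + single nv l"
  have uv: "?v = ?u + w" by (simp add: vw add_ac)
  note eu = expos_decode[OF ku assms]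
  have wu: "wt \<kappa> nv ?u = wt \<kappa> nv u" using eu(1) by (simp add: expos_def)
  have wv: "wt \<kappa> nv ?v = wt \<kappa> nv u + wt \<kappa> nv w" unfolding uv by (simp only: wt_add[of \<kappa> nv ?u w] wu)
  have dv: "deg ?v = deg ?u + int (wt \<omega> nv w)" unfolding uv by (rule \<phi>_add(3)[OF kw eu(1)])
  have "standard ?u"
  proof (rule ccontr)
    assume "\<not> standard ?u"
    let ?X = "{u' \<in> hexpos (wt \<kappa> nv u) (deg ?u). u' < ?u}" and ?Y = "{u' \<in> hexpos (wt \<kappa> nv ?v) (deg ?v). u' < ?v}"
    have in_span: "\<phi> ?u \<in> kspan (\<phi> ` ?X)" using \<open>\<not> standard ?u\<close> by (simp add: standard_def wu)
    have Xc: "\<phi> ` ?X \<subseteq> carrier M" "\<phi> ` ?Y \<subseteq> carrier M" using hexpos_image_carrier by auto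
    have "mon rv nv w \<odot> \<phi> ?u \<in> kspan (\<phi> ` ?Y)"
    proof (rule smult_kspan[OF Xc(1) kspan_ksubspace[OF Xc(2)] _ in_span])
      fix x assume "x \<in> \<phi> ` ?X"
      then obtain u' where u': "u' \<in> expos (wt \<kappa> nv u)" "deg u' = deg ?u" "u' < ?u" "x = \<phi> u'"
        by (auto simp: hexpos_def)
      note a = \<phi>_add[OF kw u'(1)]
      have "u' + w < ?v" unfolding uv using u'(3) by (rule add_strict_right_mono)
      then have "u' + w \<in> ?Y" using a(2,3) u'(2) by (simp add: hexpos_def wv dv)
      from imageI[OF this, of \<phi>] have "mon rv nv w \<odot> x \<in> \<phi> ` ?Y" unfolding a(1) u'(4) .
      then show "mon rv nv w \<odot> x \<in> kspan (\<phi> ` ?Y)" by (rule kspan_base[OF Xc(2)])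
    qed
    then have "\<phi> ?v \<in> kspan (\<phi> ` ?Y)" unfolding uv using \<phi>_add(1)[OF kw eu(1)] by simp
    then show False using kv(2) by (simp add: standard_def)
  qed
  then show "u \<in> standard_slice l" using ku by (simp add: standard_slice_def)
qed

text \<open>The standard exponents of degree at most \<open>i\<close> are sorted by generator
  instead of by degree. As \<open>j0\<close> lies below all degrees that occur, the interval misses
  none of them.\<close>

lemma sum_kdim:
  assumes "\<And>l. l < r \<Longrightarrow> j0 \<le> \<delta> l"
  shows "(\<Sum>j\<in>{j0..i}. kdim (component M j \<inter> ideal_smult (ideal_power I k) M N)) =
    (\<Sum>l<r. card (bidegree_set \<omega> \<kappa> nv (standard_slice l) (i - \<delta> l) (int k)))"
proof -
  let ?A = "\<lambda>j. {u \<in> hexpos k j. standard u}" and ?B = "\<lambda>l. bidegree_set \<omega> \<kappa> nv (standard_slice l) (i - \<delta> l) (int k)"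
  have "(\<Sum>j\<in>{j0..i}. kdim (component M j \<inter> ideal_smult (ideal_power I k) M N)) = (\<Sum>j\<in>{j0..i}. card (?A j))"
    by (simp add: kdim_eq_card_standard)
  also have "\<dots> = card (\<Union>j\<in>{j0..i}. ?A j)"
    by (rule card_UN_disjoint[symmetric]) (auto simp: finite_hexpos, auto simp: hexpos_def)
  also have "(\<Union>j\<in>{j0..i}. ?A j) = (\<Union>l<r. (\<lambda>v. v + single nv l) ` ?B l)"
  proof (intro equalityI subsetI)
    fix u assume "u \<in> (\<Union>j\<in>{j0..i}. ?A j)"
    then have u: "u \<in> expos k" "deg u \<le> i" "standard u" by (auto simp: hexpos_def)
    have ku: "keys u \<subseteq> {..<Suc nv}" using u(1) by (simp add: expos_def)
    obtain v l where vl: "keys v \<subseteq> {..<nv}" "u = v + single nv l" by (rule keys_subset_lessThan_SucE[OF ku])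
    have "lookup v nv = 0" using vl(1) by (meson in_keys_iff lessThan_iff less_irrefl subsetD)
    then have l: "l < r" using u(1) by (simp add: expos_def vl(2) lookup_add)
    note e = expos_decode[OF vl(1) l]
    have "wt \<kappa> nv v = k" using e(1) u(1) by (simp add: expos_def vl(2))
    then have "v \<in> ?B l" using vl u(2,3) e(3) by (simp add: bidegree_set_def standard_slice_def)
    then show "u \<in> (\<Union>l<r. (\<lambda>v. v + single nv l) ` ?B l)" using l vl(2) by blast
  next
    fix u assume "u \<in> (\<Union>l<r. (\<lambda>v. v + single nv l) ` ?B l)"
    then obtain l v where l: "l < r" "v \<in> ?B l" "u = v + single nv l" by auto
    then have v: "keys v \<subseteq> {..<nv}" "standard u" "wt \<kappa> nv v = k" "int (wt \<omega> nv v) \<le> i - \<delta> l"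
      by (auto simp: bidegree_set_def standard_slice_def)
    note e = expos_decode[OF v(1) l(1)]
    have "u \<in> ?A (deg u)" using e(1) v l(3) by (simp add: hexpos_def)
    moreover have "deg u \<in> {j0..i}" using e(3) v(4) l(3) assms[OF l(1)] by simp
    ultimately show "u \<in> (\<Union>j\<in>{j0..i}. ?A j)" by blast
  qed
  also have "card \<dots> = (\<Sum>l<r. card ((\<lambda>v. v + single nv l) ` ?B l))"
  proof (rule card_UN_disjoint)
    have "\<omega> s + \<kappa> s \<ge> 1" for s by (simp add: \<omega>_def \<kappa>_def)
    then show "\<forall>l\<in>{..<r}. finite ((\<lambda>v. v + single nv l) ` ?B l)" by (simp add: finite_bidegree_set)
    show "\<forall>l\<in>{..<r}. \<forall>l'\<in>{..<r}. l \<noteq> l' \<longrightarrow> (\<lambda>v. v + single nv l) ` ?B l \<inter> (\<lambda>v. v + single nv l') ` ?B l' = {}"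
    proof (intro ballI impI)
      fix l l' assume ll: "l \<in> {..<r}" "l' \<in> {..<r}" "l \<noteq> l'"
      have lk: "lookup u nv = l" if "u \<in> (\<lambda>v. v + single nv l) ` ?B l" "l < r" for u l
        using that expos_decode(2) by (auto simp: bidegree_set_def)
      have False if "u \<in> (\<lambda>v. v + single nv l) ` ?B l" "u \<in> (\<lambda>v. v + single nv l') ` ?B l'" for u
        using lk[OF that(1)] lk[OF that(2)] ll by simp
      then show "(\<lambda>v. v + single nv l) ` ?B l \<inter> (\<lambda>v. v + single nv l') ` ?B l' = {}" by blast
    qed
  qed simp
  also have "\<dots> = (\<Sum>l<r. card (?B l))"
    by (intro sum.cong refl card_image) (auto simp: inj_on_def)
  finally show ?thesis .
qed

lemma fin_dim_component:
  "vectorspace.fin_dim class_ring ((kspace M)\<lparr>carrier := component M j \<inter> ideal_smult (ideal_power I k) M N\<rparr>)"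
  unfolding ideal_smult_eq component_kspan
  by (rule K.fin_dim_span) (use finite_hexpos hexpos_image_carrier in auto)

end


section \<open>Quotients\<close>

context graded_module
begin

definition coset :: "'m set \<Rightarrow> 'm \<Rightarrow> 'm set"
  where "coset U x = (\<lambda>u. u \<oplus> x) ` U"

lemma a_r_coset_restrict: "U +>\<^bsub>restrict_graded M W\<^esub> x = coset U x"
  by (auto simp: a_r_coset_def' restrict_graded_def coset_def)

lemma coset_eq_iff:
  assumes U: "smodule U" and x: "x \<in> carrier M" and y: "y \<in> carrier M"
  shows "coset U x = coset U y \<longleftrightarrow> x \<ominus> y \<in> U"
proof
  note c = smoduleD[OF U]
  assume "coset U x = coset U y"
  moreover have "x \<in> coset U x" unfolding coset_def using c(2) x by (intro image_eqI[of _ _ "\<zero>"]) auto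
  ultimately obtain u where u: "u \<in> U" "x = u \<oplus> y" by (auto simp: coset_def)
  then have "x \<ominus> y = u" using y c(1) by (simp add: a_minus_def M.a_assoc M.r_neg)
  then show "x \<ominus> y \<in> U" using u by simp
next
  note c = smoduleD[OF U]
  have sub: "coset U x \<subseteq> coset U y" if d: "x \<ominus> y \<in> U" and x: "x \<in> carrier M" and y: "y \<in> carrier M" for x y
  proof
    fix z assume "z \<in> coset U x"
    then obtain u where u: "u \<in> U" "z = u \<oplus> x" by (auto simp: coset_def)
    have "z = (u \<oplus> (x \<ominus> y)) \<oplus> y"
      using u x y c(1) by (simp add: a_minus_def M.a_assoc M.l_neg)
    then show "z \<in> coset U y" using c(3)[OF u(1) d] by (auto simp: coset_def)
  qed
  assume d: "x \<ominus> y \<in> U"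
  have "y \<ominus> x = (-1) \<odot> (x \<ominus> y)"
    using x y by (simp add: uminus_eq_smult[symmetric] a_minus_def M.minus_add M.minus_minus M.a_comm)
  then have "y \<ominus> x \<in> U" using c(4)[OF d] by simp
  then show "coset U x = coset U y" using sub[OF d x y] sub[of y x] x y by blast
qed

lemma coset_zero: "smodule U \<Longrightarrow> coset U \<zero> = U"
  using smoduleD(1)[of U] by (auto simp: coset_def image_iff)

lemma coset_eq_zero: "smodule U \<Longrightarrow> x \<in> carrier M \<Longrightarrow> coset U x = U \<longleftrightarrow> x \<in> U"
  using coset_eq_iff[of U x "\<zero>"] coset_zero[of U]
    uminus_eq_smult[of "\<zero>"] smult_0_right[of "-1"] by (simp add: a_minus_def)

lemma coset_add:
  assumes U: "smodule U" and x: "x \<in> carrier M" and y: "y \<in> carrier M"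
  shows "set_add (restrict_graded M W) (coset U x) (coset U y) = coset U (x \<oplus> y)"
proof -
  note c = smoduleD[OF U]
  have e: "(u \<oplus> x) \<oplus> (v \<oplus> y) = (u \<oplus> v) \<oplus> (x \<oplus> y)" if "u \<in> U" "v \<in> U" for u v
    using that c(1) x y by (simp add: M.a_ac)
  have "set_add (restrict_graded M W) (coset U x) (coset U y) = {(u \<oplus> x) \<oplus> (v \<oplus> y) | u v. u \<in> U \<and> v \<in> U}"
    by (auto simp: set_add_def' restrict_graded_def coset_def)
  also have "\<dots> = coset U (x \<oplus> y)"
  proof (intro equalityI subsetI)
    fix z assume "z \<in> {(u \<oplus> x) \<oplus> (v \<oplus> y) | u v. u \<in> U \<and> v \<in> U}"
    then show "z \<in> coset U (x \<oplus> y)" using e c(3) by (auto simp: coset_def)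
  next
    fix z assume "z \<in> coset U (x \<oplus> y)"
    then obtain u where u: "u \<in> U" "z = u \<oplus> (x \<oplus> y)" by (auto simp: coset_def)
    have "z = (u \<oplus> x) \<oplus> (\<zero> \<oplus> y)" using u e[OF u(1) c(2)] c(1) by simp
    then show "z \<in> {(u \<oplus> x) \<oplus> (v \<oplus> y) | u v. u \<in> U \<and> v \<in> U}" using u(1) c(2) by blast
  qed
  finally show ?thesis .
qed

lemma coset_smult:
  assumes U: "smodule U" and x: "x \<in> carrier M"
  shows "(\<Union>z\<in>coset U x. coset U (p \<odot> z)) = coset U (p \<odot> x)"
proof -
  note c = smoduleD[OF U]
  have "coset U (p \<odot> z) = coset U (p \<odot> x)" if z: "z \<in> coset U x" for z
  proof -
    obtain u where u: "u \<in> U" "z = u \<oplus> x" using z by (auto simp: coset_def)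
    have uc: "u \<in> carrier M" using c(1) u(1) .
    have "p \<odot> z \<ominus> p \<odot> x = p \<odot> u"
      using u(2) uc x smult_in_carrier by (simp add: smult_add_right a_minus_def M.a_assoc M.r_neg)
    then show ?thesis using coset_eq_iff[OF U, of "p \<odot> z" "p \<odot> x"] c(4)[OF u(1)] uc x u(2) smult_in_carrier by simp
  qed
  moreover have "coset U x \<noteq> {}" using c(2) by (auto simp: coset_def)
  ultimately show ?thesis by auto
qed

abbreviation quotient :: "'m set \<Rightarrow> 'm set \<Rightarrow> (('n, 'k) mpoly, 'm set) graded_module"
  where "quotient W U \<equiv> quotient_graded (restrict_graded M W) U"

lemma quotient_component: "component (quotient W U) j = coset U ` (component M j \<inter> W)"
  by (simp add: quotient_graded_def a_r_coset_restrict) (simp add: restrict_graded_def)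

lemma quotient_carrier: "carrier (quotient W U) = coset U ` W"
  by (auto simp: quotient_graded_def A_RCOSETS_def' a_r_coset_restrict) (auto simp: restrict_graded_def)

lemma quotient_zero: "\<zero>\<^bsub>quotient W U\<^esub> = U"
  by (simp add: quotient_graded_def)

lemma quotient_add:
  "smodule U \<Longrightarrow> x \<in> carrier M \<Longrightarrow> y \<in> carrier M \<Longrightarrow> coset U x \<oplus>\<^bsub>quotient W U\<^esub> coset U y = coset U (x \<oplus> y)"
  using coset_add by (simp add: quotient_graded_def)

lemma quotient_smult:
  "smodule U \<Longrightarrow> x \<in> carrier M \<Longrightarrow> p \<odot>\<^bsub>quotient W U\<^esub> coset U x = coset U (p \<odot> x)"
  using coset_smult[of U x p] by (simp add: quotient_graded_def a_r_coset_restrict) (simp add: restrict_graded_def)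

lemma annihilator_quotient:
  assumes "smodule U" "smodule W"
  shows "annihilator \<S> (quotient W U) = {p. \<forall>x\<in>W. p \<odot> x \<in> U}"
proof -
  have "p \<odot>\<^bsub>quotient W U\<^esub> coset U x = U \<longleftrightarrow> p \<odot> x \<in> U" if "x \<in> W" for p x
    using that assms smoduleD(1)[OF assms(2)] smult_in_carrier
    by (simp add: quotient_smult coset_eq_zero)
  then show ?thesis by (auto simp: annihilator_def quotient_carrier quotient_zero)
qed

lemma ksubspace_Int: "ksubspace V \<Longrightarrow> ksubspace W \<Longrightarrow> ksubspace (V \<inter> W)"
  by (auto simp: ksubspace_def)

lemma ksubspace_vectorspace: "ksubspace V \<Longrightarrow> vectorspace class_ring ((kspace M)\<lparr>carrier := V\<rparr>)"
  unfolding ksubspace_iff using K.submodule_is_module class_field.field_axioms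
  by (simp add: vectorspace_def)

text \<open>Rank-nullity for the projection of the degree-\<open>j\<close> part of \<open>W\<close>,
  whose kernel is the degree-\<open>j\<close> part of \<open>U\<close>. The additive form avoids
  truncated subtraction.\<close>

lemma quotient_dim:
  assumes U: "smodule U" and W: "smodule W" and "U \<subseteq> W"
    and fin: "vectorspace.fin_dim class_ring ((kspace M)\<lparr>carrier := component M j \<inter> W\<rparr>)"
  shows "component_dim (quotient W U) j + kdim (component M j \<inter> U) = kdim (component M j \<inter> W)"
proof -
  let ?Wj = "component M j \<inter> W" and ?Q = "component_space (quotient W U) j"
  let ?V = "(kspace M)\<lparr>carrier := ?Wj\<rparr>"
  have sub: "ksubspace ?Wj" using component_ksubspace smodule_ksubspace[OF W] by (rule ksubspace_Int)
  have car: "x \<in> carrier M" if "x \<in> ?Wj" for x using that component_carrier by blast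
  have ops: "carrier ?Q = coset U ` ?Wj" "\<zero>\<^bsub>?Q\<^esub> = coset U \<zero>"
    by (simp_all add: component_space_def quotient_component quotient_zero coset_zero[OF U])
  have add: "coset U x \<oplus>\<^bsub>?Q\<^esub> coset U y = coset U (x \<oplus> y)" if "x \<in> carrier M" "y \<in> carrier M" for x y
    using quotient_add[OF U that] by (simp add: component_space_def)
  have smult: "c \<odot>\<^bsub>?Q\<^esub> coset U x = coset U (mpoly_const c \<odot> x)" if "x \<in> carrier M" for c x
    using quotient_smult[OF U that] by (simp add: component_space_def)
  have Wj: "\<zero> \<in> ?Wj" "\<And>x y. x \<in> ?Wj \<Longrightarrow> y \<in> ?Wj \<Longrightarrow> x \<oplus> y \<in> ?Wj"
    "\<And>x c. x \<in> ?Wj \<Longrightarrow> mpoly_const c \<odot> x \<in> ?Wj" using sub unfolding ksubspace_def by auto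
  have V: "vectorspace class_ring ?V" by (rule ksubspace_vectorspace[OF sub])
  have Q: "vectorspace class_ring ?Q"
  proof (rule vs_criteria)
    show "\<forall>v\<in>carrier ?Q. \<exists>u\<in>carrier ?Q. v \<oplus>\<^bsub>?Q\<^esub> u = \<zero>\<^bsub>?Q\<^esub>"
    proof
      fix v assume "v \<in> carrier ?Q"
      then obtain x where x: "x \<in> ?Wj" "v = coset U x" by (auto simp: ops)
      have "\<ominus> x = mpoly_const (-1) \<odot> x"
        using uminus_eq_smult[OF car[OF x(1)]] by (simp add: mpoly_const_def single_uminus)
      then have m: "\<ominus> x \<in> ?Wj" using Wj(3)[OF x(1)] by simp
      show "\<exists>u\<in>carrier ?Q. v \<oplus>\<^bsub>?Q\<^esub> u = \<zero>\<^bsub>?Q\<^esub>"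
        by (rule bexI[of _ "coset U (\<ominus> x)"])
           (use m car[OF x(1)] in \<open>auto simp: x(2) ops add car M.r_neg\<close>)
    qed
  qed (use Wj in \<open>auto simp: ops add smult car class_field.field_axioms M.a_ac
      smult_in_carrier mpoly_const_mult mpoly_const_add mpoly_const_1 smult_mult smult_add_left smult_add_right\<close>)
  interpret V: vectorspace class_ring ?V by (rule V)
  interpret Q: vectorspace class_ring ?Q by (rule Q)
  interpret T: linear_map class_ring ?V ?Q "coset U"
  proof (unfold_locales)
    show "coset U \<in> LinearCombinations.module_hom class_ring ?V ?Q"
      by (auto simp: LinearCombinations.module_hom_def ops add smult car)
  qed
  have im: "T.imT = carrier ?Q" by (auto simp: T.im_def ops)
  have ker: "T.kerT = component M j \<inter> U"
    using coset_eq_zero[OF U] car \<open>U \<subseteq> W\<close> by (auto simp: T.ker_def ops coset_zero[OF U])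
  have "vectorspace.dim class_ring (?Q\<lparr>carrier := T.imT\<rparr>) + vectorspace.dim class_ring (?V\<lparr>carrier := T.kerT\<rparr>) = V.dim"
    by (rule T.rank_nullity[OF fin])
  moreover have "?Q\<lparr>carrier := T.imT\<rparr> = ?Q" unfolding im by simp
  ultimately show ?thesis by (simp add: ker component_dim_def)
qed

lemma finsum_smult_left:
  assumes "x \<in> carrier M" "finite T"
  shows "(\<Oplus>i\<in>T. p i \<odot> x) = (\<Sum>i\<in>T. p i) \<odot> x"
  using assms(2)
proof (induction T)
  case empty
  then show ?case using smult_0_left[OF assms(1)] by simp
next
  case (insert a T)
  have "(\<Oplus>i\<in>insert a T. p i \<odot> x) = p a \<odot> x \<oplus> (\<Oplus>i\<in>T. p i \<odot> x)"
    using insert smult_in_carrier[OF assms(1)] by (intro M.finsum_insert) auto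
  then show ?case using insert smult_add_left[OF assms(1)] by simp
qed

lemma hpart_smult_component:
  assumes x: "x \<in> component M \<delta>"
  shows "hpart j (p \<odot> x) = (if \<delta> \<le> j then mpoly_hom_part (nat (j - \<delta>)) p \<odot> x else \<zero>)"
proof (rule hpart_eqI)
  have xc: "x \<in> carrier M" by (rule component_carrier[OF x])
  show "p \<odot> x \<in> carrier M" by (rule smult_in_carrier[OF xc])
  let ?c = "\<lambda>j. if \<delta> \<le> j then mpoly_hom_part (nat (j - \<delta>)) p \<odot> x else \<zero>"
  let ?D = "mono_deg ` keys p"
  let ?T = "(\<lambda>i. int i + \<delta>) ` ?D"
  show "hom_decomposition M (p \<odot> x) ?c"
  proof (rule hom_decompositionI[of ?T])
    show "finite ?T" by simp
    show "?c j \<in> component M j" for j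
      using smult_component[OF hom_part_component[of "nat (j - \<delta>)" p] x] component_zero by auto
    show "?c j = \<zero>" if "j \<notin> ?T" for j
    proof (cases "\<delta> \<le> j")
      case True
      then have "nat (j - \<delta>) \<notin> ?D" using that by (auto simp: image_iff)
      then show ?thesis using hom_part_eq_0[of "nat (j - \<delta>)" p] smult_0_left[OF xc] by simp
    qed simp
    have "(\<Oplus>j\<in>?T. ?c j) = (\<Oplus>i\<in>?D. ?c (int i + \<delta>))"
      using smult_in_carrier[OF xc] by (intro M.add.finprod_reindex) (auto simp: inj_on_def)
    also have "\<dots> = (\<Oplus>i\<in>?D. mpoly_hom_part i p \<odot> x)" by simp
    also have "\<dots> = (\<Sum>i\<in>?D. mpoly_hom_part i p) \<odot> x" by (rule finsum_smult_left[OF xc]) simp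
    also have "(\<Sum>i\<in>?D. mpoly_hom_part i p) = p" by (rule sum_hom_parts) auto
    finally show "p \<odot> x = (\<Oplus>j\<in>?T. ?c j)" by simp
  qed
qed

text \<open>On a homogeneous generator \<open>h l\<close>, the homogeneous parts of
  \<open>p \<odot> h l\<close> are the parts of \<open>p\<close> applied to \<open>h l\<close>, and
  they stay in the graded \<open>U\<close>. So every part of \<open>p\<close> takes the generators,
  and with them all of \<open>W\<close>, into \<open>U\<close>.\<close>

lemma graded_annihilator:
  assumes U: "graded U" and W: "smodule W" and gens: "W = sspan (h ` {..<r})"
    and hc: "\<And>l. l < r \<Longrightarrow> h l \<in> component M (\<delta> l)"
  shows "graded_ideal {p. \<forall>x\<in>W. p \<odot> x \<in> U}"
proof -
  let ?A = "{p. \<forall>x\<in>W. p \<odot> x \<in> U}"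
  have Us: "smodule U" "\<And>x j. x \<in> U \<Longrightarrow> hpart j x \<in> U" using U by (auto simp: graded_def)
  note c = smoduleD[OF Us(1)]
  have Wc: "x \<in> carrier M" if "x \<in> W" for x using smoduleD(1)[OF W that] .
  have hW: "h l \<in> W" if "l < r" for l
    unfolding gens using that hc component_carrier by (intro sspan_base) auto
  have id: "ideal ?A \<S>" unfolding ideal_class_ring_iff
    using c Wc by (auto simp: smult_0_left smult_add_left smult_mult)
  have "mpoly_hom_part i p \<in> ?A" if p: "p \<in> ?A" for p i
  proof -
    let ?V = "{x \<in> carrier M. mpoly_hom_part i p \<odot> x \<in> U}"
    have com: "mpoly_hom_part i p \<odot> (q \<odot> x) = q \<odot> (mpoly_hom_part i p \<odot> x)" if "x \<in> carrier M" for q x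
      using that by (simp add: smult_mult[symmetric] mult.commute)
    have "smodule ?V" using c com
      by (auto simp: smodule_def smult_0_right smult_add_right smult_in_carrier)
    moreover have "h ` {..<r} \<subseteq> ?V"
    proof
      fix x assume "x \<in> h ` {..<r}"
      then obtain l where l: "l < r" "x = h l" by auto
      have "hpart (int i + \<delta> l) (p \<odot> h l) \<in> U" using p hW[OF l(1)] Us(2) by simp
      then show "x \<in> ?V" using hpart_smult_component[OF hc[OF l(1)], of "int i + \<delta> l" p] l
          component_carrier[OF hc[OF l(1)]] by simp
    qed
    ultimately have "W \<subseteq> ?V" unfolding gens by (rule sspan_minimal)
    then show ?thesis by auto
  qed
  then show ?thesis using id by (simp add: graded_ideal_def)
qed

lemma kspan_add:
  assumes "X \<subseteq> carrier M" "x \<in> kspan X" "y \<in> kspan X"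
  shows "x \<oplus> y \<in> kspan X"
  using kspan_ksubspace[OF assms(1)] assms(2,3) by (simp add: ksubspace_def)

text \<open>A spanning set of the polynomial ring modulo the annihilator, multiplied with homogeneous
  generators of \<open>W\<close>, spans the quotient of \<open>W\<close> by \<open>U\<close>.\<close>

lemma quotient_dim_le:
  fixes r :: nat
  assumes U: "graded U" and W: "smodule W" and UW: "U \<subseteq> W" and gens: "W = sspan (h ` {..<r})"
    and hc: "\<And>l. l < r \<Longrightarrow> h l \<in> component M (\<delta> l)"
    and E: "\<And>j. finite (E j)" "\<And>j. E j \<subseteq> mpoly_hom_component j"
      "\<And>j p. p \<in> mpoly_hom_component j \<Longrightarrow> \<exists>a\<in>{p. \<forall>x\<in>W. p \<odot> x \<in> U}. \<exists>e\<in>mpoly_vs.span (E j). p = a + e"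
    and BU: "finite B" "B \<subseteq> carrier M" "component M j \<inter> U = kspan B"
  shows "kdim (component M j \<inter> W) \<le> card B + (\<Sum>l<r. if \<delta> l \<le> j then card (E (nat (j - \<delta> l))) else 0)"
proof -
  have Us: "smodule U" "\<And>x j. x \<in> U \<Longrightarrow> hpart j x \<in> U" using U by (auto simp: graded_def)
  note c = smoduleD[OF Us(1)]
  have hcar: "h l \<in> carrier M" if "l < r" for l using component_carrier[OF hc[OF that]] .
  have hW: "h l \<in> W" if "l < r" for l
    unfolding gens using that hcar by (intro sspan_base) auto
  define G where "G = (\<Union>l\<in>{l. l < r \<and> \<delta> l \<le> j}. (\<lambda>e. e \<odot> h l) ` E (nat (j - \<delta> l)))"
  have G_comp: "G \<subseteq> component M j"
  proof
    fix x assume "x \<in> G"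
    then obtain l e where l: "l < r" "\<delta> l \<le> j" "e \<in> E (nat (j - \<delta> l))" "x = e \<odot> h l" by (auto simp: G_def)
    have "e \<in> mpoly_hom_component (nat (j - \<delta> l))" using E(2) l(3) by auto
    then have "x \<in> component M (int (nat (j - \<delta> l)) + \<delta> l)" unfolding l(4) by (rule smult_component[OF _ hc[OF l(1)]])
    then show "x \<in> component M j" using l(2) by simp
  qed
  have GW: "G \<subseteq> W" using smoduleD(4)[OF W hW] by (auto simp: G_def)
  have Gc: "G \<subseteq> carrier M" using GW smoduleD(1)[OF W] by auto
  have finG: "finite G" by (auto simp: G_def E(1))
  have cardG: "card G \<le> (\<Sum>l<r. if \<delta> l \<le> j then card (E (nat (j - \<delta> l))) else 0)"
  proof -
    have "card G \<le> (\<Sum>l\<in>{l. l < r \<and> \<delta> l \<le> j}. card ((\<lambda>e. e \<odot> h l) ` E (nat (j - \<delta> l))))"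
      unfolding G_def by (rule card_UN_le) simp
    also have "\<dots> \<le> (\<Sum>l\<in>{l. l < r \<and> \<delta> l \<le> j}. card (E (nat (j - \<delta> l))))"
      by (intro sum_mono card_image_le E(1))
    also have "\<dots> = (\<Sum>l<r. if \<delta> l \<le> j then card (E (nat (j - \<delta> l))) else 0)"
      by (intro sum.mono_neutral_cong_left) auto
    finally show ?thesis .
  qed
  let ?R = "{u \<oplus> z | u z. u \<in> U \<and> z \<in> kspan G}"
  have Gk: "ksubspace (kspan G)" by (rule kspan_ksubspace[OF Gc])
  have Gkc: "z \<in> carrier M" if "z \<in> kspan G" for z using Gk that by (auto simp: ksubspace_def)
  have R0: "\<zero> \<in> ?R" using c(2) Gk by (auto simp: ksubspace_def intro!: exI[of _ "\<zero>"])
  have Radd: "x \<oplus> y \<in> ?R" if xR: "x \<in> ?R" and yR: "y \<in> ?R" for x y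
  proof -
    obtain u z u' z' where x: "x = u \<oplus> z" "u \<in> U" "z \<in> kspan G" and y: "y = u' \<oplus> z'" "u' \<in> U" "z' \<in> kspan G"
      using xR yR by auto
    have "x \<oplus> y = (u \<oplus> u') \<oplus> (z \<oplus> z')" using x y c(1) Gkc by (simp add: M.a_ac)
    then show ?thesis using c(3)[OF x(2) y(2)] kspan_add[OF Gc x(3) y(3)] by blast
  qed
  have key: "hpart j (p \<odot> h l) \<in> ?R" if l: "l < r" for p l
  proof (cases "\<delta> l \<le> j")
    case True
    obtain a e where ae: "\<forall>x\<in>W. a \<odot> x \<in> U" "e \<in> mpoly_vs.span (E (nat (j - \<delta> l)))" "mpoly_hom_part (nat (j - \<delta> l)) p = a + e"
      using E(3)[OF hom_part_component[of "nat (j - \<delta> l)" p]] by auto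
    have "e \<odot> h l \<in> kspan G"
      using ae(2)
    proof (induction rule: mpoly_vs.span_induct_alt)
      case base
      then show ?case using Gk smult_0_left[OF hcar[OF l]] by (simp add: ksubspace_def)
    next
      case (step q x y)
      have "x \<odot> h l \<in> G" using step(1) l True by (auto simp: G_def)
      then have "x \<odot> h l \<in> kspan G" by (rule kspan_base[OF Gc])
      then have "mpoly_const q \<odot> (x \<odot> h l) \<in> kspan G" using Gk by (simp add: ksubspace_def)
      then show ?case using kspan_add[OF Gc _ step(2)] by (simp add: smult_add_left smult_mult hcar[OF l])
    qed
    moreover have "hpart j (p \<odot> h l) = a \<odot> h l \<oplus> e \<odot> h l"
      using hpart_smult_component[OF hc[OF l], of j p] True ae(3) smult_add_left[OF hcar[OF l]] by simp
    ultimately show ?thesis using ae(1) hW[OF l] by blast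
  next
    case False
    then show ?thesis using hpart_smult_component[OF hc[OF l], of j p] R0 by simp
  qed
  \<comment> \<open>Quantifying over all multiples makes this set a submodule, so only the
    generators have to be checked; \<open>p = 1\<close> gives back the statement about the element
    itself.\<close>
  let ?W' = "{x \<in> carrier M. \<forall>p. hpart j (p \<odot> x) \<in> ?R}"
  have hz: "hpart j \<zero> = \<zero>" using hpart_of_component[OF component_zero, of j j] by simp
  have "smodule ?W'" unfolding smodule_def
  proof (intro conjI ballI allI)
    show "\<zero> \<in> ?W'" using R0 by (simp add: smult_0_right hz)
    show "x \<oplus> y \<in> ?W'" if "x \<in> ?W'" "y \<in> ?W'" for x y
    proof -
      have "hpart j (p \<odot> (x \<oplus> y)) = hpart j (p \<odot> x) \<oplus> hpart j (p \<odot> y)" for p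
        using that by (simp add: smult_add_right hpart_add smult_in_carrier)
      then show ?thesis using that Radd by auto
    qed
    show "q \<odot> x \<in> ?W'" if "x \<in> ?W'" for x q
      using that by (simp add: smult_in_carrier smult_mult[symmetric])
  qed auto
  then have WW: "W \<subseteq> ?W'" unfolding gens by (rule sspan_minimal) (use key hcar in auto)
  have BG: "B \<union> G \<subseteq> carrier M" using BU(2) Gc by auto
  have eq: "component M j \<inter> W = kspan (B \<union> G)"
  proof
    show "component M j \<inter> W \<subseteq> kspan (B \<union> G)"
    proof
      fix x assume x: "x \<in> component M j \<inter> W"
      then have xc: "x \<in> carrier M" using component_carrier by blast
      have "hpart j (1 \<odot> x) \<in> ?R" using WW x by blast
      then have "x \<in> ?R" using x xc hpart_of_component[of x j j] by simp
      then obtain u z where u: "x = u \<oplus> z" "u \<in> U" "z \<in> kspan G" by auto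
      \<comment> \<open>Passing to degree-\<open>j\<close> parts replaces \<open>u\<close> by
        \<open>hpart j u\<close>, which lies in \<open>component M j \<inter> U\<close> and hence in
        the span of \<open>B\<close>.\<close>
      have zj: "z \<in> component M j" using kspan_minimal[OF component_ksubspace G_comp] u(3) by auto
      have "hpart j x = hpart j u \<oplus> hpart j z" unfolding u(1) by (rule hpart_add[OF c(1)[OF u(2)] Gkc[OF u(3)]])
      then have x2: "x = hpart j u \<oplus> z" using x zj hpart_of_component[of _ j j] by auto
      have "hpart j u \<in> component M j \<inter> U" using Us(2)[OF u(2)] hpart_component[OF c(1)[OF u(2)]] by simp
      then have "hpart j u \<in> kspan (B \<union> G)" unfolding BU(3) using kspan_mono[of B "B \<union> G"] BG by auto
      moreover have "z \<in> kspan (B \<union> G)" using kspan_mono[of G "B \<union> G"] BG u(3) by auto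
      ultimately show "x \<in> kspan (B \<union> G)" unfolding x2 by (rule kspan_add[OF BG])
    qed
    have "B \<subseteq> component M j \<inter> U" unfolding BU(3) using kspan_base[OF BU(2)] by auto
    then have "B \<union> G \<subseteq> component M j \<inter> W" using UW G_comp GW by auto
    then show "kspan (B \<union> G) \<subseteq> component M j \<inter> W"
      by (rule kspan_minimal[OF ksubspace_Int[OF component_ksubspace smodule_ksubspace[OF W]]])
  qed
  have "kdim (component M j \<inter> W) \<le> card (B \<union> G)"
    unfolding eq by (rule K.dim_span_le_card) (use BU(1) finG BG in auto)
  also have "\<dots> \<le> card B + card G" by (rule card_Un_le)
  finally show ?thesis using cardG by simp
qed

end


section \<open>Degrees and leading coefficients of polynomials\<close>

lemma poly_eq_sum_le:
  fixes p :: "'a::comm_ring_1 poly"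
  assumes "degree p \<le> N"
  shows "poly p x = (\<Sum>i\<le>N. coeff p i * x ^ i)"
  unfolding poly_altdef using assms
  by (intro sum.mono_neutral_left) (auto simp: coeff_eq_0)

lemma poly_div_power_tendsto:
  fixes p :: "real poly"
  assumes "degree p \<le> N"
  shows "(\<lambda>k. poly p (real k) / real k ^ N) \<longlonglongrightarrow> coeff p N"
proof -
  have trm: "(\<lambda>k. coeff p i * (real k ^ i / real k ^ N)) \<longlonglongrightarrow> (if i = N then coeff p N else 0)" if "i \<le> N" for i
  proof (cases "i = N")
    case True
    have "\<forall>\<^sub>F k in sequentially. coeff p i * (real k ^ i / real k ^ N) = (if i = N then coeff p N else 0)"
      using eventually_gt_at_top[of 0] by eventually_elim (simp add: True)
    then show ?thesis by (rule tendsto_eventually)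
  next
    case False
    then have lt: "0 < N - i" using that by simp
    have "(\<lambda>k. coeff p i * inverse (real k) ^ (N - i)) \<longlonglongrightarrow> coeff p i * 0 ^ (N - i)"
      by (intro tendsto_intros lim_inverse_n)
    then have lim: "(\<lambda>k. coeff p i * inverse (real k) ^ (N - i)) \<longlonglongrightarrow> 0"
      unfolding zero_power[OF lt] by simp
    have "\<forall>\<^sub>F k in sequentially. coeff p i * inverse (real k) ^ (N - i) = coeff p i * (real k ^ i / real k ^ N)"
      using eventually_gt_at_top[of 0]
    proof eventually_elim
      case (elim k)
      have "real k ^ N = real k ^ i * real k ^ (N - i)" using that by (simp add: power_add[symmetric])
      then show ?case using elim by (simp add: field_simps power_inverse)
    qed
    from Lim_transform_eventually[OF lim this] show ?thesis using False by simp
  qed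
  have "(\<lambda>k. \<Sum>i\<le>N. coeff p i * (real k ^ i / real k ^ N)) \<longlonglongrightarrow> (\<Sum>i\<le>N. if i = N then coeff p N else 0)"
    by (intro tendsto_sum trm) simp
  moreover have "(\<Sum>i\<le>N. coeff p i * (real k ^ i / real k ^ N)) = poly p (real k) / real k ^ N" for k
    by (simp add: poly_eq_sum_le[OF assms] sum_divide_distrib)
  ultimately show ?thesis by simp
qed

text \<open>After division by \<open>k ^ degree p\<close> the bound would tend to 0 if
  \<open>n < degree p\<close>, while the left side tends to the absolute value of the leading
  coefficient.\<close>

lemma degree_le_of_bound:
  fixes p B :: "real poly"
  assumes "\<forall>\<^sub>F k in sequentially. \<bar>poly p (real k)\<bar> \<le> poly B (real k)" "degree B \<le> n"
  shows "degree p \<le> n"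
proof (rule ccontr)
  assume n: "\<not> degree p \<le> n"
  let ?N = "degree p"
  have "(\<lambda>k. \<bar>poly p (real k) / real k ^ ?N\<bar>) \<longlonglongrightarrow> \<bar>coeff p ?N\<bar>"
    by (intro tendsto_rabs poly_div_power_tendsto) simp
  moreover have "(\<lambda>k. poly B (real k) / real k ^ ?N) \<longlonglongrightarrow> coeff B ?N"
    using n assms(2) by (intro poly_div_power_tendsto) simp
  moreover have "\<forall>\<^sub>F k in sequentially. \<bar>poly p (real k) / real k ^ ?N\<bar> \<le> poly B (real k) / real k ^ ?N"
    using assms(1) by eventually_elim (simp add: divide_right_mono)
  ultimately have "\<bar>coeff p ?N\<bar> \<le> coeff B ?N" by (intro tendsto_le[of sequentially]) auto
  also have "coeff B ?N = 0" using n assms(2) by (intro coeff_eq_0) simp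
  finally have "p = 0" by simp
  then show False using n by simp
qed

lemma poly_eqI_eventually:
  fixes p q :: "real poly"
  assumes "\<forall>\<^sub>F x in at_top. poly p (real_of_int x) = poly q (real_of_int x)"
  shows "p = q"
proof (rule ccontr)
  assume "p \<noteq> q"
  then have "finite {x. poly (p - q) x = 0}" by (intro poly_roots_finite) simp
  moreover obtain N where N: "\<And>x. x \<ge> N \<Longrightarrow> poly p (real_of_int x) = poly q (real_of_int x)"
    using assms by (auto simp: eventually_at_top_linorder)
  then have "real_of_int ` {N..} \<subseteq> {x. poly (p - q) x = 0}" by auto
  ultimately have "finite (real_of_int ` {N..})" by (rule rev_finite_subset)
  then have "finite {N..}" by (rule finite_imageD) (simp add: inj_on_def)
  then show False by (simp add: infinite_Ici)
qed

text \<open>The outer variable stands for \<open>x\<close>, evaluated at the constant polynomial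
  \<open>[:x:]\<close>, and the coefficients are polynomials in \<open>y\<close>. With
  \<open>x\<close> the degree and \<open>y\<close> the power, \<open>coeff P d\<close> is then the
  polynomial in \<open>k\<close> that determines the multiplicity.\<close>

lemma bipoly_normal_form:
  assumes "bipoly f"
  shows "\<exists>P :: real poly poly. (\<forall>a b. coeff (coeff P a) b \<in> \<rat>) \<and> (\<forall>x y. f x y = poly (poly P [:x:]) y)"
  using assms
proof (induction rule: bipoly.induct)
  case (bipoly_monom c a b)
  then show ?case
    by (intro exI[of _ "monom (monom c b) a"]) (auto simp: poly_monom)
next
  case (bipoly_add f g)
  then obtain P Q where "(\<forall>a b. coeff (coeff P a) b \<in> \<rat>) \<and> (\<forall>x y. f x y = poly (poly P [:x:]) y)"
    "(\<forall>a b. coeff (coeff Q a) b \<in> \<rat>) \<and> (\<forall>x y. g x y = poly (poly Q [:x:]) y)" by blast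
  then show ?case by (intro exI[of _ "P + Q"]) auto
qed

lemma poly_poly_eq_sum:
  fixes P :: "real poly poly"
  shows "poly (poly P [:x:]) y = (\<Sum>a\<le>degree P. poly (coeff P a) y * x ^ a)"
  by (simp add: poly_altdef[of P] poly_sum poly_mult poly_power)

definition eval_coeffs :: "real poly poly \<Rightarrow> real \<Rightarrow> real poly"
  where "eval_coeffs P y = map_poly (\<lambda>q. poly q y) P"

lemma coeff_eval_coeffs: "coeff (eval_coeffs P y) a = poly (coeff P a) y"
  by (simp add: eval_coeffs_def coeff_map_poly)

lemma poly_eval_coeffs: "poly (eval_coeffs P y) x = poly (poly P [:x:]) y"
proof -
  have "degree (eval_coeffs P y) \<le> degree P" 
    by (rule degree_le) (simp add: coeff_eval_coeffs coeff_eq_0)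
  from poly_eq_sum_le[OF this, of x] show ?thesis by (simp add: coeff_eval_coeffs poly_poly_eq_sum)
qed

text \<open>Restricting to the lines \<open>x = \<mu> y\<close> for infinitely many \<open>\<mu>\<close> separates the monomials of a
  given total degree.\<close>

lemma total_degree_le:
  fixes P :: "real poly poly" and W c :: int
  assumes bound: "\<And>k i. k \<ge> K \<Longrightarrow> i \<ge> W * k + c \<Longrightarrow> \<bar>poly (poly P [:real_of_int i:]) (real_of_int k)\<bar> \<le> C * (real_of_int i + e) ^ n"
    and "a + b > n"
  shows "coeff (coeff P a) b = 0"
proof -
  define m where "m = a + b"
  have root: "(\<Sum>a\<le>m. coeff (coeff P a) (m - a) * real_of_int \<mu> ^ a) = 0" if \<mu>: "\<mu> \<ge> max (W + 1) 1" for \<mu>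
  proof -
    \<comment> \<open>\<open>R\<close> is the restriction to the line of slope \<open>\<mu>\<close>.
      As \<open>\<mu> > W\<close>, the line lies in the region once \<open>k\<close> is at least
      \<open>c\<close> and \<open>K\<close>, so \<open>R\<close> has degree at most \<open>n\<close>
      and its coefficient at \<open>m = a + b\<close> vanishes. That coefficient is a polynomial in
      \<open>\<mu>\<close>, called \<open>S\<close> below, with infinitely many zeros.\<close>
    define R where "R = (\<Sum>a\<le>degree P. monom (real_of_int \<mu> ^ a) a * coeff P a)"
    define B where "B = Polynomial.smult C ([:e, real_of_int \<mu>:] ^ n)"
    have R: "poly R y = poly (poly P [:real_of_int \<mu> * y:]) y" for y
      unfolding R_def poly_poly_eq_sum by (simp add: poly_sum poly_monom power_mult_distrib algebra_simps)
    have "degree ([:e, real_of_int \<mu>:] ^ n) \<le> n"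
      using degree_power_le[of "[:e, real_of_int \<mu>:]" n] by (simp add: order_trans)
    then have "degree B \<le> n" unfolding B_def using degree_smult_le order_trans by blast
    moreover have "\<forall>\<^sub>F k in sequentially. \<bar>poly R (real k)\<bar> \<le> poly B (real k)"
      using eventually_ge_at_top[of "nat K + nat c"]
    proof eventually_elim
      case (elim k)
      have "int k \<ge> K" "int k \<ge> c" using elim by linarith+
      moreover have "(W + 1) * int k \<le> \<mu> * int k" using \<mu> by (intro mult_right_mono) auto
      ultimately have "\<mu> * int k \<ge> W * int k + c" by (simp add: algebra_simps)
      from bound[OF \<open>int k \<ge> K\<close> this] show ?case by (simp add: R B_def algebra_simps)
    qed
    ultimately have "degree R \<le> n" using degree_le_of_bound by blast
    then have "coeff R m = 0" using assms(2) by (intro coeff_eq_0) (simp add: m_def)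
    moreover have "coeff R m = (\<Sum>a\<le>degree P. if m < a then 0 else real_of_int \<mu> ^ a * coeff (coeff P a) (m - a))"
      unfolding R_def coeff_sum by (simp add: coeff_monom_mult)
    moreover have "\<dots> = (\<Sum>a\<le>m. coeff (coeff P a) (m - a) * real_of_int \<mu> ^ a)"
    proof -
      have "(\<Sum>a\<le>degree P. if m < a then 0 else real_of_int \<mu> ^ a * coeff (coeff P a) (m - a))
          = (\<Sum>a\<in>{..degree P} \<inter> {..m}. coeff (coeff P a) (m - a) * real_of_int \<mu> ^ a)"
        by (intro sum.mono_neutral_cong_right) (auto simp: mult.commute)
      also have "\<dots> = (\<Sum>a\<le>m. coeff (coeff P a) (m - a) * real_of_int \<mu> ^ a)"
        by (intro sum.mono_neutral_left) (auto simp: coeff_eq_0)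
      finally show ?thesis .
    qed
    ultimately show ?thesis by simp
  qed
  define S where "S = (\<Sum>a\<le>m. monom (coeff (coeff P a) (m - a)) a)"
  have "\<forall>\<^sub>F x in at_top. poly S (real_of_int x) = poly 0 (real_of_int x)"
    using eventually_ge_at_top[of "max (W + 1) 1"]
    by eventually_elim (simp add: S_def poly_sum poly_monom root)
  then have "S = 0" by (rule poly_eqI_eventually)
  then have "coeff S a = 0" by simp
  then show ?thesis by (simp add: S_def coeff_sum m_def)
qed

section \<open>Hilbert coefficients\<close>

text \<open>This is \<open>(x + m) gchoose m\<close> as a polynomial in \<open>x\<close>. There is
  one such polynomial in each degree, so they form a basis, the one in which Hilbert coefficients
  are defined.\<close>

definition binom_poly :: "nat \<Rightarrow> real poly"
  where "binom_poly m = Polynomial.smult (1 / fact m) (\<Prod>i<m. [:real (m - i), 1:])"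

lemma poly_binom_poly: "poly (binom_poly m) x = ((x + real m) gchoose m)"
proof -
  have "poly (binom_poly m) x = (\<Prod>i<m. real (m - i) + x) / fact m"
    by (simp add: binom_poly_def poly_prod)
  also have "(\<Prod>i<m. real (m - i) + x) = (\<Prod>i<m. x + real m - real i)"
    by (intro prod.cong refl) (auto simp: of_nat_diff)
  finally show ?thesis by (simp add: gbinomial_prod_rev atLeast0LessThan)
qed

lemma degree_binom_poly: "degree (binom_poly m) \<le> m" "coeff (binom_poly m) m = 1 / fact m"
proof -
  have prod: "degree (\<Prod>i<l. [:c i, 1:]) \<le> l \<and> coeff (\<Prod>i<l. [:c i, 1:]) l = (1 :: real)" for l and c :: "nat \<Rightarrow> real"
  proof (induction l)
    case (Suc l)
    let ?p = "\<Prod>i<l. [:c i, 1:]"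
    have "degree (?p * [:c l, 1:]) \<le> degree ?p + degree [:c l, 1:]" by (rule degree_mult_le)
    moreover have "coeff (?p * [:c l, 1:]) (Suc l) = 1"
      using Suc coeff_eq_0[of ?p "Suc l"] by (simp add: mult.commute[of ?p])
    ultimately show ?case using Suc by simp
  qed simp
  show "degree (binom_poly m) \<le> m" unfolding binom_poly_def
    using prod[of "\<lambda>i. real (m - i)" m] degree_smult_le order_trans by blast
  show "coeff (binom_poly m) m = 1 / fact m" unfolding binom_poly_def
    using prod[of "\<lambda>i. real (m - i)" m] by simp
qed

definition binom_sum :: "nat \<Rightarrow> (nat \<Rightarrow> real) \<Rightarrow> real poly"
  where "binom_sum m c = (\<Sum>i\<le>m. Polynomial.smult (c i) (binom_poly (m - i)))"

lemma binom_sum_Suc: "binom_sum (Suc m) c = Polynomial.smult (c 0) (binom_poly (Suc m)) + binom_sum m (\<lambda>i. c (Suc i))"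
  by (simp add: binom_sum_def sum.atMost_Suc_shift del: sum.atMost_Suc)

lemma degree_binom_sum: "degree (binom_sum m c) \<le> m"
  unfolding binom_sum_def
proof (rule degree_sum_le)
  show "degree (Polynomial.smult (c i) (binom_poly (m - i))) \<le> m" for i
    using degree_smult_le[of "c i" "binom_poly (m - i)"] degree_binom_poly(1)[of "m - i"] by simp
qed simp

lemma coeff_binom_sum: "coeff (binom_sum m c) m = c 0 / fact m"
proof (cases m)
  case 0
  then show ?thesis using degree_binom_poly(2)[of 0] by (simp add: binom_sum_def)
next
  case (Suc l)
  have "coeff (binom_sum l (\<lambda>i. c (Suc i))) (Suc l) = 0"
    using degree_binom_sum[of l] by (intro coeff_eq_0) (simp add: le_imp_less_Suc)
  then show ?thesis using degree_binom_poly(2)[of m] by (simp add: Suc binom_sum_Suc)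
qed

lemma binom_sum_exists: "degree p \<le> m \<Longrightarrow> \<exists>c. p = binom_sum m c"
proof (induction m arbitrary: p)
  case 0
  then have "p = [:coeff p 0:]" by (metis degree_0_id le_zero_eq)
  moreover have "binom_sum 0 (\<lambda>_. coeff p 0) = [:coeff p 0:]" by (simp add: binom_sum_def binom_poly_def)
  ultimately show ?case by metis
next
  case (Suc m)
  define q where "q = p - Polynomial.smult (fact (Suc m) * coeff p (Suc m)) (binom_poly (Suc m))"
  have "degree q \<le> Suc m" unfolding q_def
    using Suc.prems degree_binom_poly(1)[of "Suc m"] degree_smult_le order_trans by (intro degree_diff_le) blast+
  moreover have "coeff q (Suc m) = 0" using degree_binom_poly(2)[of "Suc m"] by (simp add: q_def)
  ultimately have "degree q \<le> m"
    by (metis le_SucE leading_coeff_0_iff degree_0 le0)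
  then obtain c where c: "q = binom_sum m c" using Suc.IH by blast
  have "p = binom_sum (Suc m) (case_nat (fact (Suc m) * coeff p (Suc m)) c)"
    unfolding binom_sum_Suc using c by (simp add: q_def)
  then show ?case by blast
qed

lemma binom_sum_inj: "binom_sum m c = binom_sum m c' \<Longrightarrow> i \<le> m \<Longrightarrow> c i = c' i"
proof (induction m arbitrary: c c' i)
  case 0
  then show ?case using coeff_binom_sum[of 0 c] coeff_binom_sum[of 0 c'] by simp
next
  case (Suc m)
  have c0: "c 0 = c' 0" using coeff_binom_sum[of "Suc m" c] coeff_binom_sum[of "Suc m" c'] Suc.prems(1) by simp
  then have "binom_sum m (\<lambda>i. c (Suc i)) = binom_sum m (\<lambda>i. c' (Suc i))"
    using Suc.prems(1) by (simp add: binom_sum_Suc)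
  then show ?case using Suc.IH[of "\<lambda>i. c (Suc i)" "\<lambda>i. c' (Suc i)" "i - 1"] c0 Suc.prems(2) by (cases i) auto
qed

lemma hilbert_coeff_sum_eq:
  "(\<Sum>i<Suc m. (-1) ^ i * e i * ((of_int x + of_int (int m) - of_nat i) gchoose nat (int m - int i)))
    = poly (binom_sum m (\<lambda>i. (-1) ^ i * e i)) (real_of_int x)"
proof -
  have tm: "(-1) ^ i * e i * ((real_of_int x + of_int (int m) - of_nat i) gchoose nat (int m - int i))
      = (-1) ^ i * e i * poly (binom_poly (m - i)) (real_of_int x)" if "i \<le> m" for i
  proof -
    have "nat (int m - int i) = m - i" by simp
    moreover have "real_of_int x + of_int (int m) - of_nat i = real_of_int x + real (m - i)"
      using that by (simp add: of_nat_diff)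
    ultimately show ?thesis by (simp only: poly_binom_poly)
  qed
  show ?thesis unfolding binom_sum_def lessThan_Suc_atMost poly_sum
    by (intro sum.cong refl) (simp only: tm poly_smult atMost_iff)
qed

text \<open>Existence and uniqueness of the Hilbert coefficients are those of the expansion of
  \<open>p\<close> in the binomial basis, for which \<open>degree p \<le> m\<close> is enough; the
  coefficient at \<open>m\<close> may be zero. The factor \<open>fact m\<close> inverts the leading
  coefficient of \<open>binom_poly m\<close>.\<close>

theorem multiplicity_module_eq:
  assumes p: "\<forall>\<^sub>F x in at_top. real (hilbert_sum X x) = poly p (real_of_int x)"
    and dim: "module_dim \<S> X = int m" and deg: "degree p \<le> m"
  shows "multiplicity_module X = fact m * coeff p m"
proof -
  have iff: "is_hilbert_coeffs X e \<longleftrightarrow> (\<forall>i>m. e i = 0) \<and> p = binom_sum m (\<lambda>i. (-1) ^ i * e i)" for e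
  proof -
    have m: "nat (int m + 1) = Suc m" by simp
    have "is_hilbert_coeffs X e \<longleftrightarrow> (\<forall>i>m. e i = 0) \<and>
      (\<forall>\<^sub>F x in at_top. real (hilbert_sum X x) = poly (binom_sum m (\<lambda>i. (-1) ^ i * e i)) (real_of_int x))"
      unfolding is_hilbert_coeffs_def Let_def dim m hilbert_coeff_sum_eq by simp
    also have "(\<forall>\<^sub>F x in at_top. real (hilbert_sum X x) = poly (binom_sum m (\<lambda>i. (-1) ^ i * e i)) (real_of_int x))
        \<longleftrightarrow> p = binom_sum m (\<lambda>i. (-1) ^ i * e i)"
    proof
      assume "\<forall>\<^sub>F x in at_top. real (hilbert_sum X x) = poly (binom_sum m (\<lambda>i. (-1) ^ i * e i)) (real_of_int x)"
      then have "\<forall>\<^sub>F x in at_top. poly p (real_of_int x) = poly (binom_sum m (\<lambda>i. (-1) ^ i * e i)) (real_of_int x)"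
        using p by eventually_elim simp
      then show "p = binom_sum m (\<lambda>i. (-1) ^ i * e i)" by (rule poly_eqI_eventually)
    qed (use p in simp)
    finally show ?thesis .
  qed
  obtain c where c: "p = binom_sum m c" using binom_sum_exists[OF deg] by blast
  define e where "e i = (if i \<le> m then (-1) ^ i * c i else 0)" for i
  have sg: "(-1) ^ i * ((-1) ^ i * x) = (x :: real)" for i x
    by (simp add: power_add[symmetric] mult.assoc[symmetric] power_mult_distrib[symmetric])
  have "p = binom_sum m (\<lambda>i. (-1) ^ i * e i)"
    unfolding c binom_sum_def by (intro sum.cong refl) (simp add: e_def sg)
  then have e: "is_hilbert_coeffs X e" using iff by (simp add: e_def)
  have uniq: "e' = e" if "is_hilbert_coeffs X e'" for e'
  proof
    fix i
    have h: "\<forall>i>m. e' i = 0" "binom_sum m c = binom_sum m (\<lambda>i. (-1) ^ i * e' i)" using that iff c by auto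
    show "e' i = e i"
    proof (cases "i \<le> m")
      case True
      have "c i = (-1) ^ i * e' i" using binom_sum_inj[OF h(2) True] .
      then show ?thesis using True by (simp add: e_def sg)
    next
      case False
      then show ?thesis using h(1) by (simp add: e_def)
    qed
  qed
  have "hilbert_coeff X = e" unfolding hilbert_coeff_def using e uniq by (rule the_equality)
  then show ?thesis using coeff_binom_sum[of m c] by (simp add: multiplicity_module_def e_def c)
qed

text \<open>In dimension -1 the defining sum is empty and every coefficient is required to be zero,
  so the zero sequence is the only candidate; the vanishing Hilbert sum makes it one.\<close>

lemma multiplicity_module_zero:
  assumes "\<forall>\<^sub>F x in at_top. hilbert_sum X x = 0" "module_dim \<S> X = -1"
  shows "multiplicity_module X = 0"
proof -
  have "is_hilbert_coeffs X e \<longleftrightarrow> e = (\<lambda>_. 0)" for e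
  proof -
    have "\<forall>\<^sub>F x in at_top. real (hilbert_sum X x) = 0" using assms(1) by eventually_elim simp
    then show ?thesis by (auto simp: is_hilbert_coeffs_def assms(2) fun_eq_iff)
  qed
  then show ?thesis by (simp add: multiplicity_module_def hilbert_coeff_def)
qed


section \<open>The limit of the multiplicities\<close>

context rees_data
begin

lemma ideal_smult_smodule: "smodule (ideal_smult (ideal_power I k) M N)"
  unfolding ideal_smult_eq by (rule kspan_expos_smodule)

lemma ideal_smult_graded: "graded (ideal_smult (ideal_power I k) M N)"
  unfolding graded_def
proof (intro conjI ballI allI)
  show "smodule (ideal_smult (ideal_power I k) M N)" by (rule ideal_smult_smodule)
  show "hpart j x \<in> ideal_smult (ideal_power I k) M N" if "x \<in> ideal_smult (ideal_power I k) M N" for x j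
    using that hpart_kspan[of x k j] kspan_hexpos_subset unfolding ideal_smult_eq by auto
qed

text \<open>The exact cardinality matters: it cancels against \<open>kdim\<close> when the dimension
  of the quotient is isolated in \<open>hilbert_sum_quotient_growth\<close>.\<close>

lemma component_basis:
  "\<exists>B. finite B \<and> B \<subseteq> carrier M \<and> component M j \<inter> ideal_smult (ideal_power I k) M N = kspan B \<and>
    card B = kdim (component M j \<inter> ideal_smult (ideal_power I k) M N)"
proof -
  let ?S = "{v \<in> hexpos k j. \<phi> v \<notin> kspan (\<phi> ` {u \<in> hexpos k j. u < v})}"
  have car: "\<phi> ` hexpos k j \<subseteq> carrier (kspace M)" using hexpos_image_carrier by simp
  have g: "inj_on \<phi> ?S" "kspan (\<phi> ` ?S) = kspan (\<phi> ` hexpos k j)"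
    using K.greedy_basis[OF finite_hexpos car] by auto
  have "kdim (kspan (\<phi> ` hexpos k j)) = card ?S" by (rule K.greedy_dim[OF finite_hexpos car])
  then have "card (\<phi> ` ?S) = kdim (component M j \<inter> ideal_smult (ideal_power I k) M N)"
    unfolding ideal_smult_eq component_kspan card_image[OF g(1)] by simp
  moreover have "component M j \<inter> ideal_smult (ideal_power I k) M N = kspan (\<phi> ` ?S)"
    unfolding ideal_smult_eq component_kspan g(2) ..
  moreover have "finite (\<phi> ` ?S)" "\<phi> ` ?S \<subseteq> carrier M"
    using finite_hexpos[of k j] hexpos_image_carrier[of k j] by auto
  ultimately show ?thesis by (intro exI[of _ "\<phi> ` ?S"]) simp
qed

lemma kdim_eq_0:
  assumes "\<And>l. l < r \<Longrightarrow> j < \<delta> l"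
  shows "kdim (component M j \<inter> ideal_smult (ideal_power I k) M N) = 0"
proof -
  have "hexpos k j = {}" using assms by (force simp: hexpos_def expos_def deg_def)
  then show ?thesis by (simp add: kdim_eq_card_standard)
qed

lemma asymp_bipoly_hilbert:
  assumes "0 \<le> W" "\<And>j. j < m \<Longrightarrow> int (d j) \<le> W"
  shows "asymp_bipoly W (\<lambda>i k. \<Sum>l<r. card (bidegree_set \<omega> \<kappa> nv (standard_slice l) (i - \<delta> l) k))"
proof (rule asymp_bipoly_sum)
  fix l assume "l \<in> {..<r}"
  then have "asymp_bipoly W (\<lambda>i k. card (bidegree_set \<omega> \<kappa> nv (standard_slice l) i k))"
    using assms by (intro asymp_bipoly_card[of "CARD('n)"] downclosed_standard_slice) (auto simp: \<omega>_def \<kappa>_def nv_def)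
  from asymp_bipoly_shift[OF this assms(1), of 0 "\<delta> l"]
  show "asymp_bipoly W (\<lambda>i k. card (bidegree_set \<omega> \<kappa> nv (standard_slice l) (i - \<delta> l) k))" by simp
qed

end

text \<open>The dimension is the length of a chain, one less than the number of its members, whence
  \<open>d + 1\<close>.\<close>

lemma module_dim_prime_chain:
  assumes "module_dim \<S> X = d" "prime_chain (annihilator \<S> X) C"
  shows "card C \<le> nat (d + 1)"
proof -
  let ?T = "{card C | C. finite C \<and> subset.chain {P. primeideal P \<S> \<and> annihilator \<S> X \<subseteq> P} C}"
  have "bdd_above ?T" using prime_chain_card_le by (intro bdd_aboveI) blast
  moreover have "card C \<in> ?T" using assms(2) by blast
  ultimately have "card C \<le> Sup ?T" by (intro cSup_upper)
  then show ?thesis using assms(1) unfolding module_dim_def by linarith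
qed

lemma module_dim_ge: "module_dim \<S> X \<ge> -1"
  by (simp add: module_dim_def)

lemma growth_bound_mono: "i \<le> j \<Longrightarrow> growth_bound D i \<le> growth_bound D j"
  by (simp add: growth_bound_def power_mono)

context graded_module
begin

lemma ideal_smult_power_0: "ideal_smult (ideal_power I 0) M (carrier M) = carrier M"
proof -
  let ?G = "{p \<odot> x | p x. p \<in> ideal_power I 0 \<and> x \<in> carrier M}"
  have sub: "?G \<subseteq> carrier M" using smult_in_carrier by auto
  have "x \<in> ?G" if "x \<in> carrier M" for x
    unfolding ideal_power_0 using that by (intro CollectI exI[of _ 1] exI[of _ x]) simp
  then have "carrier M \<subseteq> sspan ?G" using sspan_base[OF sub] by blast
  moreover have "sspan ?G \<subseteq> carrier M" by (rule sspan_minimal[OF smodule_carrier sub])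
  ultimately show ?thesis unfolding ideal_smult_def by (rule equalityI[rotated])
qed

lemma exists_rees_data:
  assumes "fin_gen_module M" "graded_ideal I" "graded N"
  shows "\<exists>f m d h \<delta> r. rees_data M I N f m d h \<delta> r"
proof -
  obtain F where F: "finite F" "F \<subseteq> I" "\<forall>f\<in>F. \<exists>d. f \<in> mpoly_hom_component d" "I = Idl\<^bsub>\<S>\<^esub> F"
    using graded_ideal_homogeneous_generators[OF assms(2)] by (elim exE conjE)
  obtain \<epsilon> where \<epsilon>: "\<forall>f\<in>F. f \<in> mpoly_hom_component (\<epsilon> f)" using bchoice[OF F(3)] by (elim exE)
  obtain f where f: "bij_betw f {0..<card F} F" using ex_bij_betw_nat_finite[OF F(1)] by (elim exE)
  then have fF: "f ` {..<card F} = F" by (auto simp: bij_betw_def atLeast0LessThan)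
  obtain r :: nat and h \<delta> where h: "\<And>l. l < r \<Longrightarrow> h l \<in> component M (\<delta> l)" "N = sspan (h ` {..<r})"
    using graded_homogeneous_generators[OF assms(1,3)] by metis
  have "rees_data M I N f (card F) (\<lambda>j. \<epsilon> (f j)) h \<delta> r"
  proof unfold_locales
    show "I = Idl\<^bsub>\<S>\<^esub> (f ` {..<card F})" unfolding fF by (rule F(4))
    show "f j \<in> mpoly_hom_component (\<epsilon> (f j))" if "j < card F" for j
    proof -
      have "f j \<in> F" using fF that by auto
      then show ?thesis using \<epsilon> by simp
    qed
    show "N = sspan (h ` {..<r})" by (rule h(2))
    show "h l \<in> component M (\<delta> l)" if "l < r" for l by (rule h(1)[OF that])
  qed
  then show ?thesis by (intro exI)
qed

text \<open>The growth witness for the annihilator is copied once for each homogeneous generator of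
  \<open>W\<close>, shifted by the degree of the generator. The constant \<open>c\<close> absorbs
  these shifts and \<open>C\<close> the number of generators.\<close>

lemma hilbert_sum_quotient_growth:
  assumes fg: "fin_gen_module M" and U: "graded U" and W: "graded W" and UW: "U \<subseteq> W"
    and basis: "\<And>j. \<exists>B. finite B \<and> B \<subseteq> carrier M \<and> component M j \<inter> U = kspan B \<and> card B = kdim (component M j \<inter> U)"
    and dimq: "\<And>j. component_dim (quotient W U) j + kdim (component M j \<inter> U) = kdim (component M j \<inter> W)"
    and hs: "\<And>i. hilbert_sum (quotient W U) i = (\<Sum>j\<in>{j0..i}. component_dim (quotient W U) j)"
    and dim: "module_dim \<S> (quotient W U) = d"
  shows "\<exists>C c. \<forall>i. hilbert_sum (quotient W U) i \<le> C * growth_bound (nat (d + 1)) (nat i + c)"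
proof -
  have Ws: "smodule W" and Us: "smodule U" using U W by (auto simp: graded_def)
  obtain r :: nat and h \<delta> where h: "\<And>l. l < r \<Longrightarrow> h l \<in> component M (\<delta> l)" "W = sspan (h ` {..<r})"
    using graded_homogeneous_generators[OF fg W] by metis
  let ?A = "{p. \<forall>x\<in>W. p \<odot> x \<in> U}" and ?D = "nat (d + 1)"
  have ann: "annihilator \<S> (quotient W U) = ?A" by (rule annihilator_quotient[OF Us Ws])
  have "graded_ideal ?A" by (rule graded_annihilator[OF U Ws h(2,1)])
  moreover have "card C \<le> ?D" if "prime_chain ?A C" for C
    by (rule module_dim_prime_chain[OF dim]) (use that ann in simp)
  ultimately have "growth_bounded ?A ?D" by (rule prime_chain_growth)
  then obtain E C where "growth_witness ?A ?D E C" unfolding growth_bounded_def by (elim exE)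
  note E = growth_witnessD[OF this]
  define e where "e l j = (if \<delta> l \<le> j then card (E (nat (j - \<delta> l))) else 0)" for l j
  have cd: "component_dim (quotient W U) j \<le> (\<Sum>l<r. e l j)" for j
  proof -
    obtain B where B: "finite B" "B \<subseteq> carrier M" "component M j \<inter> U = kspan B" "card B = kdim (component M j \<inter> U)"
      using basis[of j] by (elim exE conjE)
    have "kdim (component M j \<inter> W) \<le> card B + (\<Sum>l<r. e l j)"
      unfolding e_def by (rule quotient_dim_le[OF U Ws UW h(2,1) E(1-3) B(1-3)])
    then show ?thesis using dimq[of j] B(4) by simp
  qed
  define c where "c = (\<Sum>l<r. nat \<bar>\<delta> l\<bar>)"
  have el: "(\<Sum>j\<in>{j0..i}. e l j) \<le> C * growth_bound ?D (nat i + c)" if "l < r" for l i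
  proof -
    have "(\<Sum>j\<in>{j0..i}. e l j) = (\<Sum>j\<in>{j \<in> {j0..i}. \<delta> l \<le> j}. card (E (nat (j - \<delta> l))))"
      by (intro sum.mono_neutral_cong_right) (auto simp: e_def)
    also have "\<dots> = (\<Sum>t\<in>(\<lambda>j. nat (j - \<delta> l)) ` {j \<in> {j0..i}. \<delta> l \<le> j}. card (E t))"
      by (subst sum.reindex) (auto simp: inj_on_def)
    also have "\<dots> \<le> (\<Sum>t\<le>nat (i - \<delta> l). card (E t))"
      by (intro sum_mono2) (auto intro: nat_mono)
    also have "\<dots> \<le> C * growth_bound ?D (nat (i - \<delta> l))" by (rule E(4))
    also have "\<dots> \<le> C * growth_bound ?D (nat i + c)"
    proof (intro mult_left_mono growth_bound_mono)
      have "nat \<bar>\<delta> l\<bar> \<le> c" unfolding c_def using that by (intro member_le_sum) auto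
      then show "nat (i - \<delta> l) \<le> nat i + c" by linarith
    qed simp
    finally show ?thesis .
  qed
  have "hilbert_sum (quotient W U) i \<le> (r * C) * growth_bound ?D (nat i + c)" for i
  proof -
    have "hilbert_sum (quotient W U) i \<le> (\<Sum>j\<in>{j0..i}. \<Sum>l<r. e l j)" unfolding hs by (intro sum_mono cd)
    also have "\<dots> = (\<Sum>l<r. \<Sum>j\<in>{j0..i}. e l j)" by (rule sum.swap)
    also have "\<dots> \<le> (\<Sum>l<r. C * growth_bound ?D (nat i + c))" by (intro sum_mono el) simp
    finally show ?thesis by (simp add: mult.assoc)
  qed
  then show ?thesis by blast
qed

text \<open>The constants do not depend on the lower limit \<open>j0\<close>, so the bound covers
  the Hilbert sums of all quotients of submodules of \<open>M\<close> simultaneously.\<close>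

lemma sum_kdim_component_le:
  assumes "fin_gen_module M"
  shows "\<exists>C c. \<forall>j0 i. 0 \<le> i \<longrightarrow> (\<Sum>j\<in>{j0..i}. kdim (component M j)) \<le> C * (nat i + c) ^ CARD('n)"
proof -
  obtain r :: nat and h \<delta> where h: "\<And>l. l < r \<Longrightarrow> h l \<in> component M (\<delta> l)" "carrier M = sspan (h ` {..<r})"
    using graded_homogeneous_generators[OF assms graded_carrier] by metis
  \<comment> \<open>With no ideal generators and the power 0 the Rees data describe \<open>M\<close>
    itself. Only the \<open>n\<close> variables remain as factors, which gives the exponent
    \<open>n\<close>.\<close>
  interpret Z: rees_data M "Idl\<^bsub>\<S>\<^esub> {}" "carrier M" "\<lambda>_. 0" 0 "\<lambda>_. 0" h \<delta> r
    by unfold_locales (use h in auto)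
  let ?W = "ideal_smult (ideal_power (Idl\<^bsub>\<S>\<^esub> {}) 0) M (carrier M)"
  have W: "?W = carrier M" by (rule ideal_smult_power_0)
  have eq: "component M j \<inter> ?W = component M j" for j unfolding W using component_carrier by auto
  define c where "c = Suc (\<Sum>l<r. nat \<bar>\<delta> l\<bar>)"
  have bound: "(\<Sum>j\<in>{j0..i}. kdim (component M j)) \<le> r * (nat i + c) ^ CARD('n)" if "0 \<le> i" for j0 i
  proof -
    \<comment> \<open>Lowering the start of the interval below all generator degrees only enlarges
      the sum and meets the requirement of \<open>sum_kdim\<close>.\<close>
    define j1 where "j1 = Min (insert j0 (\<delta> ` {..<r}))"
    have j1: "j1 \<le> j0" "\<And>l. l < r \<Longrightarrow> j1 \<le> \<delta> l" by (auto simp: j1_def)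
    have "(\<Sum>j\<in>{j0..i}. kdim (component M j)) \<le> (\<Sum>j\<in>{j1..i}. kdim (component M j))"
      using j1(1) by (intro sum_mono2) auto
    also have "\<dots> = (\<Sum>l<r. card (bidegree_set Z.\<omega> Z.\<kappa> Z.nv (Z.standard_slice l) (i - \<delta> l) (int 0)))"
      using Z.sum_kdim[OF j1(2), where i = i and k = 0] unfolding eq by simp
    also have "\<dots> \<le> (\<Sum>l<r. (nat i + c) ^ CARD('n))"
    proof (rule sum_mono)
      fix l assume l: "l \<in> {..<r}"
      have nv: "Z.nv = CARD('n)" by (simp add: Z.nv_def)
      have "card (bidegree_set Z.\<omega> Z.\<kappa> Z.nv (Z.standard_slice l) (i - \<delta> l) (int 0)) \<le> nat (i - \<delta> l + 1) ^ CARD('n)"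
        unfolding nv by (rule card_bidegree_set_le) (simp add: Z.\<omega>_def Z.\<kappa>_def)
      also have "\<dots> \<le> (nat i + c) ^ CARD('n)"
      proof (rule power_mono)
        have "nat \<bar>\<delta> l\<bar> \<le> (\<Sum>l<r. nat \<bar>\<delta> l\<bar>)" using l by (intro member_le_sum) auto
        then show "nat (i - \<delta> l + 1) \<le> nat i + c" using that unfolding c_def by linarith
      qed simp
      finally show "card (bidegree_set Z.\<omega> Z.\<kappa> Z.nv (Z.standard_slice l) (i - \<delta> l) (int 0)) \<le> (nat i + c) ^ CARD('n)" .
    qed
    finally show ?thesis by simp
  qed
  then show ?thesis by blast
qed

text \<open>The constants \<open>C\<close> and \<open>e\<close> of the first bound are independent
  of \<open>k\<close>, as needed to limit the total degree of \<open>f\<close>. Those of the second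
  bound may vary with \<open>k\<close>, since it only limits the degree in \<open>i\<close> for one
  fixed \<open>k\<close>.\<close>

theorem hilbert_sum_power_quotient:
  fixes I J :: "('n, 'k) mpoly set" and N :: "'m set"
  assumes I: "graded_ideal I" and J: "graded_ideal J" and JI: "J \<subseteq> I" and fg: "fin_gen_module M" and N: "graded N"
  shows "\<exists>f W c K C e. bipoly f \<and>
      (\<forall>k i. k \<ge> K \<longrightarrow> i \<ge> W * int k + c \<longrightarrow> real (hilbert_sum (power_quotient I J M N k) i) = f (real_of_int i) (real k)) \<and>
      (\<forall>k i. 0 \<le> i \<longrightarrow> hilbert_sum (power_quotient I J M N k) i \<le> C * (nat i + e) ^ CARD('n)) \<and>
      (\<forall>k d. module_dim \<S> (power_quotient I J M N k) = d \<longrightarrow>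
        (\<exists>C c. \<forall>i. hilbert_sum (power_quotient I J M N k) i \<le> C * growth_bound (nat (d + 1)) (nat i + c)))"
proof -
  obtain f1 m1 d1 h1 \<delta>1 r1 where "rees_data M I (carrier M) f1 m1 d1 h1 \<delta>1 r1"
    using exists_rees_data[OF fg I graded_carrier] by (elim exE)
  then interpret A: rees_data M I "carrier M" f1 m1 d1 h1 \<delta>1 r1 .
  obtain f2 m2 d2 h2 \<delta>2 r2 where "rees_data M J N f2 m2 d2 h2 \<delta>2 r2"
    using exists_rees_data[OF fg J N] by (elim exE)
  then interpret B: rees_data M J N f2 m2 d2 h2 \<delta>2 r2 .
  define W where "W k = ideal_smult (ideal_power I k) M (carrier M)" for k
  define U where "U k = ideal_smult (ideal_power J k) M N" for k
  let ?Q = "\<lambda>k. quotient (W k) (U k)"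
  have Q: "power_quotient I J M N k = ?Q k" for k by (simp add: power_quotient_def W_def U_def)
  have Ns: "smodule N" using N by (simp add: graded_def)
  have Wg: "graded (W k)" and Ug: "graded (U k)" and Ws: "smodule (W k)" and Us: "smodule (U k)" for k
    unfolding W_def U_def
    by (rule A.ideal_smult_graded B.ideal_smult_graded A.ideal_smult_smodule B.ideal_smult_smodule)+
  have UW: "U k \<subseteq> W k" for k
  proof -
    have "{p \<odot> x | p x. p \<in> ideal_power J k \<and> x \<in> N} \<subseteq> {p \<odot> x | p x. p \<in> ideal_power I k \<and> x \<in> carrier M}"
      using ideal_power_mono[OF JI, of k] smoduleD(1)[OF Ns] by auto
    then show ?thesis unfolding U_def W_def ideal_smult_def
      by (rule sspan_mono) (use smult_in_carrier in auto)
  qed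
  have finW: "vectorspace.fin_dim class_ring ((kspace M)\<lparr>carrier := component M j \<inter> W k\<rparr>)" for j k
    unfolding W_def by (rule A.fin_dim_component)
  have qd: "component_dim (?Q k) j + kdim (component M j \<inter> U k) = kdim (component M j \<inter> W k)" for k j
    by (rule quotient_dim[OF Us Ws UW finW])
  \<comment> \<open>A common lower bound for the generator degrees on both sides; the inserted 0
    keeps the set non-empty when there are no generators.\<close>
  define j0 where "j0 = Min (insert 0 (\<delta>1 ` {..<r1} \<union> \<delta>2 ` {..<r2}))"
  have j0: "\<And>l. l < r1 \<Longrightarrow> j0 \<le> \<delta>1 l" "\<And>l. l < r2 \<Longrightarrow> j0 \<le> \<delta>2 l" by (auto simp: j0_def)
  have Wz: "component_dim (?Q k) j = 0" if "j < j0" for k j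
  proof -
    have "kdim (component M j \<inter> W k) = 0" unfolding W_def
      by (rule A.kdim_eq_0) (use j0(1) that in fastforce)
    then show ?thesis using qd[of k j] by simp
  qed
  have hs: "hilbert_sum (?Q k) i = (\<Sum>j\<in>{j0..i}. component_dim (?Q k) j)" for k i
    unfolding hilbert_sum_def using Wz by (intro sum.mono_neutral_left) (auto intro!: leI)
  define H1 where "H1 i k = (\<Sum>l<r1. card (bidegree_set A.\<omega> A.\<kappa> A.nv (A.standard_slice l) (i - \<delta>1 l) k))" for i k
  define H2 where "H2 i k = (\<Sum>l<r2. card (bidegree_set B.\<omega> B.\<kappa> B.nv (B.standard_slice l) (i - \<delta>2 l) k))" for i k
  have sums: "hilbert_sum (?Q k) i + H2 i (int k) = H1 i (int k)" for k i
  proof -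
    have "H1 i (int k) = (\<Sum>j\<in>{j0..i}. kdim (component M j \<inter> W k))"
      unfolding H1_def W_def by (rule A.sum_kdim[OF j0(1), symmetric])
    moreover have "H2 i (int k) = (\<Sum>j\<in>{j0..i}. kdim (component M j \<inter> U k))"
      unfolding H2_def U_def by (rule B.sum_kdim[OF j0(2), symmetric])
    ultimately show ?thesis unfolding hs by (simp add: sum.distrib[symmetric] qd)
  qed
  \<comment> \<open>The two counts are subtracted, so they need a common region. The sum of all
    generator degrees bounds each of them and serves as its slope.\<close>
  define V where "V = int ((\<Sum>j<m1. d1 j) + (\<Sum>j<m2. d2 j))"
  have V0: "0 \<le> V" unfolding V_def by (rule of_nat_0_le_iff)
  have V1: "int (d1 j) \<le> V" if "j < m1" for j
    using member_le_sum[of j "{..<m1}" d1] that unfolding V_def by (simp only: of_nat_le_iff lessThan_iff) simp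
  have V2: "int (d2 j) \<le> V" if "j < m2" for j
    using member_le_sum[of j "{..<m2}" d2] that unfolding V_def by (simp only: of_nat_le_iff lessThan_iff) simp
  have "asymp_bipoly V H1" unfolding H1_def by (rule A.asymp_bipoly_hilbert) (use V0 V1 in auto)
  then obtain k1 c1 P1 where P1: "bipoly P1"
    "\<forall>k\<ge>k1. \<forall>i\<ge>V * k + c1. real (H1 i k) = P1 (real_of_int i) (real_of_int k)"
    unfolding asymp_bipoly_def by (elim exE conjE)
  have "asymp_bipoly V H2" unfolding H2_def by (rule B.asymp_bipoly_hilbert) (use V0 V2 in auto)
  then obtain k2 c2 P2 where P2: "bipoly P2"
    "\<forall>k\<ge>k2. \<forall>i\<ge>V * k + c2. real (H2 i k) = P2 (real_of_int i) (real_of_int k)"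
    unfolding asymp_bipoly_def by (elim exE conjE)
  define f where "f x y = P1 x y - P2 x y" for x y
  have "bipoly f" unfolding f_def by (rule bipoly_diff[OF P1(1) P2(1)])
  moreover have "real (hilbert_sum (?Q k) i) = f (real_of_int i) (real k)"
    if "k \<ge> nat k1 + nat k2" "i \<ge> V * int k + max c1 c2" for k i
  proof -
    have k: "int k \<ge> k1" "int k \<ge> k2" using that(1) by linarith+
    have "real (H1 i (int k)) = P1 (real_of_int i) (real k)" using P1(2) k(1) that(2) by fastforce
    moreover have "real (H2 i (int k)) = P2 (real_of_int i) (real k)" using P2(2) k(2) that(2) by fastforce
    moreover have "real (hilbert_sum (?Q k) i) + real (H2 i (int k)) = real (H1 i (int k))"
      using sums[of k i] by linarith
    ultimately show ?thesis by (simp add: f_def)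
  qed
  moreover obtain C e where Ce: "\<forall>j0 i. 0 \<le> i \<longrightarrow> (\<Sum>j\<in>{j0..i}. kdim (component M j)) \<le> C * (nat i + e) ^ CARD('n)"
    using sum_kdim_component_le[OF fg] by (elim exE)
  moreover have "hilbert_sum (?Q k) i \<le> C * (nat i + e) ^ CARD('n)" if "0 \<le> i" for k i
  proof -
    have le: "component_dim (?Q k) j \<le> kdim (component M j)" for j
    proof -
      have W0: "component M j \<inter> carrier M = component M j" using component_carrier by auto
      have car: "W 0 = carrier M" unfolding W_def by (rule ideal_smult_power_0)
      \<comment> \<open>The dimension formula for the quotient of \<open>M = W 0\<close> by
        \<open>W k\<close> shows that the degree-\<open>j\<close> part of \<open>W k\<close> has
        dimension at most that of \<open>component M j\<close>.\<close>
      have "component_dim (quotient (W 0) (W k)) j + kdim (component M j \<inter> W k) = kdim (component M j \<inter> W 0)"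
        by (rule quotient_dim[OF Ws Ws _ finW]) (use car smoduleD(1)[OF Ws] in auto)
      then show ?thesis using qd[of k j] W0 car by simp
    qed
    have "hilbert_sum (?Q k) i \<le> (\<Sum>j\<in>{j0..i}. kdim (component M j))" unfolding hs by (intro sum_mono le)
    also have "\<dots> \<le> C * (nat i + e) ^ CARD('n)" using Ce that by simp
    finally show ?thesis .
  qed
  moreover have "\<exists>C c. \<forall>i. hilbert_sum (?Q k) i \<le> C * growth_bound (nat (d + 1)) (nat i + c)"
    if "module_dim \<S> (?Q k) = d" for k d
  proof (rule hilbert_sum_quotient_growth[OF fg Ug Wg UW _ qd hs that])
    show "\<exists>B. finite B \<and> B \<subseteq> carrier M \<and> component M j \<inter> U k = kspan B \<and> card B = kdim (component M j \<inter> U k)" for j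
      unfolding U_def by (rule B.component_basis)
  qed
  ultimately show ?thesis unfolding Q
    by (intro exI[of _ f] exI[of _ V] exI[of _ "max c1 c2"] exI[of _ "nat k1 + nat k2"] exI[of _ C] exI[of _ e]) simp
qed

end


theorem proposition2p1:
  fixes M :: "(('n::finite, 'k::field) mpoly, 'm) graded_module"
    and I J :: "('n, 'k) mpoly set"
    and N :: "'m set"
    and d :: int
  assumes "graded_ideal I" and "graded_ideal J" and "J \<subseteq> I"
    and "graded_module M" and "fin_gen_module M"
    and "graded_submodule N M"
    and "has_limit_dimension (power_quotient I J M N) d"
  shows "\<exists>L\<in>\<rat>. (\<lambda>k. multiplicity_module (power_quotient I J M N k)
                     / real k powi (int CARD('n) - d)) \<longlonglongrightarrow> L"
proof -
  interpret graded_module M by fact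
  let ?Q = "power_quotient I J M N" and ?n = "CARD('n)"
  have N: "graded N" using assms(6) by (simp add: graded_submodule_iff)
  obtain f W c K C e where f: "bipoly f"
      "\<forall>k i. k \<ge> K \<longrightarrow> i \<ge> W * int k + c \<longrightarrow> real (hilbert_sum (?Q k) i) = f (real_of_int i) (real k)"
      "\<forall>k i. 0 \<le> i \<longrightarrow> hilbert_sum (?Q k) i \<le> C * (nat i + e) ^ ?n"
      "\<forall>k d. module_dim \<S> (?Q k) = d \<longrightarrow>
        (\<exists>C c. \<forall>i. hilbert_sum (?Q k) i \<le> C * growth_bound (nat (d + 1)) (nat i + c))"
    using hilbert_sum_power_quotient[OF assms(1-3,5) N] by (elim exE conjE)
  obtain P where P: "\<forall>a b. coeff (coeff P a) b \<in> \<rat>" "\<forall>x y. f x y = poly (poly P [:x:]) y"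
    using bipoly_normal_form[OF f(1)] by (elim exE conjE)
  have total: "coeff (coeff P a) b = 0" if "a + b > ?n" for a b
  proof (rule total_degree_le[OF _ that])
    fix k i :: int
    \<comment> \<open>Replacing slope and offset by their non-negative parts shrinks the region to
      one where \<open>i \<ge> 0\<close>, the range of the uniform bound.\<close>
    assume k: "k \<ge> int K" and i: "i \<ge> max W 0 * k + max c 0"
    have k': "int (nat k) = k" using k by simp
    have "W * k \<le> max W 0 * k" "0 \<le> max W 0 * k" using k by (auto intro: mult_right_mono)
    then have "W * k + c \<le> i" and i0: "0 \<le> i" using i by linarith+
    then have i': "i \<ge> W * int (nat k) + c" "0 \<le> i" unfolding k' by simp_all
    have eq: "poly (poly P [:real_of_int i:]) (real_of_int k) = real (hilbert_sum (?Q (nat k)) i)"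
      using f(2)[rule_format, of "nat k" i] i'(1) k P(2) by simp
    have "real (hilbert_sum (?Q (nat k)) i) \<le> real (C * (nat i + e) ^ ?n)"
      using f(3) i'(2) by (simp only: of_nat_le_iff)
    then show "\<bar>poly (poly P [:real_of_int i:]) (real_of_int k)\<bar> \<le> real C * (real_of_int i + real e) ^ ?n"
      unfolding eq using i'(2) by simp
  qed
  obtain k0 where "\<forall>k\<ge>k0. module_dim \<S> (?Q k) = d"
    using assms(7) unfolding has_limit_dimension_def by (elim exE)
  then have k0: "module_dim \<S> (?Q k) = d" if "k \<ge> k0" for k using that by simp
  have hpoly: "real (hilbert_sum (?Q k) i) = poly (eval_coeffs P (real k)) (real_of_int i)"
    if "k \<ge> K" "i \<ge> W * int k + c" for k i
    using f(2) that P(2) by (simp add: poly_eval_coeffs)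
  have d: "d = -1 \<or> d \<ge> 0" using module_dim_ge[of "?Q k0"] k0[of k0] by auto
  then show ?thesis
  proof
    assume d: "d = -1"
    have mult: "multiplicity_module (?Q k) = 0" if k: "k \<ge> k0" for k
    proof (rule multiplicity_module_zero)
      show dim: "module_dim \<S> (?Q k) = -1" using k0[OF k] d by simp
      obtain C c where "\<forall>i. hilbert_sum (?Q k) i \<le> C * growth_bound (nat (-1 + 1)) (nat i + c)"
        using f(4)[rule_format, OF dim] by (elim exE)
      then show "\<forall>\<^sub>F x in at_top. hilbert_sum (?Q k) x = 0" by (simp add: growth_bound_def)
    qed
    have "\<forall>\<^sub>F k in sequentially. multiplicity_module (?Q k) / real k powi (int ?n - d) = 0"
      using eventually_ge_at_top[of k0] by eventually_elim (simp add: mult)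
    then have "(\<lambda>k. multiplicity_module (?Q k) / real k powi (int ?n - d)) \<longlonglongrightarrow> 0"
      by (rule tendsto_eventually)
    then show ?thesis by (intro bexI[of _ 0]) auto
  next
    assume "d \<ge> 0"
    define m where "m = nat d"
    have m: "d = int m" using \<open>d \<ge> 0\<close> by (simp add: m_def)
    have mult: "multiplicity_module (?Q k) = fact m * poly (coeff P m) (real k)" if k: "k \<ge> max k0 K" for k
    proof -
      let ?p = "eval_coeffs P (real k)"
      have dim: "module_dim \<S> (?Q k) = int m" using k0[of k] k m by simp
      obtain C c' where Cc: "\<forall>i. hilbert_sum (?Q k) i \<le> C * growth_bound (nat (int m + 1)) (nat i + c')"
        using f(4)[rule_format, OF dim] by (elim exE)
      \<comment> \<open>\<open>growth_bound (m + 1) i\<close> is \<open>(i + 1) ^ m\<close>, so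
        \<open>?B\<close> is the Krull dimension bound as a polynomial of degree at most
        \<open>m\<close>.\<close>
      let ?B = "Polynomial.smult (real C) ([:real c' + 1, 1:] ^ m)"
      have "degree ([:real c' + 1, 1:] ^ m) \<le> m"
        using degree_power_le[of "[:real c' + 1, 1:]" m] by simp
      then have degB: "degree ?B \<le> m" using degree_smult_le order_trans by blast
      have "\<forall>\<^sub>F x in sequentially. \<bar>poly ?p (real x)\<bar> \<le> poly ?B (real x)"
        using eventually_ge_at_top[of "nat (W * int k + c)"]
      proof eventually_elim
        case (elim x)
        have "real (hilbert_sum (?Q k) (int x)) = poly ?p (real x)" using hpoly[of k "int x"] k elim by simp
        moreover have "hilbert_sum (?Q k) (int x) \<le> C * (x + c' + 1) ^ m"
          using Cc[rule_format, of "int x"] by (simp add: growth_bound_def nat_add_distrib)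
        then have "real (hilbert_sum (?Q k) (int x)) \<le> real (C * (x + c' + 1) ^ m)" by (simp only: of_nat_le_iff)
        ultimately show ?case by (simp add: algebra_simps)
      qed
      then have deg: "degree ?p \<le> m" using degree_le_of_bound degB by blast
      have "\<forall>\<^sub>F x in at_top. real (hilbert_sum (?Q k) x) = poly ?p (real_of_int x)"
        using eventually_ge_at_top[of "W * int k + c"] by eventually_elim (use hpoly k in simp)
      from multiplicity_module_eq[OF this dim deg] show ?thesis by (simp add: coeff_eval_coeffs)
    qed
    show ?thesis
    proof (cases "m \<le> ?n")
      case True
      \<comment> \<open>The bound \<open>n\<close> on the total degree leaves at most
        \<open>n - m\<close> for the power of \<open>k\<close> next to \<open>x^m\<close>; division
        by \<open>k^(n - m)\<close> therefore tends to a single, rational coefficient.\<close>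
      have "degree (coeff P m) \<le> ?n - m" using total[of m] True by (intro degree_le) simp
      from tendsto_mult_left[OF poly_div_power_tendsto[OF this], of "fact m"]
      have lim: "(\<lambda>k. fact m * (poly (coeff P m) (real k) / real k ^ (?n - m))) \<longlonglongrightarrow> fact m * coeff (coeff P m) (?n - m)" .
      have pw: "real k powi (int ?n - d) = real k ^ (?n - m)" for k
      proof -
        have "int ?n - d = int (?n - m)" using True m by simp
        then show ?thesis by (simp only: power_int_of_nat)
      qed
      have "\<forall>\<^sub>F k in sequentially. fact m * (poly (coeff P m) (real k) / real k ^ (?n - m))
          = multiplicity_module (?Q k) / real k powi (int ?n - d)"
        using eventually_ge_at_top[of "max k0 K"] by eventually_elim (simp add: mult pw)
      note lim' = Lim_transform_eventually[OF lim this]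
      have "(fact m :: real) \<in> \<rat>" by (metis Rats_of_nat of_nat_fact)
      then have "fact m * coeff (coeff P m) (?n - m) \<in> \<rat>" using P(1) by (intro Rats_mult) simp_all
      then show ?thesis using lim' by (rule bexI[rotated])
    next
      case False
      \<comment> \<open>For \<open>m > n\<close> the bound on the total degree makes the coefficient
        of \<open>x^m\<close> vanish identically, so the multiplicities are eventually 0 and the
        negative exponent has no effect.\<close>
      have z: "coeff P m = 0" using total[of m] False by (intro poly_eqI) simp
      have "\<forall>\<^sub>F k in sequentially. multiplicity_module (?Q k) / real k powi (int ?n - d) = 0"
        using eventually_ge_at_top[of "max k0 K"] by eventually_elim (simp add: mult z)
      then have "(\<lambda>k. multiplicity_module (?Q k) / real k powi (int ?n - d)) \<longlonglongrightarrow> 0"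
        by (rule tendsto_eventually)
      then show ?thesis by (intro bexI[of _ 0]) auto
    qed
  qed
qed


end
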